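(* Let $\{V^{(\nu)}_j\}_{j\in\mathbb Z}$, $\nu\in V_{\mathbb Q}$, be one-dimensional multiresolution analyses (in $L^2(\mathbb R)$ for $\nu=\infty$, in $L^2(\mathbb Q_p)$ for $\nu=p$ prime), and let $\phi^{(\nu)}$ be the refinable function of $\{V^{(\nu)}_j\}_{j\in\mathbb Z}$, where $\phi^{(p)}(x_p)=\Omega(|x_p|_p)$ for every prime $p$. Let $$\Phi(x)=\phi^{(\infty)}(x_\infty)\otimes\phi^{(2)}(x_2)\otimes\cdots\otimes\phi^{(p)}(x_p)\otimes\cdots,\quad x\in\mathbb A,$$ and $$V_j=\overline{\mathrm{span}\,(V_j^{[m]}:m\in V_{\mathbb Q})}=\overline{\mathrm{span}\,\{M^{-j}_{(m)}T_{\widehat a}\Phi:\ \widehat a\in I_{\mathbb A},\ m(\widehat a)=m\in V_{\mathbb Q}\}},\quad j\in\mathbb Z,$$ where $V_j^{[m]}=\Big(\bigotimes_{\nu\in\{\infty,2,3,\dots,m\}}V_j^{(\nu)}\Big)\otimes\bigotimes_{q>m}\phi^{(q)}\subset L^2(\mathbb A,dx)$. Then $$V_j=\bigotimes_{e;\,\nu\in V_{\mathbb Q}}V_j^{(\nu)}\subset L^2(\mathbb A,dx),\qquad j\in\{0,1,2,\dots\},$$ where $e=(\phi^{(\nu)})_\nu$ is the stabilizing sequence, and the subspaces $V_j$ satisfy the following properties: (a) $V_j\subset V_{j+1}$ for all $j\in\mathbb Z$; (b) $\bigcup_{j\in\mathbb Z}V_j$ is dense in $L^2(\mathbb A,dx)$;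 (c) $\bigcap_{j\in\mathbb Z}V_j=\{0\}$; (d) $f\in V_j^{[m]}\iff M^{-1}_{(m)}f\in V_{j+1}^{[m]}$ for all $j\in\mathbb Z$ and any $m\in V_{\mathbb Q}$; (e) the function $\Phi\in V_0$ is such that the system $\{\Phi(x-\widehat a):\widehat a\in I_{\mathbb A}\}$ is an orthonormal basis for $V_0$.
   Context: $V_{\mathbb Q}=\{\infty,2,3,5,\dots\}$ is ordered by $\infty<2<3<5<\cdots$. For a prime $p$: $\mathbb Q_p$, $|\cdot|_p$, $\mathbb Z_p$ are the $p$-adic numbers, norm, and integers; $dx_p$ is Haar measure with $\mathbb Z_p$ of measure 1; $\Omega$ is the characteristic function of $[0,1]$. $\mathbb Q_\infty=\mathbb R$ with Lebesgue measure. $\mathbb A$ is the adele ring of $\mathbb Q$ (all $(x_\nu)_{\nu\in V_{\mathbb Q}}$ with $x_p\in\mathbb Z_p$ for almost all primes $p$) with Haar measure $dx=dx_\infty dx_2dx_3\cdots$. A multiresolution analysis in $L^2(\mathbb R)$ (resp. $L^2(\mathbb Q_p)$) is a family of closed subspaces $V_j$, $j\in\mathbb Z$, such that: $V_j\subset V_{j+1}$; $\bigcup_jV_j$ is dense; $\bigcap_jV_j=\{0\}$; $f\in V_j\iff f(2\,\cdot)\in V_{j+1}$ (resp. $f(p^{-1}\cdot)\in V_{j+1}$) for all $j$; and there is $\phi\in V_0$ (the refinable function) such that $\{\phi(\cdot-n):n\in\mathbb Z\}$ (resp. $\{\phi(\cdot-a):a\in I_p\}$) is an orthonormal basis of $V_0$.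 Here $I_p\subset\mathbb Q_p$ is the set of finite sums $a_{-\gamma}p^{-\gamma}+\dots+a_{-1}p^{-1}$ with $a_i\in\{0,\dots,p-1\}$ (including $0$). $I_{\mathbb A}$ is the set of $\widehat a=(a_\infty,a_2,a_3,\dots)$ with $a_\infty\in\mathbb Z$, $a_p\in I_p$, and $a_p=0$ for all sufficiently large $p$; $m(\widehat a)=\min\{p\in V_{\mathbb Q}:a_q=0\text{ for all }q>p\}$. $T_{\widehat a}$ is the shift $(T_{\widehat a}f)(x)=f(x-\widehat a)$. $L^2(\mathbb A,dx)$ is identified with the infinite tensor product of the spaces $L^2(\mathbb Q_\nu,dx_\nu)$ with stabilizing vectors $\phi^{(\nu)}$, a tensor $\otimes f_\nu$ with $f_\nu=\phi^{(\nu)}$ for almost all $\nu$ being the function $\prod_\nu f_\nu(x_\nu)$. For closed subspaces $X_\nu\ni\phi^{(\nu)}$, $\bigotimes_{e;\nu}X_\nu$ is the closed linear span of all functions $\prod_\nu f_\nu(x_\nu)$ with $f_\nu\in X_\nu$ and $f_\nu=\phi^{(\nu)}$ for almost all $\nu$. In $V_j^{[m]}$ the tensor product over $\nu\le m$ is the finite Hilbert space tensor product. For $m\in V_{\mathbb Q}$ and $j\in\mathbb Z$, $M^{-j}_{(m)}$ is the dilation operator on $L^2(\mathbb A,dx)$ acting on product functions by $$\prod_\nu f_\nu(x_\nu)\mapsto 2^{j/2}f_\infty(2^jx_\infty)\prod_{2\le q\le m}q^{j/2}f_q(q^{-j}x_q)\prod_{q>m}f_q(x_q),$$ so that for $m=m(\widehat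 a)$ $$(M^{-j}_{(m)}T_{\widehat a}\Phi)(x)=2^{j/2}\phi^{(\infty)}(2^jx_\infty-a_\infty)\prod_{2\le q\le m}q^{j/2}\phi^{(q)}(q^{-j}x_q-a_q)\prod_{q>m}\phi^{(q)}(x_q).$$
   Formalization: The displayed equality of the two closed spans defining V_j fails for every j<0; it is proved for j≥0, with the span of the M^{-j}_{(m)}T_aΦ contained in the span of the V_j^{[m]} for all j, and every other claim is proved for V_j being either of the two spans. *)

theory Defs
  imports "HOL-Analysis.Analysis" "HOL-Computational_Algebra.Primes"
begin

section \<open>Complex $L^2$ spaces\<close>

text \<open>
  Elements of $L^2$ are represented by square-integrable functions.  All closed subspaces below
  are closed under changing a function on a null set, so equality of such sets of
  functions is equality of the corresponding subspaces of $L^2$.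
\<close>

definition L2 :: "'a measure \<Rightarrow> ('a \<Rightarrow> complex) set" where
  "L2 M = {f \<in> borel_measurable M. integrable M (\<lambda>x. (cmod (f x))\<^sup>2)}"

definition l2_inner :: "'a measure \<Rightarrow> ('a \<Rightarrow> complex) \<Rightarrow> ('a \<Rightarrow> complex) \<Rightarrow> complex" where
  "l2_inner M f g = (LINT x|M. f x * cnj (g x))"

definition l2_norm :: "'a measure \<Rightarrow> ('a \<Rightarrow> complex) \<Rightarrow> real" where
  "l2_norm M f = sqrt (LINT x|M. (cmod (f x))\<^sup>2)"

definition l2_zero :: "'a measure \<Rightarrow> ('a \<Rightarrow> complex) set" where
  "l2_zero M = {f \<in> L2 M. AE x in M. f x = 0}"

definition l2_closure :: "'a measure \<Rightarrow> ('a \<Rightarrow> complex) set \<Rightarrow> ('a \<Rightarrow> complex) set" where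
  "l2_closure M W = {f \<in> L2 M. \<forall>\<epsilon>>0. \<exists>g \<in> W \<inter> L2 M. l2_norm M (\<lambda>x. f x - g x) < \<epsilon>}"

definition lin_span :: "('a \<Rightarrow> complex) set \<Rightarrow> ('a \<Rightarrow> complex) set" where
  "lin_span S = {(\<lambda>x. \<Sum>g\<in>F. c g * g x) |c F. finite F \<and> F \<subseteq> S}"

definition closed_span :: "'a measure \<Rightarrow> ('a \<Rightarrow> complex) set \<Rightarrow> ('a \<Rightarrow> complex) set" where
  "closed_span M S = l2_closure M (lin_span S)"

definition closed_subspace :: "'a measure \<Rightarrow> ('a \<Rightarrow> complex) set \<Rightarrow> bool" where
  "closed_subspace M V \<longleftrightarrow> V \<subseteq> L2 M \<and> lin_span V \<subseteq> V \<and> l2_closure M V \<subseteq> V"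

definition l2_dense :: "'a measure \<Rightarrow> ('a \<Rightarrow> complex) set \<Rightarrow> bool" where
  "l2_dense M W \<longleftrightarrow> W \<subseteq> L2 M \<and> l2_closure M W = L2 M"

definition orthonormal_basis ::
    "'a measure \<Rightarrow> 'i set \<Rightarrow> ('i \<Rightarrow> 'a \<Rightarrow> complex) \<Rightarrow> ('a \<Rightarrow> complex) set \<Rightarrow> bool" where
  "orthonormal_basis M I u V \<longleftrightarrow>
     (\<forall>i\<in>I. u i \<in> V) \<and>
     (\<forall>i\<in>I. \<forall>k\<in>I. l2_inner M (u i) (u k) = (if i = k then 1 else 0)) \<and>
     closed_span M (u ` I) = V"


section \<open>The $p$-adic numbers\<close>

definition rat_padic_norm :: "nat \<Rightarrow> rat \<Rightarrow> real" where
  "rat_padic_norm p r =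
     (if r = 0 then 0
      else real p powi (int (multiplicity (int p) (snd (quotient_of r)))
                        - int (multiplicity (int p) (fst (quotient_of r)))))"

definition padic_cauchy :: "nat \<Rightarrow> (nat \<Rightarrow> rat) \<Rightarrow> bool" where
  "padic_cauchy p X \<longleftrightarrow>
     (\<forall>\<epsilon>>0. \<exists>N. \<forall>m\<ge>N. \<forall>n\<ge>N. rat_padic_norm p (X m - X n) < \<epsilon>)"

definition padic_rel :: "nat \<Rightarrow> ((nat \<Rightarrow> rat) \<times> (nat \<Rightarrow> rat)) set" where
  "padic_rel p = {(X, Y). padic_cauchy p X \<and> padic_cauchy p Y \<and>
                          (\<lambda>n. rat_padic_norm p (X n - Y n)) \<longlonglongrightarrow> 0}"

text \<open>
  $\mathbf{Q}_p$ is the completion of the rationals: a $p$-adic number is an equivalence class of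
  Cauchy sequences.  The type is the same for every $p$; the carrier is the set Qp p.
\<close>

type_synonym padic = "(nat \<Rightarrow> rat) set"

definition Qp :: "nat \<Rightarrow> padic set" where
  "Qp p = {X. padic_cauchy p X} // padic_rel p"

definition padic_of_rat :: "nat \<Rightarrow> rat \<Rightarrow> padic" where
  "padic_of_rat p r = padic_rel p `` {\<lambda>_. r}"

definition padic_diff :: "nat \<Rightarrow> padic \<Rightarrow> padic \<Rightarrow> padic" where
  "padic_diff p x y = padic_rel p `` {(\<lambda>n. X n - Y n) |X Y. X \<in> x \<and> Y \<in> y}"

definition padic_mult :: "nat \<Rightarrow> padic \<Rightarrow> padic \<Rightarrow> padic" where
  "padic_mult p x y = padic_rel p `` {(\<lambda>n. X n * Y n) |X Y. X \<in> x \<and> Y \<in> y}"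

definition padic_norm :: "nat \<Rightarrow> padic \<Rightarrow> real" where
  "padic_norm p x = (THE l. \<forall>X\<in>x. (\<lambda>n. rat_padic_norm p (X n)) \<longlonglongrightarrow> l)"

definition Zp :: "nat \<Rightarrow> padic set" where
  "Zp p = {x \<in> Qp p. padic_norm p x \<le> 1}"

definition padic_open :: "nat \<Rightarrow> padic set \<Rightarrow> bool" where
  "padic_open p U \<longleftrightarrow>
     U \<subseteq> Qp p \<and>
     (\<forall>x\<in>U. \<exists>\<epsilon>>0. \<forall>y\<in>Qp p. padic_norm p (padic_diff p y x) < \<epsilon> \<longrightarrow> y \<in> U)"

text \<open>The Haar measure on the Borel sets of $\mathbf{Q}_p$, normalised on the integers.\<close>

definition padic_haar :: "nat \<Rightarrow> padic measure \<Rightarrow> bool" where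
  "padic_haar p \<mu> \<longleftrightarrow>
     space \<mu> = Qp p \<and>
     sets \<mu> = sigma_sets (Qp p) {U. padic_open p U} \<and>
     (\<forall>a\<in>Qp p. \<forall>B\<in>sets \<mu>. emeasure \<mu> ((\<lambda>x. padic_diff p x a) ` B) = emeasure \<mu> B) \<and>
     emeasure \<mu> (Zp p) = 1"

definition Ip :: "nat \<Rightarrow> padic set" where
  "Ip p = {padic_of_rat p (\<Sum>i=1..\<gamma>. of_nat (a i) / of_nat p ^ i) |a \<gamma>. \<forall>i. a i < p}"


section \<open>One-dimensional multiresolution analyses\<close>

definition real_mra :: "(int \<Rightarrow> (real \<Rightarrow> complex) set) \<Rightarrow> (real \<Rightarrow> complex) \<Rightarrow> bool" where
  "real_mra V \<phi> \<longleftrightarrow>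
     (\<forall>j. closed_subspace lborel (V j)) \<and>
     (\<forall>j. V j \<subseteq> V (j + 1)) \<and>
     l2_dense lborel (\<Union>j. V j) \<and>
     (\<Inter>j. V j) = l2_zero lborel \<and>
     (\<forall>j. \<forall>f \<in> L2 lborel. f \<in> V j \<longleftrightarrow> (\<lambda>x. f (2 * x)) \<in> V (j + 1)) \<and>
     \<phi> \<in> V 0 \<and>
     orthonormal_basis lborel (UNIV :: int set) (\<lambda>n x. \<phi> (x - of_int n)) (V 0)"

definition padic_mra ::
    "nat \<Rightarrow> padic measure \<Rightarrow> (int \<Rightarrow> (padic \<Rightarrow> complex) set) \<Rightarrow> (padic \<Rightarrow> complex) \<Rightarrow> bool" where
  "padic_mra p \<mu> V \<phi> \<longleftrightarrow>
     (\<forall>j. closed_subspace \<mu> (V j)) \<and>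
     (\<forall>j. V j \<subseteq> V (j + 1)) \<and>
     l2_dense \<mu> (\<Union>j. V j) \<and>
     (\<Inter>j. V j) = l2_zero \<mu> \<and>
     (\<forall>j. \<forall>f \<in> L2 \<mu>.
        f \<in> V j \<longleftrightarrow> (\<lambda>x. f (padic_mult p (padic_of_rat p (1 / of_nat p)) x)) \<in> V (j + 1)) \<and>
     \<phi> \<in> V 0 \<and>
     orthonormal_basis \<mu> (Ip p) (\<lambda>a x. \<phi> (padic_diff p x a)) (V 0)"


section \<open>The adeles\<close>

text \<open>
  The place $\infty$ is encoded by 0, so that the order of the natural numbers is the
  order $\infty < 2 < 3 < 5 < \cdots$ of the places.
\<close>

definition places :: "nat set" where
  "places = insert 0 {p. prime p}"

text \<open>
  An adele is a pair of its real component and the family of its $p$-adic components,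
  the latter being undefined at indices that are not prime.
\<close>

type_synonym adele = "real \<times> (nat \<Rightarrow> padic)"

definition adeles :: "adele set" where
  "adeles = {x. snd x \<in> (\<Pi>\<^sub>E p\<in>{p. prime p}. Qp p) \<and> finite {p. prime p \<and> snd x p \<notin> Zp p}}"

definition adele_diff :: "adele \<Rightarrow> adele \<Rightarrow> adele" where
  "adele_diff x y = (fst x - fst y, \<lambda>p\<in>{p. prime p}. padic_diff p (snd x p) (snd y p))"

definition adele_box :: "real set \<Rightarrow> (nat \<Rightarrow> padic set) \<Rightarrow> adele set" where
  "adele_box B C = B \<times> (\<Pi>\<^sub>E p\<in>{p. prime p}. C p)"

definition adele_box_sides :: "(nat \<Rightarrow> padic measure) \<Rightarrow> (real set \<times> (nat \<Rightarrow> padic set)) set" where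
  "adele_box_sides \<mu> =
     {(B, C). B \<in> sets lborel \<and> (\<forall>p. prime p \<longrightarrow> C p \<in> sets (\<mu> p)) \<and>
              finite {p. prime p \<and> C p \<noteq> Zp p}}"

text \<open>
  The measure $dx = dx_\infty\,dx_2\,dx_3\cdots$.  The restricted product topology is second
  countable, and its Borel sets are generated by the measurable boxes almost all of whose
  sides are the integers.  Those sides contribute a factor 1.
\<close>

definition adele_haar :: "(nat \<Rightarrow> padic measure) \<Rightarrow> adele measure \<Rightarrow> bool" where
  "adele_haar \<mu> A \<longleftrightarrow>
     space A = adeles \<and>
     sets A = sigma_sets adeles {adele_box B C |B C. (B, C) \<in> adele_box_sides \<mu>} \<and>
     (\<forall>(B, C) \<in> adele_box_sides \<mu>.
        emeasure A (adele_box B C) =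
          emeasure lborel B * (\<Prod>p | prime p \<and> C p \<noteq> Zp p. emeasure (\<mu> p) (C p)))"

definition IA :: "adele set" where
  "IA = {a. fst a \<in> \<int> \<and> snd a \<in> (\<Pi>\<^sub>E p\<in>{p. prime p}. Ip p) \<and>
            (\<exists>N. \<forall>p>N. prime p \<longrightarrow> snd a p = padic_of_rat p 0)}"

definition top_place :: "adele \<Rightarrow> nat" where
  "top_place a =
     (LEAST m. m \<in> places \<and> (\<forall>q>m. prime q \<longrightarrow> snd a q = padic_of_rat q 0))"


section \<open>Tensor products and operators on functions of adeles\<close>

text \<open>At every adele only finitely many factors of the products considered here differ from 1.\<close>

definition tensor ::
    "(real \<Rightarrow> complex) \<Rightarrow> (nat \<Rightarrow> padic \<Rightarrow> complex) \<Rightarrow> adele \<Rightarrow> complex" where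
  "tensor f g x = f (fst x) * (\<Prod>p | prime p \<and> g p (snd x p) \<noteq> 1. g p (snd x p))"

definition tensor_space ::
    "adele measure \<Rightarrow> (nat \<Rightarrow> padic \<Rightarrow> complex) \<Rightarrow>
     (real \<Rightarrow> complex) set \<Rightarrow> (nat \<Rightarrow> (padic \<Rightarrow> complex) set) \<Rightarrow> (adele \<Rightarrow> complex) set" where
  "tensor_space A \<phi>p Xr Xp =
     closed_span A {tensor f g |f g. f \<in> Xr \<and> (\<forall>p. prime p \<longrightarrow> g p \<in> Xp p) \<and>
                                     finite {p. prime p \<and> g p \<noteq> \<phi>p p}}"

definition shift :: "adele \<Rightarrow> (adele \<Rightarrow> complex) \<Rightarrow> adele \<Rightarrow> complex" where
  "shift a f x = f (adele_diff x a)"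

text \<open>
  dilation m j is the operator $M^{-j}_{(m)}$.  The formula on product functions determines
  it as composition with a coordinatewise scaling of the adeles, times a constant.
\<close>

definition dilation :: "nat \<Rightarrow> int \<Rightarrow> (adele \<Rightarrow> complex) \<Rightarrow> adele \<Rightarrow> complex" where
  "dilation m j f x =
     complex_of_real (2 powr (of_int j / 2) * (\<Prod>q | prime q \<and> q \<le> m. real q powr (of_int j / 2)))
     * f (2 powi j * fst x,
          \<lambda>q\<in>{q. prime q}.
            if q \<le> m then padic_mult q (padic_of_rat q (of_nat q powi (- j))) (snd x q)
            else snd x q)"

text \<open>The space $V_j^{[m]}$.\<close>

definition V_bracket ::
    "adele measure \<Rightarrow> (int \<Rightarrow> (real \<Rightarrow> complex) set) \<Rightarrow> (nat \<Rightarrow> int \<Rightarrow> (padic \<Rightarrow> complex) set) \<Rightarrow>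
     (nat \<Rightarrow> padic \<Rightarrow> complex) \<Rightarrow> nat \<Rightarrow> int \<Rightarrow> (adele \<Rightarrow> complex) set" where
  "V_bracket A Vr Vp \<phi>p m j =
     closed_span A {tensor f g |f g. f \<in> Vr j \<and>
                      (\<forall>p. prime p \<longrightarrow> (if p \<le> m then g p \<in> Vp p j else g p = \<phi>p p))}"

text \<open>
  The two closed spans commonly written $V_j$.  They agree for $j \ge 0$, but for $j < 0$ the
  second one is a proper subspace of the first: the function
  $\phi^{(\infty)}_{j,0} \otimes (\mathbf{1}_{2^j\mathbf{Z}_2} - \mathbf{1}_{\mathbf{Z}_2})
  \otimes \phi^{(3)} \otimes \cdots$ is orthogonal to all $M^{-j}_{(m)}T_a\Phi$ with
  $m = m(a)$, but not to $V_j^{[2]}$.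
\<close>

definition V_by_brackets ::
    "adele measure \<Rightarrow> (int \<Rightarrow> (real \<Rightarrow> complex) set) \<Rightarrow> (nat \<Rightarrow> int \<Rightarrow> (padic \<Rightarrow> complex) set) \<Rightarrow>
     (nat \<Rightarrow> padic \<Rightarrow> complex) \<Rightarrow> int \<Rightarrow> (adele \<Rightarrow> complex) set" where
  "V_by_brackets A Vr Vp \<phi>p j = closed_span A (\<Union>m\<in>places. V_bracket A Vr Vp \<phi>p m j)"

definition V_by_translates ::
    "adele measure \<Rightarrow> (adele \<Rightarrow> complex) \<Rightarrow> int \<Rightarrow> (adele \<Rightarrow> complex) set" where
  "V_by_translates A \<Phi> j =
     closed_span A {dilation m j (shift a \<Phi>) |m a. a \<in> IA \<and> m \<in> places \<and> top_place a = m}"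

end

theory Submission
  imports Defs
begin

text \<open>
  Every space involved is a closed linear span, so the identifications reduce to two facts: a
  tensor lies in a closed span of tensors as soon as its finitely many nonstandard factors do, and
  the $p$-adic basis functions are indicators of balls.  A ball of level $j$ is the disjoint union
  of $p$ balls of level $j + 1$, and a ball that misses 0 splits into balls that miss 0; this
  makes the translates increase with $j$ and, for $j \ge 0$, expresses the ball around 0 by
  $\phi^{(p)}$ and balls that miss 0.  The measure on the adeles is a product of the real line
  and the finite adeles, so a function in all $V_j$ integrates over a box of finite adeles to a
  function in all $V_j^{(\infty)}$, that is, to 0; hence it vanishes.  Dilations multiply the
  measure by a constant because the $p$-adic Haar measure is determined by its values on balls.
\<close>

section \<open>Closed spans in $L^2$\<close>

text \<open>The two spans called V_j differ at negative levels, and the theorem covers either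
  choice, so each property is taken from the side where it is accessible. Density uses nonnegative
  levels only: there \<open>\<phi>p\<close> lies in every local space and the two spans agree. The
  zero intersection is proved for the larger span and inherited by the smaller one. The inclusion of
  V_j in V_{j+1} has no such shortcut. It is proved for each span, and for the translates the
  obstacle is the condition m(a) = m, which forbids the index 0 at the last place. Refinement must
  not create that index, which rests on the fact that a nonzero element of I_p has norm above 1.
  This is read off from the assumed orthonormality: two translates at distance at most 1 would be
  the same indicator. The adelic measure is known on boxes only, and the finite adeles are not a
  box. Hence the exhaustion by cells and the restriction to adeles that are integral outside a
  finite set of primes, on which a tensor is a finite product.\<close>

definition l2_sq :: "'a measure \<Rightarrow> ('a \<Rightarrow> complex) \<Rightarrow> real" where
  "l2_sq M f = (LINT x|M. (cmod (f x))\<^sup>2)"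

lemma l2_sq_nonneg [simp]: "0 \<le> l2_sq M f"
  unfolding l2_sq_def by (rule Bochner_Integration.integral_nonneg) simp

lemma L2_D: "f \<in> L2 M \<Longrightarrow> f \<in> borel_measurable M" "f \<in> L2 M \<Longrightarrow> integrable M (\<lambda>x. (cmod (f x))\<^sup>2)"
  by (auto simp: L2_def)

lemma L2_cong: "(\<And>x. x \<in> space M \<Longrightarrow> f x = g x) \<Longrightarrow> f \<in> L2 M \<longleftrightarrow> g \<in> L2 M"
  unfolding L2_def
  by (simp cong: measurable_cong Bochner_Integration.integrable_cong)

lemma l2_sq_cong: "(\<And>x. x \<in> space M \<Longrightarrow> f x = g x) \<Longrightarrow> l2_sq M f = l2_sq M g"
  unfolding l2_sq_def by (rule Bochner_Integration.integral_cong) auto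

lemma cmod_add_sq_le: "(cmod (a + b))\<^sup>2 \<le> 2 * (cmod a)\<^sup>2 + 2 * (cmod b)\<^sup>2"
proof -
  have "(cmod (a + b))\<^sup>2 \<le> (cmod a + cmod b)\<^sup>2"
    by (intro power_mono norm_triangle_ineq) auto
  also have "\<dots> \<le> 2 * (cmod a)\<^sup>2 + 2 * (cmod b)\<^sup>2"
    using sum_squares_ge_zero[of "cmod a - cmod b" 0] by (simp add: power2_eq_square algebra_simps)
  finally show ?thesis .
qed

lemma L2_zero [simp]: "(\<lambda>x. 0) \<in> L2 M"
  by (simp add: L2_def)

lemma L2_scale [intro]: "f \<in> L2 M \<Longrightarrow> (\<lambda>x. c * f x) \<in> L2 M"
  by (auto simp: L2_def norm_mult power_mult_distrib)

lemma L2_add [intro]: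
  assumes "f \<in> L2 M" "g \<in> L2 M" shows "(\<lambda>x. f x + g x) \<in> L2 M"
proof -
  have [measurable]: "f \<in> borel_measurable M" "g \<in> borel_measurable M"
    and i: "integrable M (\<lambda>x. (cmod (f x))\<^sup>2)" "integrable M (\<lambda>x. (cmod (g x))\<^sup>2)"
    using assms by (auto simp: L2_def)
  have "integrable M (\<lambda>x. (cmod (f x + g x))\<^sup>2)"
    by (rule Bochner_Integration.integrable_bound[of _ "\<lambda>x. 2 * (cmod (f x))\<^sup>2 + 2 * (cmod (g x))\<^sup>2"])
      (use i in \<open>auto intro!: AE_I2 cmod_add_sq_le order_trans[OF _ abs_ge_self]\<close>)
  then show ?thesis by (simp add: L2_def)
qed

lemma L2_diff [intro]: "f \<in> L2 M \<Longrightarrow> g \<in> L2 M \<Longrightarrow> (\<lambda>x. f x - g x) \<in> L2 M"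
  using L2_add[of f M "\<lambda>x. -1 * g x"] L2_scale[of g M "-1"] by simp

lemma L2_sum [intro]: "(\<And>i. i \<in> F \<Longrightarrow> f i \<in> L2 M) \<Longrightarrow> (\<lambda>x. \<Sum>i\<in>F. f i x) \<in> L2 M"
  by (induction F rule: infinite_finite_induct) (auto intro: L2_add)

lemma L2_indicator:
  assumes "E \<in> sets M" "emeasure M E < \<infinity>" shows "(\<lambda>x. indicator E x) \<in> L2 M"
proof -
  have "(\<lambda>x. (cmod (indicator E x))\<^sup>2) = indicator E" by (auto simp: indicator_def)
  then show ?thesis using assms by (simp add: L2_def)
qed

lemma l2_sq_scale: "l2_sq M (\<lambda>x. c * f x) = (cmod c)\<^sup>2 * l2_sq M f"
  by (simp add: l2_sq_def norm_mult power_mult_distrib)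

text \<open>Substitute for Minkowski's inequality: the lost factor 2 does no harm in approximation
  arguments, and no square root has to be handled.\<close>

lemma l2_sq_add_le:
  assumes "f \<in> L2 M" "g \<in> L2 M"
  shows "l2_sq M (\<lambda>x. f x + g x) \<le> 2 * l2_sq M f + 2 * l2_sq M g"
proof -
  have "l2_sq M (\<lambda>x. f x + g x) \<le> (LINT x|M. 2 * (cmod (f x))\<^sup>2 + 2 * (cmod (g x))\<^sup>2)"
    unfolding l2_sq_def
    by (rule integral_mono) (use assms L2_add[OF assms] in \<open>auto simp: L2_D cmod_add_sq_le\<close>)
  also have "\<dots> = 2 * l2_sq M f + 2 * l2_sq M g"
    using assms by (simp add: l2_sq_def L2_D)
  finally show ?thesis .
qed

lemma l2_sq_cong_AE:
  assumes "f \<in> L2 M" "g \<in> L2 M" "AE x in M. f x = g x"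
  shows "l2_sq M f = l2_sq M g"
  unfolding l2_sq_def
proof (rule integral_cong_AE)
  show "(\<lambda>x. (cmod (f x))\<^sup>2) \<in> borel_measurable M" "(\<lambda>x. (cmod (g x))\<^sup>2) \<in> borel_measurable M"
    using assms(1,2) by (auto simp: L2_def)
qed (use assms(3) in auto)

lemma l2_sq_eq_0_iff: "f \<in> L2 M \<Longrightarrow> l2_sq M f = 0 \<longleftrightarrow> (AE x in M. f x = 0)"
  unfolding l2_sq_def by (subst integral_nonneg_eq_0_iff_AE) (auto simp: L2_D)

lemma l2_norm_less_iff: "0 < e \<Longrightarrow> l2_norm M f < e \<longleftrightarrow> l2_sq M f < e\<^sup>2"
  unfolding l2_norm_def l2_sq_def[symmetric]
  by (metis abs_of_pos real_sqrt_abs real_sqrt_less_iff)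

lemma l2_closure_iff:
  "f \<in> l2_closure M W \<longleftrightarrow> f \<in> L2 M \<and> (\<forall>e>0. \<exists>g\<in>W \<inter> L2 M. l2_sq M (\<lambda>x. f x - g x) < e)"
proof -
  have "(\<forall>e>0. \<exists>g\<in>W \<inter> L2 M. l2_norm M (\<lambda>x. f x - g x) < e) \<longleftrightarrow>
        (\<forall>e>0. \<exists>g\<in>W \<inter> L2 M. l2_sq M (\<lambda>x. f x - g x) < e)" (is "?L \<longleftrightarrow> ?R")
  proof safe
    fix e :: real assume L: ?L and e: "e > 0"
    then obtain g where "g \<in> W \<inter> L2 M" "l2_norm M (\<lambda>x. f x - g x) < sqrt e"
      by (meson real_sqrt_gt_zero)
    then show "\<exists>g\<in>W \<inter> L2 M. l2_sq M (\<lambda>x. f x - g x) < e" using e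
      by (auto simp: l2_norm_less_iff)
  next
    fix e :: real assume ?R and e: "e > 0"
    then obtain g where "g \<in> W \<inter> L2 M" "l2_sq M (\<lambda>x. f x - g x) < e\<^sup>2"
      by (meson zero_less_power)
    then show "\<exists>g\<in>W \<inter> L2 M. l2_norm M (\<lambda>x. f x - g x) < e" using e
      by (auto simp: l2_norm_less_iff)
  qed
  then show ?thesis by (auto simp: l2_closure_def)
qed

text \<open>The distance to each approximant does not see null sets, so neither does the closure.
  This repairs representatives after operators that are linear only almost everywhere.\<close>

lemma l2_closure_cong_AE:
  assumes "f \<in> l2_closure M W" "g \<in> L2 M" "AE x in M. f x = g x"
  shows "g \<in> l2_closure M W"
  unfolding l2_closure_iff
proof safe
  fix e :: real assume "e > 0"
  then obtain h where h: "h \<in> W" "h \<in> L2 M" "l2_sq M (\<lambda>x. f x - h x) < e"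
    using assms(1) by (auto simp: l2_closure_iff)
  have "l2_sq M (\<lambda>x. f x - h x) = l2_sq M (\<lambda>x. g x - h x)"
    using assms h by (intro l2_sq_cong_AE L2_diff) (auto simp: l2_closure_iff)
  then show "\<exists>h\<in>W \<inter> L2 M. l2_sq M (\<lambda>x. g x - h x) < e" using h by auto
qed (use assms in auto)

lemma l2_closure_subset_L2: "l2_closure M W \<subseteq> L2 M"
  by (auto simp: l2_closure_iff)

lemma l2_closure_base: "f \<in> W \<Longrightarrow> f \<in> L2 M \<Longrightarrow> f \<in> l2_closure M W"
  by (auto simp: l2_closure_iff l2_sq_def intro!: bexI[of _ f])

lemma l2_closure_mono: "W \<subseteq> W' \<Longrightarrow> l2_closure M W \<subseteq> l2_closure M W'"
  unfolding l2_closure_def by blast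

text \<open>Approximants are approximated in turn: two errors below e/4 give a total below e by
  \<open>l2_sq_add_le\<close>. Applied to a closure \<open>W\<close> of \<open>W'\<close> this is
  idempotence.\<close>

lemma l2_closure_minimal:
  assumes "W \<inter> L2 M \<subseteq> l2_closure M W'" shows "l2_closure M W \<subseteq> l2_closure M W'"
proof
  fix f assume f: "f \<in> l2_closure M W"
  show "f \<in> l2_closure M W'" unfolding l2_closure_iff
  proof safe
    show "f \<in> L2 M" using f l2_closure_subset_L2 by blast
    fix e :: real assume e: "e > 0"
    obtain g where g: "g \<in> W" "g \<in> L2 M" "l2_sq M (\<lambda>x. f x - g x) < e / 4"
      using f e by (auto simp: l2_closure_iff dest!: spec[of _ "e/4"])
    then have "g \<in> l2_closure M W'" using assms by auto
    then obtain h where h: "h \<in> W'" "h \<in> L2 M" "l2_sq M (\<lambda>x. g x - h x) < e / 4"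
      using e by (auto simp: l2_closure_iff dest!: spec[of _ "e/4"])
    have "l2_sq M (\<lambda>x. (f x - g x) + (g x - h x)) \<le> 2 * l2_sq M (\<lambda>x. f x - g x) + 2 * l2_sq M (\<lambda>x. g x - h x)"
      using \<open>f \<in> L2 M\<close> g h by (intro l2_sq_add_le) auto
    also have "\<dots> < e" using g h by simp
    finally show "\<exists>g\<in>W' \<inter> L2 M. l2_sq M (\<lambda>x. f x - g x) < e" using h by auto
  qed
qed

section \<open>Linear spans and their closures\<close>

lemma lin_span_base: "f \<in> S \<Longrightarrow> f \<in> lin_span S"
  unfolding lin_span_def by (force intro!: exI[of _ "\<lambda>_. 1"] exI[of _ "{f}"])

lemma lin_span_zero: "(\<lambda>x. 0) \<in> lin_span S"
  unfolding lin_span_def by (force intro!: exI[of _ "{}"])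

lemma lin_span_mono: "S \<subseteq> T \<Longrightarrow> lin_span S \<subseteq> lin_span T"
  unfolding lin_span_def by blast

lemma lin_span_add:
  assumes "f \<in> lin_span S" "g \<in> lin_span S" shows "(\<lambda>x. f x + c * g x) \<in> lin_span S"
proof -
  obtain a F b G where F: "finite F" "F \<subseteq> S" "f = (\<lambda>x. \<Sum>h\<in>F. a h * h x)"
    and G: "finite G" "G \<subseteq> S" "g = (\<lambda>x. \<Sum>h\<in>G. b h * h x)"
    using assms unfolding lin_span_def by blast
  \<comment> \<open>Both coefficient families are extended by 0 to the union of the index sets; a
    function in both sets receives the sum of its coefficients.\<close>
  define d where "d h = (if h \<in> F then a h else 0) + (if h \<in> G then c * b h else 0)" for h
  have "f x + c * g x = (\<Sum>h\<in>F \<union> G. d h * h x)" for x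
  proof -
    have "f x = (\<Sum>h\<in>F \<union> G. (if h \<in> F then a h else 0) * h x)"
      using F G by (auto intro!: sum.mono_neutral_cong_left)
    moreover have "c * g x = (\<Sum>h\<in>F \<union> G. (if h \<in> G then c * b h else 0) * h x)"
      using F G by (auto simp: sum_distrib_left mult.assoc intro!: sum.mono_neutral_cong_left)
    ultimately show ?thesis by (simp add: d_def sum.distrib algebra_simps)
  qed
  then show ?thesis using F G unfolding lin_span_def
    by (intro CollectI exI[of _ d] exI[of _ "F \<union> G"]) auto
qed

lemma closed_span_subset_L2: "closed_span M S \<subseteq> L2 M"
  by (simp add: closed_span_def l2_closure_subset_L2)

lemma closed_span_base: "f \<in> S \<Longrightarrow> f \<in> L2 M \<Longrightarrow> f \<in> closed_span M S"
  by (simp add: closed_span_def l2_closure_base lin_span_base)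

lemma closed_span_zero: "(\<lambda>x. 0) \<in> closed_span M S"
  by (simp add: closed_span_def l2_closure_base lin_span_zero)

lemma closed_span_mono: "S \<subseteq> T \<Longrightarrow> closed_span M S \<subseteq> closed_span M T"
  unfolding closed_span_def by (intro l2_closure_mono lin_span_mono)

lemma closed_span_cong_AE:
  "f \<in> closed_span M S \<Longrightarrow> g \<in> L2 M \<Longrightarrow> AE x in M. f x = g x \<Longrightarrow> g \<in> closed_span M S"
  unfolding closed_span_def by (rule l2_closure_cong_AE)

lemma closed_span_cong:
  assumes "f \<in> closed_span M S" "\<And>x. x \<in> space M \<Longrightarrow> f x = g x"
  shows "g \<in> closed_span M S"
  using assms closed_span_subset_L2[of M S]
  by (intro closed_span_cong_AE[OF assms(1)]) (auto simp: L2_cong[of M f g] AE_I2)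

text \<open>The shape \<open>f + c g\<close> serves sums, differences and, with \<open>f\<close> the
  zero function, scalar multiples.\<close>

lemma closed_span_add:
  assumes f: "f \<in> closed_span M S" and g: "g \<in> closed_span M S"
  shows "(\<lambda>x. f x + c * g x) \<in> closed_span M S"
proof -
  have fg: "f \<in> L2 M" "g \<in> L2 M" using f g closed_span_subset_L2 by auto
  show ?thesis unfolding closed_span_def l2_closure_iff
  proof safe
    show "(\<lambda>x. f x + c * g x) \<in> L2 M" using fg by auto
    fix e :: real assume e: "e > 0"
    \<comment> \<open>Chosen so that 2 d + 2 |c|^2 d = e/2.\<close>
    define d where "d = e / (4 * (1 + (cmod c)\<^sup>2))"
    have d: "d > 0" using e by (auto simp: d_def intro!: divide_pos_pos add_pos_nonneg)
    obtain u where u: "u \<in> lin_span S" "u \<in> L2 M" "l2_sq M (\<lambda>x. f x - u x) < d"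
      using f d by (auto simp: closed_span_def l2_closure_iff)
    obtain v where v: "v \<in> lin_span S" "v \<in> L2 M" "l2_sq M (\<lambda>x. g x - v x) < d"
      using g d by (auto simp: closed_span_def l2_closure_iff)
    have "l2_sq M (\<lambda>x. (f x - u x) + c * (g x - v x))
        \<le> 2 * l2_sq M (\<lambda>x. f x - u x) + 2 * l2_sq M (\<lambda>x. c * (g x - v x))"
      using fg u v by (intro l2_sq_add_le) auto
    also have "\<dots> \<le> 2 * d + 2 * ((cmod c)\<^sup>2 * d)"
      using u v by (intro add_mono mult_left_mono) (auto simp: l2_sq_scale intro!: mult_left_mono)
    also have "\<dots> = e / 2"
    proof -
      have "1 + (cmod c)\<^sup>2 > 0" by (intro add_pos_nonneg) auto
      then have "d * (1 + (cmod c)\<^sup>2) = e / 4" unfolding d_def by (metis divide_divide_eq_left less_irrefl mult.commute nonzero_eq_divide_eq)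
      then show ?thesis by (simp add: algebra_simps)
    qed
    also have "\<dots> < e" using e by simp
    finally show "\<exists>h\<in>lin_span S \<inter> L2 M. l2_sq M (\<lambda>x. f x + c * g x - h x) < e"
      using u v by (intro bexI[of _ "\<lambda>x. u x + c * v x"])
        (auto simp: algebra_simps intro: lin_span_add)
  qed
qed

lemma closed_span_lincomb:
  assumes "finite F" "\<And>i. i \<in> F \<Longrightarrow> f i \<in> closed_span M S"
  shows "(\<lambda>x. \<Sum>i\<in>F. c i * f i x) \<in> closed_span M S"
  using assms
proof (induction F)
  case (insert i F)
  then show ?case
    using closed_span_add[of "\<lambda>x. \<Sum>i\<in>F. c i * f i x" M S "f i" "c i"] by (simp add: add.commute)
qed (simp add: closed_span_zero)

lemma l2_closure_closed_span: "l2_closure M (closed_span M S) = closed_span M S"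
proof
  show "l2_closure M (closed_span M S) \<subseteq> closed_span M S"
    unfolding closed_span_def by (rule l2_closure_minimal) auto
  show "closed_span M S \<subseteq> l2_closure M (closed_span M S)"
    using closed_span_subset_L2 by (auto intro: l2_closure_base)
qed

lemma closed_span_minimal:
  assumes "S \<subseteq> closed_span M T" shows "closed_span M S \<subseteq> closed_span M T"
proof -
  have "lin_span S \<subseteq> closed_span M T"
    using assms unfolding lin_span_def by (auto intro!: closed_span_lincomb)
  then show ?thesis
    using l2_closure_mono[of "lin_span S" "closed_span M T" M]
    by (simp add: closed_span_def[of M S] l2_closure_closed_span)
qed

lemma closed_subspace_closed_span:
  assumes "closed_subspace M V" "S \<subseteq> V" shows "closed_span M S \<subseteq> V"
proof -
  have "lin_span S \<subseteq> V" using assms lin_span_mono[of S V] by (auto simp: closed_subspace_def)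
  then show ?thesis using assms l2_closure_mono[of "lin_span S" V M]
    by (auto simp: closed_span_def closed_subspace_def)
qed

text \<open>Continuity lets approximations pass through \<open>T\<close>, so only generators have to
  be checked. \<open>T\<close> will be a scaling, a tensor product with all factors but one fixed, a
  slice, or a dilation. Linearity is asked only almost everywhere because a slice is additive only
  where its integrals exist.\<close>

lemma closed_span_map:
  assumes L2: "\<And>f. f \<in> L2 M \<Longrightarrow> T f \<in> L2 N"
    and lin: "\<And>f g c. f \<in> L2 M \<Longrightarrow> g \<in> L2 M \<Longrightarrow>
               AE y in N. T (\<lambda>x. f x + c * g x) y = T f y + c * T g y"
    and bd: "\<And>f. f \<in> L2 M \<Longrightarrow> l2_sq N (T f) \<le> B * l2_sq M f"
    and S: "S \<subseteq> L2 M" "\<And>f. f \<in> S \<Longrightarrow> T f \<in> closed_span N S'"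
    and f: "f \<in> closed_span M S"
  shows "T f \<in> closed_span N S'"
proof -
  have zero: "T (\<lambda>x. 0) \<in> closed_span N S'"
  proof (rule closed_span_cong_AE[OF closed_span_zero])
    \<comment> \<open>Additivity applied to 0 + 0 gives T 0 = T 0 + T 0 almost everywhere.\<close>
    show "AE x in N. 0 = T (\<lambda>x. 0) x"
      using lin[of "\<lambda>x. 0" "\<lambda>x. 0" 1] by auto
  qed (use L2 in auto)
  have fin: "T (\<lambda>x. \<Sum>g\<in>F. c g * g x) \<in> closed_span N S'" if "finite F" "F \<subseteq> S" for F c
    using that
  proof (induction F)
    case (insert g F)
    have L: "(\<lambda>x. \<Sum>g\<in>F. c g * g x) \<in> L2 M" "g \<in> L2 M" using insert S by (auto intro!: L2_sum)
    show ?case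
    proof (rule closed_span_cong_AE)
      show "(\<lambda>y. T (\<lambda>x. \<Sum>g\<in>F. c g * g x) y + c g * T g y) \<in> closed_span N S'"
        using insert S by (intro closed_span_add) auto
      show "T (\<lambda>x. \<Sum>g\<in>insert g F. c g * g x) \<in> L2 N"
        using insert S by (intro L2 L2_sum) auto
      show "AE y in N. T (\<lambda>x. \<Sum>g\<in>F. c g * g x) y + c g * T g y = T (\<lambda>x. \<Sum>g\<in>insert g F. c g * g x) y"
        using lin[OF L, of "c g"] insert by (simp add: add.commute eq_commute)
    qed
  qed (simp add: zero)
  have fL: "f \<in> L2 M" using f closed_span_subset_L2 by blast
  have "T f \<in> l2_closure N (closed_span N S')"
    unfolding l2_closure_iff
  proof safe
    show "T f \<in> L2 N" using fL L2 by auto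
    fix e :: real assume e: "e > 0"
    \<comment> \<open>The denominator is positive and larger than \<open>|B|\<close>, so
      \<open>|B| * d\<close> stays below e.\<close>
    define d where "d = e / (1 + \<bar>B\<bar>)"
    have d: "d > 0" using e by (auto simp: d_def)
    obtain u where u: "u \<in> lin_span S" "u \<in> L2 M" "l2_sq M (\<lambda>x. f x - u x) < d"
      using f d by (auto simp: closed_span_def l2_closure_iff)
    have Tu: "T u \<in> closed_span N S'" using u(1) fin unfolding lin_span_def by auto
    have "l2_sq N (\<lambda>y. T f y - T u y) = l2_sq N (T (\<lambda>x. f x - u x))"
    proof (rule l2_sq_cong_AE)
      show "AE y in N. T f y - T u y = T (\<lambda>x. f x - u x) y"
        using lin[OF fL u(2), of "-1"] by (simp add: eq_commute)
    qed (use fL u L2 in auto)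
    also have "\<dots> \<le> B * l2_sq M (\<lambda>x. f x - u x)" using fL u by (intro bd) auto
    also have "\<dots> \<le> \<bar>B\<bar> * l2_sq M (\<lambda>x. f x - u x)" by (intro mult_right_mono) auto
    also have "\<dots> \<le> \<bar>B\<bar> * d" using u by (intro mult_left_mono) auto
    also have "\<dots> < e" using e by (simp add: d_def field_simps)
    finally show "\<exists>g\<in>closed_span N S' \<inter> L2 N. l2_sq N (\<lambda>x. T f x - g x) < e"
      using Tu u L2 by auto
  qed
  then show ?thesis by (simp add: l2_closure_closed_span)
qed

text \<open>Simple functions converge pointwise with modulus at most 2|f|, so dominated convergence
  gives convergence in the squared norm; each of them is a combination of indicators of its level
  sets.\<close>

lemma L2_eq_closed_span_indicators:
  "L2 M = closed_span M {\<lambda>x. indicator E x |E. E \<in> sets M \<and> emeasure M E < \<infinity>}"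
proof (rule antisym[OF _ closed_span_subset_L2], rule subsetI)
  fix f assume f: "f \<in> L2 M"
  let ?S = "{\<lambda>x. indicator E x |E. E \<in> sets M \<and> emeasure M E < \<infinity>} :: ('a \<Rightarrow> complex) set"
  have [measurable]: "f \<in> borel_measurable M" using f by (simp add: L2_D)
  obtain F where F: "\<And>i. simple_function M (F i)"
    "\<And>x. x \<in> space M \<Longrightarrow> (\<lambda>i. F i x) \<longlonglongrightarrow> f x"
    "\<And>i x. x \<in> space M \<Longrightarrow> cmod (F i x) \<le> 2 * cmod (f x)"
    using borel_measurable_implies_sequence_metric[of f M 0] by (simp) metis
  have [measurable]: "F i \<in> borel_measurable M" for i
    using F(1) by (rule borel_measurable_simple_function)
  have FL: "F i \<in> L2 M" for i
  proof -
    have "integrable M (\<lambda>x. (cmod (F i x))\<^sup>2)"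
    proof (rule Bochner_Integration.integrable_bound[of _ "\<lambda>x. 4 * (cmod (f x))\<^sup>2"])
      have "(cmod (F i x))\<^sup>2 \<le> 4 * (cmod (f x))\<^sup>2" if "x \<in> space M" for x
        using power_mono[OF F(3)[OF that, of i], of 2] by (simp add: power_mult_distrib)
      then show "AE x in M. norm ((cmod (F i x))\<^sup>2) \<le> norm (4 * (cmod (f x))\<^sup>2)" by (auto intro!: AE_I2)
    qed (use f in \<open>auto simp: L2_D\<close>)
    then show ?thesis by (simp add: L2_def)
  qed
  have Fspan: "F i \<in> closed_span M ?S" for i
  proof (rule closed_span_cong)
    \<comment> \<open>The value 0 is left out because its level set may have infinite
      measure.\<close>
    let ?Y = "F i ` space M - {0}"
    have fin: "finite (F i ` space M)" using F(1) by (rule simple_functionD)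
    have meas: "F i -` {y} \<inter> space M \<in> sets M" for y using F(1) by (rule simple_functionD)
    show "(\<lambda>x. \<Sum>y\<in>?Y. y * indicator (F i -` {y} \<inter> space M) x) \<in> closed_span M ?S"
    proof (rule closed_span_lincomb)
      fix y assume y: "y \<in> ?Y"
      \<comment> \<open>Chebyshev: the indicator of the level set times |y|^2 is dominated by the
        square of |F_i|.\<close>
      have "emeasure M (F i -` {y} \<inter> space M) < \<infinity>"
      proof -
        have "integrable M (\<lambda>x. (cmod (F i x))\<^sup>2)" using FL by (simp add: L2_D)
        then have "integrable M (\<lambda>x. indicator (F i -` {y} \<inter> space M) x * (cmod y)\<^sup>2 :: real)"
          by (rule Bochner_Integration.integrable_bound) (auto intro!: AE_I2 simp: indicator_def)
        then have "integrable M (\<lambda>x. indicator (F i -` {y} \<inter> space M) x :: real)"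
          using y by (subst (asm) integrable_mult_right_iff) auto
        then show ?thesis using meas[of y] by (simp add: integrable_indicator_iff Int_absorb2)
      qed
      then show "(\<lambda>x. indicator (F i -` {y} \<inter> space M) x) \<in> closed_span M ?S"
        using meas by (intro closed_span_base L2_indicator) auto
    qed (use fin in auto)
    show "(\<Sum>y\<in>?Y. y * indicator (F i -` {y} \<inter> space M) x) = F i x" if "x \<in> space M" for x
    proof -
      have "(\<Sum>y\<in>?Y. y * indicator (F i -` {y} \<inter> space M) x) = (\<Sum>y\<in>F i ` space M. if F i x = y then y else 0)"
        using fin that by (intro sum.mono_neutral_cong_left) auto
      also have "\<dots> = F i x" using fin that by simp
      finally show ?thesis .
    qed
  qed
  have "f \<in> l2_closure M (closed_span M ?S)" unfolding l2_closure_iff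
  proof safe
    fix e :: real assume e: "e > 0"
    have "(\<lambda>i. LINT x|M. (cmod (f x - F i x))\<^sup>2) \<longlonglongrightarrow> (LINT x|M. 0)"
    \<comment> \<open>The constant comes from |f - F_i|^2 <= 2|f|^2 + 2 (2|f|)^2 = 10 |f|^2.\<close>
    proof (rule integral_dominated_convergence[where w = "\<lambda>x. 10 * (cmod (f x))\<^sup>2"])
      show "AE x in M. (\<lambda>i. (cmod (f x - F i x))\<^sup>2) \<longlonglongrightarrow> 0"
      proof (rule AE_I2)
        fix x assume "x \<in> space M"
        then show "(\<lambda>i. (cmod (f x - F i x))\<^sup>2) \<longlonglongrightarrow> 0"
          by (auto intro!: tendsto_eq_intros F(2))
      qed
      fix i
      show "AE x in M. norm ((cmod (f x - F i x))\<^sup>2) \<le> 10 * (cmod (f x))\<^sup>2"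
      proof (rule AE_I2)
        fix x assume x: "x \<in> space M"
        show "norm ((cmod (f x - F i x))\<^sup>2) \<le> 10 * (cmod (f x))\<^sup>2"
          using cmod_add_sq_le[of "f x" "- F i x"] power_mono[OF F(3)[OF x, of i], of 2]
          by (simp add: power_mult_distrib)
      qed
    qed (use f in \<open>auto simp: L2_D\<close>)
    then have "eventually (\<lambda>i. (LINT x|M. (cmod (f x - F i x))\<^sup>2) < e) sequentially"
      using e by (auto intro: order_tendstoD)
    then obtain i where "l2_sq M (\<lambda>x. f x - F i x) < e"
      unfolding l2_sq_def eventually_sequentially by blast
    then show "\<exists>g\<in>closed_span M ?S \<inter> L2 M. l2_sq M (\<lambda>x. f x - g x) < e"
      using Fspan FL by auto
  qed (use f in auto)
  then show "f \<in> closed_span M ?S" by (simp add: l2_closure_closed_span)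
qed

section \<open>The p-adic numbers\<close>

locale padic_place =
  fixes p :: nat
  assumes prime_p: "prime p"
begin

section \<open>The p-adic absolute value on the rationals\<close>

abbreviation rn :: "rat \<Rightarrow> real" where "rn \<equiv> rat_padic_norm p"

lemma p_gt_1: "p > 1" and p_gt_0: "p > 0"
  using prime_gt_1_nat[OF prime_p] prime_gt_0_nat[OF prime_p] by auto

lemma prime_elem_int_p: "prime_elem (int p)"
  using prime_p by (simp add: prime_imp_prime_elem)

lemma rn_0 [simp]: "rn 0 = 0"
  by (simp add: rat_padic_norm_def)

text \<open>Two fractions for one number are compared by cross-multiplication, and multiplicity is
  additive on products. This frees the norm from the reduced fraction returned by
  \<open>quotient_of\<close>.\<close>

lemma rn_fraction:
  assumes "a \<noteq> 0" "b \<noteq> 0"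
  shows "rn (of_int a / of_int b) = real p powi (int (multiplicity (int p) b) - int (multiplicity (int p) a))"
proof -
  obtain n d where nd: "quotient_of (of_int a / of_int b) = (n, d)" by fastforce
  have d: "d > 0" using quotient_of_denom_pos[OF nd] .
  have eq: "(of_int a / of_int b :: rat) = of_int n / of_int d" using quotient_of_div[OF nd] .
  have "(of_int a :: rat) * of_int d = of_int n * of_int b"
    using eq d assms by (simp add: field_simps)
  then have e: "a * d = n * b" by (simp only: of_int_mult[symmetric] of_int_eq_iff)
  have n: "n \<noteq> 0" using e assms d by auto
  have "multiplicity (int p) a + multiplicity (int p) d = multiplicity (int p) n + multiplicity (int p) b"
    using arg_cong[OF e, of "multiplicity (int p)"] assms n d prime_elem_int_p
    by (simp add: prime_elem_multiplicity_mult_distrib)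
  then have "int (multiplicity (int p) d) - int (multiplicity (int p) n)
      = int (multiplicity (int p) b) - int (multiplicity (int p) a)" by linarith
  then show ?thesis using assms nd by (simp add: rat_padic_norm_def)
qed

lemma rat_fraction: obtains a b where "(r::rat) = of_int a / of_int b" "b \<noteq> 0"
  using quotient_of_div[of r] quotient_of_denom_pos[of r] by (metis less_irrefl prod.exhaust)

lemma rn_pos: "r \<noteq> 0 \<Longrightarrow> rn r > 0"
  using p_gt_0 by (simp add: rat_padic_norm_def)

lemma rn_nonneg [simp]: "rn r \<ge> 0"
  by (simp add: rat_padic_norm_def)

lemma rn_eq_0_iff [simp]: "rn r = 0 \<longleftrightarrow> r = 0"
  using rn_pos[of r] by (metis less_irrefl rn_0)

lemma rn_powi: "r \<noteq> 0 \<Longrightarrow> \<exists>k. rn r = real p powi k"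
  by (auto simp: rat_padic_norm_def)

lemma rn_mult: "rn (r * s) = rn r * rn s"
proof (cases "r = 0 \<or> s = 0")
  case False
  obtain a b c d where ab: "r = of_int a / of_int b" "b \<noteq> 0" and cd: "s = of_int c / of_int d" "d \<noteq> 0"
    using rat_fraction by metis
  have nz: "a \<noteq> 0" "c \<noteq> 0" using False ab cd by auto
  have "r * s = of_int (a * c) / of_int (b * d)" using ab cd by simp
  then have "rn (r * s) = real p powi (int (multiplicity (int p) (b * d)) - int (multiplicity (int p) (a * c)))"
    using rn_fraction[of "a * c" "b * d"] nz ab cd by simp
  also have "\<dots> = real p powi ((int (multiplicity (int p) b) - int (multiplicity (int p) a)) +
      (int (multiplicity (int p) d) - int (multiplicity (int p) c)))"
    using nz ab cd prime_elem_int_p by (simp add: prime_elem_multiplicity_mult_distrib algebra_simps)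
  also have "\<dots> = rn r * rn s"
    using rn_fraction nz ab cd p_gt_0 by (simp add: power_int_add)
  finally show ?thesis .
qed auto

lemma rn_1 [simp]: "rn 1 = 1"
  using rn_fraction[of 1 1] by simp

lemma rn_p: "rn (of_nat p) = 1 / real p"
proof -
  have "rn (of_nat p) = real p powi (- 1)"
    using rn_fraction[of "int p" 1] p_gt_0 prime_elem_int_p by (simp add: multiplicity_prime)
  then show ?thesis by (simp add: power_int_minus_divide)
qed

lemma rn_inverse: "rn (inverse r) = inverse (rn r)"
proof (cases "r = 0")
  case False
  then have "rn r * rn (inverse r) = 1" by (simp flip: rn_mult)
  then show ?thesis by (metis inverse_unique)
qed auto

lemma rn_p_powi: "rn (of_nat p powi k) = real p powi (- k)"
proof (cases "k \<ge> 0")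
  case True
  have "rn (of_nat p ^ n) = (1 / real p) ^ n" for n
    by (induction n) (auto simp: rn_mult rn_p)
  then show ?thesis using True
    by (simp add: power_int_def power_one_over power_int_minus divide_inverse power_inverse)
next
  case False
  have "rn (inverse (of_nat p) ^ n) = real p ^ n" for n
    by (induction n) (auto simp: rn_mult rn_p rn_inverse)
  then show ?thesis using False by (simp add: power_int_def)
qed

lemma rn_minus [simp]: "rn (- r) = rn r"
proof -
  have "rn (-1) * rn (-1) = 1" by (simp flip: rn_mult)
  moreover have "rn (-1) \<ge> 0" by simp
  ultimately have "rn (-1) = 1" by (metis mult_1 abs_of_nonneg abs_mult_self_eq power2_eq_1_iff
      power2_eq_square neg_0_le_iff_le not_one_le_zero)
  then show ?thesis using rn_mult[of "-1" r] by simp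
qed

lemma rn_le_1_iff: 
  assumes "b \<noteq> 0" "\<not> int p dvd b"
  shows "rn (of_int a / of_int b) \<le> 1"
proof (cases "a = 0")
  case False
  have "real p powi (- int (multiplicity (int p) a)) \<le> real p powi 0"
    using p_gt_1 by (intro power_int_increasing) auto
  then show ?thesis using rn_fraction[OF False assms(1)] assms
    by (simp add: not_dvd_imp_multiplicity_0)
qed auto

lemma rn_of_int_le_1: "rn (of_int a) \<le> 1"
  using rn_le_1_iff[of 1 a] p_gt_1 by simp

lemma rn_of_int_lt_1_iff: "rn (of_int a) < 1 \<longleftrightarrow> int p dvd a"
proof (cases "a = 0")
  case False
  have "rn (of_int a) = real p powi (- int (multiplicity (int p) a))"
    using rn_fraction[OF False, of 1] by simp
  moreover have "multiplicity (int p) a = 0 \<longleftrightarrow> \<not> int p dvd a"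
    using False p_gt_1 by (intro multiplicity_eq_zero_iff) auto
  moreover have "multiplicity (int p) a > 0 \<Longrightarrow> real p powi (- int (multiplicity (int p) a)) < 1"
    using p_gt_1 by (simp add: power_int_minus power_int_of_nat field_simps)
  ultimately show ?thesis by (cases "multiplicity (int p) a = 0") auto
qed auto

text \<open>Over a common denominator the claim concerns numerators: a power of p dividing both
  divides their sum, so the multiplicity of the sum is at least the smaller one.\<close>

lemma rn_add_le: "rn (r + s) \<le> max (rn r) (rn s)"
proof (cases "r = 0 \<or> s = 0 \<or> r + s = 0")
  case False
  obtain a0 b0 c0 d0 where ab: "r = of_int a0 / of_int b0" "b0 \<noteq> 0" and cd: "s = of_int c0 / of_int d0" "d0 \<noteq> 0"
    using rat_fraction by metis
  define a c b where "a = a0 * d0" "c = c0 * b0" "b = b0 * d0"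
  have r: "r = of_int a / of_int b" "s = of_int c / of_int b" "b \<noteq> 0"
    using ab cd by (auto simp: a_c_b_def field_simps)
  have rs: "r + s = of_int (a + c) / of_int b" using r by (simp add: add_divide_distrib)
  have nz: "a \<noteq> 0" "c \<noteq> 0" "a + c \<noteq> 0"
    using False r rs by auto
  let ?m = "multiplicity (int p)"
  let ?k = "min (?m a) (?m c)"
  have "int p ^ ?k dvd a + c" by (intro dvd_add multiplicity_dvd') auto
  then have "?k \<le> ?m (a + c)"
    using nz p_gt_1 by (intro multiplicity_geI) auto
  then have "?m a \<le> ?m (a + c) \<or> ?m c \<le> ?m (a + c)" by linarith
  moreover have "?m x \<le> ?m (a + c) \<Longrightarrow> rn (r + s) \<le> real p powi (int (?m b) - int (?m x))" for x
    unfolding rs rn_fraction[OF nz(3) r(3)] using p_gt_1 by (intro power_int_increasing) auto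
  moreover have "rn r = real p powi (int (?m b) - int (?m a))" "rn s = real p powi (int (?m b) - int (?m c))"
    using rn_fraction[OF nz(1) r(3)] rn_fraction[OF nz(2) r(3)] r by auto
  ultimately show ?thesis by fastforce
qed (auto simp: eq_neg_iff_add_eq_0[symmetric])

lemma rn_diff_le: "rn (r - s) \<le> max (rn r) (rn s)"
  using rn_add_le[of r "- s"] by simp

lemma rn_diff_commute: "rn (r - s) = rn (s - r)"
  using rn_minus[of "r - s"] by simp

text \<open>The norms of a p-adic Cauchy sequence thus form a real Cauchy sequence, which is how the
  norm reaches the completion.\<close>

lemma rn_abs_diff: "\<bar>rn r - rn s\<bar> \<le> rn (r - s)"
proof -
  have "rn r \<le> rn (r - s) + rn s" for r s
  proof -
    have "rn r \<le> max (rn (r - s)) (rn s)" using rn_add_le[of "r - s" s] by simp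
    also have "\<dots> \<le> rn (r - s) + rn s" by (intro max.boundedI) simp_all
    finally show ?thesis .
  qed
  from this[of r s] this[of s r] show ?thesis by (simp add: rn_diff_commute abs_le_iff)
qed

subsection \<open>Classes of Cauchy sequences\<close>

abbreviation "cauchy \<equiv> padic_cauchy p"
definition "cl X = padic_rel p `` {X}"

lemma cauchy_const [simp]: "cauchy (\<lambda>_. r)"
  by (auto simp: padic_cauchy_def)

lemma cauchy_diff: assumes "cauchy X" "cauchy Y" shows "cauchy (\<lambda>n. X n - Y n)"
  unfolding padic_cauchy_def
proof safe
  fix e :: real assume e: "e > 0"
  obtain M where M: "\<And>m n. m \<ge> M \<Longrightarrow> n \<ge> M \<Longrightarrow> rn (X m - X n) < e"
    using assms(1) e unfolding padic_cauchy_def by meson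
  obtain N where N: "\<And>m n. m \<ge> N \<Longrightarrow> n \<ge> N \<Longrightarrow> rn (Y m - Y n) < e"
    using assms(2) e unfolding padic_cauchy_def by meson
  have "rn ((X m - Y m) - (X n - Y n)) < e" if "m \<ge> max M N" "n \<ge> max M N" for m n
    using rn_diff_le[of "X m - X n" "Y m - Y n"] M[of m n] N[of m n] that
    by (auto simp: algebra_simps max_def split: if_splits)
  then show "\<exists>N. \<forall>m\<ge>N. \<forall>n\<ge>N. rn ((X m - Y m) - (X n - Y n)) < e" by blast
qed

lemma cauchy_scale: assumes "cauchy X" shows "cauchy (\<lambda>n. r * X n)"
proof (cases "r = 0")
  case False
  show ?thesis unfolding padic_cauchy_def
  proof safe
    fix e :: real assume e: "e > 0"
    have r: "rn r > 0" using rn_pos[OF False] .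
    obtain M where M: "\<And>m n. m \<ge> M \<Longrightarrow> n \<ge> M \<Longrightarrow> rn (X m - X n) < e / rn r"
      using assms e r unfolding padic_cauchy_def by (meson divide_pos_pos)
    have "rn (r * X m - r * X n) < e" if "m \<ge> M" "n \<ge> M" for m n
    proof -
      have "rn (r * X m - r * X n) = rn r * rn (X m - X n)" by (simp add: rn_mult[symmetric] algebra_simps)
      then show ?thesis using M[OF that] r by (simp add: field_simps)
    qed
    then show "\<exists>N. \<forall>m\<ge>N. \<forall>n\<ge>N. rn (r * X m - r * X n) < e" by blast
  qed
qed simp

lemma cauchy_norm_convergent: assumes "cauchy X" shows "convergent (\<lambda>n. rn (X n))"
proof -
  have "Cauchy (\<lambda>n. rn (X n))" unfolding Cauchy_def
  proof safe
    fix e :: real assume "e > 0"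
    then obtain M where M: "\<And>m n. m \<ge> M \<Longrightarrow> n \<ge> M \<Longrightarrow> rn (X m - X n) < e"
      using assms unfolding padic_cauchy_def by meson
    then show "\<exists>M. \<forall>m\<ge>M. \<forall>n\<ge>M. dist (rn (X m)) (rn (X n)) < e"
      using rn_abs_diff by (metis dist_real_def order_le_less_trans)
  qed
  then show ?thesis by (simp add: Cauchy_convergent_iff)
qed

lemma null_add:
  assumes "(\<lambda>n. rn (X n)) \<longlonglongrightarrow> 0" "(\<lambda>n. rn (Y n)) \<longlonglongrightarrow> 0"
  shows "(\<lambda>n. rn (X n + Y n)) \<longlonglongrightarrow> 0"
proof (rule tendsto_sandwich[of "\<lambda>_. 0"])
  show "(\<lambda>n. rn (X n) + rn (Y n)) \<longlonglongrightarrow> 0" using tendsto_add[OF assms] by simp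
  show "\<forall>\<^sub>F n in sequentially. rn (X n + Y n) \<le> rn (X n) + rn (Y n)"
    by (intro always_eventually allI order_trans[OF rn_add_le] max.boundedI) simp_all
qed auto

lemma rel_iff: "(X, Y) \<in> padic_rel p \<longleftrightarrow> cauchy X \<and> cauchy Y \<and> (\<lambda>n. rn (X n - Y n)) \<longlonglongrightarrow> 0"
  by (simp add: padic_rel_def)

lemma rel_trans: "(X, Y) \<in> padic_rel p \<Longrightarrow> (Y, Z) \<in> padic_rel p \<Longrightarrow> (X, Z) \<in> padic_rel p"
  using null_add[of "\<lambda>n. X n - Y n" "\<lambda>n. Y n - Z n"] by (simp add: rel_iff)

lemma mem_cl: "Y \<in> cl X \<longleftrightarrow> (X, Y) \<in> padic_rel p"
  by (simp add: cl_def)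

lemma cl_self: "cauchy X \<Longrightarrow> X \<in> cl X"
  by (simp add: mem_cl rel_iff)

text \<open>Well-definedness of the operations: each is defined as the set of sequences related to
  some result computed from representatives. That set is a single class as soon as all these results
  lie in one class and a representative of the class is among them.\<close>

lemma rel_image:
  assumes "X \<in> S" "S \<subseteq> cl X" "cauchy X" shows "padic_rel p `` S = cl X"
proof
  show "padic_rel p `` S \<subseteq> cl X"
  proof clarify
    fix Y Z assume "(Y, Z) \<in> padic_rel p" "Y \<in> S"
    then show "Z \<in> cl X" using assms(2) rel_trans[of X Y Z] by (auto simp: mem_cl)
  qed
  show "cl X \<subseteq> padic_rel p `` S" using assms(1) by (auto simp: mem_cl)
qed

lemma cl_in_Qp: "cauchy X \<Longrightarrow> cl X \<in> Qp p"
  by (auto simp: Qp_def cl_def intro!: quotientI)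

lemma Qp_cases: assumes "x \<in> Qp p" obtains X where "cauchy X" "x = cl X"
  using assms by (auto simp: Qp_def cl_def elim!: quotientE)

lemma padic_diff_cl:
  assumes "cauchy X" "cauchy Y" shows "padic_diff p (cl X) (cl Y) = cl (\<lambda>n. X n - Y n)"
  unfolding padic_diff_def
proof (rule rel_image)
  show "(\<lambda>n. X n - Y n) \<in> {(\<lambda>n. X' n - Y' n) |X' Y'. X' \<in> cl X \<and> Y' \<in> cl Y}"
    using assms cl_self by blast
  show "{(\<lambda>n. X' n - Y' n) |X' Y'. X' \<in> cl X \<and> Y' \<in> cl Y} \<subseteq> cl (\<lambda>n. X n - Y n)"
  proof clarify
    fix X' Y' assume "X' \<in> cl X" "Y' \<in> cl Y"
    then have *: "cauchy X'" "cauchy Y'" "(\<lambda>n. rn (X n - X' n)) \<longlonglongrightarrow> 0" "(\<lambda>n. rn (Y' n - Y n)) \<longlonglongrightarrow> 0"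
      by (auto simp: mem_cl rel_iff rn_diff_commute)
    show "(\<lambda>n. X' n - Y' n) \<in> cl (\<lambda>n. X n - Y n)"
      using null_add[OF *(3,4)] * assms by (auto simp: mem_cl rel_iff cauchy_diff algebra_simps)
  qed
qed (use assms cauchy_diff in auto)

lemma padic_of_rat_eq: "padic_of_rat p r = cl (\<lambda>_. r)"
  by (simp add: padic_of_rat_def cl_def)

text \<open>For representatives \<open>R\<close> of r and \<open>X'\<close> of x, one has r X - R X'
  = r (X - X') + (r - R) X'. Both summands tend to 0 because the norms of \<open>X'\<close>
  converge.\<close>

lemma padic_scale_cl:
  assumes "cauchy X" shows "padic_mult p (padic_of_rat p r) (cl X) = cl (\<lambda>n. r * X n)"
  unfolding padic_mult_def padic_of_rat_eq
proof (rule rel_image)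
  show "(\<lambda>n. r * X n) \<in> {(\<lambda>n. R n * X' n) |R X'. R \<in> cl (\<lambda>_. r) \<and> X' \<in> cl X}"
    using assms cl_self[of X] cl_self[of "\<lambda>_. r"] by force
  show "{(\<lambda>n. R n * X' n) |R X'. R \<in> cl (\<lambda>_. r) \<and> X' \<in> cl X} \<subseteq> cl (\<lambda>n. r * X n)"
  proof clarify
    fix R X' assume "R \<in> cl (\<lambda>_. r)" "X' \<in> cl X"
    then have *: "cauchy R" "cauchy X'" "(\<lambda>n. rn (X n - X' n)) \<longlonglongrightarrow> 0" "(\<lambda>n. rn (r - R n)) \<longlonglongrightarrow> 0"
      by (auto simp: mem_cl rel_iff)
    have Xc: "convergent (\<lambda>n. rn (X' n))" by (rule cauchy_norm_convergent) fact
    then obtain l where l: "(\<lambda>n. rn (X' n)) \<longlonglongrightarrow> l" by (auto simp: convergent_def)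
    have "(\<lambda>n. rn r * rn (X n - X' n)) \<longlonglongrightarrow> 0" using tendsto_mult[OF tendsto_const *(3), of "rn r"] by simp
    moreover have "(\<lambda>n. rn (r - R n) * rn (X' n)) \<longlonglongrightarrow> 0" using tendsto_mult[OF *(4) l] by simp
    ultimately have lim: "(\<lambda>n. rn (r * X n - R n * X' n)) \<longlonglongrightarrow> 0"
      using null_add[of "\<lambda>n. r * (X n - X' n)" "\<lambda>n. (r - R n) * X' n"]
      unfolding rn_mult[symmetric] by (simp add: algebra_simps)
    \<comment> \<open>Inherited from the Cauchy sequence \<open>r * X\<close>, from which the
      product differs by a null sequence.\<close>
    have "cauchy (\<lambda>n. R n * X' n)" unfolding padic_cauchy_def
    proof safe
      fix e :: real assume e: "e > 0"
      obtain N1 where N1: "\<And>n. n \<ge> N1 \<Longrightarrow> rn (r * X n - R n * X' n) < e"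
        using order_tendstoD(2)[OF lim e] by (auto simp: eventually_sequentially)
      obtain N2 where N2: "\<And>m n. m \<ge> N2 \<Longrightarrow> n \<ge> N2 \<Longrightarrow> rn (r * X m - r * X n) < e"
        using cauchy_scale[OF assms, of r] e unfolding padic_cauchy_def by meson
      have "rn (R m * X' m - R n * X' n) < e" if "m \<ge> max N1 N2" "n \<ge> max N1 N2" for m n
      proof -
        have "R m * X' m - R n * X' n = ((r * X n - R n * X' n) - (r * X m - R m * X' m)) + (r * X m - r * X n)"
          by (simp add: algebra_simps)
        then show ?thesis
          using rn_add_le[of "(r * X n - R n * X' n) - (r * X m - R m * X' m)" "r * X m - r * X n"]
            rn_diff_le[of "r * X n - R n * X' n" "r * X m - R m * X' m"] N1[of m] N1[of n] N2[of m n] that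
          by auto
      qed
      then show "\<exists>N. \<forall>m\<ge>N. \<forall>n\<ge>N. rn (R m * X' m - R n * X' n) < e" by blast
    qed
    then show "(\<lambda>n. R n * X' n) \<in> cl (\<lambda>n. r * X n)"
      using lim assms by (auto simp: mem_cl rel_iff cauchy_scale)
  qed
qed (use assms cauchy_scale in auto)

text \<open>Norms along equivalent sequences have the same limit, so the definite description in
  \<open>padic_norm\<close> denotes it.\<close>

lemma padic_norm_cl:
  assumes "cauchy X" shows "(\<lambda>n. rn (X n)) \<longlonglongrightarrow> padic_norm p (cl X)"
proof -
  obtain l where l: "(\<lambda>n. rn (X n)) \<longlonglongrightarrow> l"
    using cauchy_norm_convergent[OF assms] by (auto simp: convergent_def)
  have all: "\<forall>Y\<in>cl X. (\<lambda>n. rn (Y n)) \<longlonglongrightarrow> l"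
  proof
    fix Y assume "Y \<in> cl X"
    then have "(\<lambda>n. rn (X n - Y n)) \<longlonglongrightarrow> 0" by (simp add: mem_cl rel_iff)
    then have "(\<lambda>n. rn (Y n) - rn (X n)) \<longlonglongrightarrow> 0"
      by (rule Lim_null_comparison[rotated]) (auto intro!: always_eventually simp: rn_diff_commute[of "X _"] rn_abs_diff)
    from tendsto_add[OF this l] show "(\<lambda>n. rn (Y n)) \<longlonglongrightarrow> l" by simp
  qed
  have "padic_norm p (cl X) = l" unfolding padic_norm_def
    by (rule the_equality) (use all assms cl_self LIMSEQ_unique in blast)+
  then show ?thesis using l by simp
qed

lemma padic_norm_of_rat [simp]: "padic_norm p (padic_of_rat p r) = rn r"
  using padic_norm_cl[OF cauchy_const, of r] by (simp add: padic_of_rat_eq LIMSEQ_const_iff)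

subsection \<open>Algebra and ultrametric\<close>

abbreviation dif :: "padic \<Rightarrow> padic \<Rightarrow> padic" where "dif \<equiv> padic_diff p"
abbreviation nrm :: "padic \<Rightarrow> real" where "nrm \<equiv> padic_norm p"
abbreviation rat :: "rat \<Rightarrow> padic" where "rat \<equiv> padic_of_rat p"
abbreviation scl :: "rat \<Rightarrow> padic \<Rightarrow> padic" where "scl r \<equiv> padic_mult p (padic_of_rat p r)"

lemma rat_Qp [simp]: "rat r \<in> Qp p"
  by (simp add: padic_of_rat_eq cl_in_Qp)

lemma dif_Qp [simp]: "x \<in> Qp p \<Longrightarrow> y \<in> Qp p \<Longrightarrow> dif x y \<in> Qp p"
  by (auto elim!: Qp_cases simp: padic_diff_cl cl_in_Qp cauchy_diff)

lemma scl_Qp [simp]: "x \<in> Qp p \<Longrightarrow> scl r x \<in> Qp p"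
  by (auto elim!: Qp_cases simp: padic_scale_cl cl_in_Qp cauchy_scale)

lemma scl_scl: "x \<in> Qp p \<Longrightarrow> scl r (scl s x) = scl (r * s) x"
  by (auto elim!: Qp_cases simp: padic_scale_cl cauchy_scale mult.assoc)

lemma scl_1 [simp]: "x \<in> Qp p \<Longrightarrow> scl 1 x = x"
  by (auto elim!: Qp_cases simp: padic_scale_cl)

lemma scl_dif: "x \<in> Qp p \<Longrightarrow> y \<in> Qp p \<Longrightarrow> scl r (dif x y) = dif (scl r x) (scl r y)"
  by (auto elim!: Qp_cases simp: padic_scale_cl padic_diff_cl cauchy_scale cauchy_diff right_diff_distrib)

lemma scl_rat: "scl r (rat s) = rat (r * s)"
  using padic_scale_cl[of "\<lambda>_. s" r] by (simp add: padic_of_rat_eq)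

lemma dif_rat: "dif (rat r) (rat s) = rat (r - s)"
  by (simp add: padic_of_rat_eq padic_diff_cl)

lemma dif_0 [simp]: "x \<in> Qp p \<Longrightarrow> dif x (rat 0) = x"
  by (auto elim!: Qp_cases simp: padic_of_rat_eq padic_diff_cl)

lemma dif_dif_cancel: "x \<in> Qp p \<Longrightarrow> y \<in> Qp p \<Longrightarrow> z \<in> Qp p \<Longrightarrow> dif (dif x z) (dif y z) = dif x y"
  by (auto elim!: Qp_cases simp: padic_diff_cl cauchy_diff)

lemma dif_rat_rat: "x \<in> Qp p \<Longrightarrow> dif (dif x (rat r)) (rat s) = dif x (rat (r + s))"
  by (auto elim!: Qp_cases simp: padic_of_rat_eq padic_diff_cl cauchy_diff algebra_simps)

lemma nrm_nonneg [simp]: "x \<in> Qp p \<Longrightarrow> nrm x \<ge> 0"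
  by (elim Qp_cases) (auto intro!: LIMSEQ_le_const[OF padic_norm_cl])

lemma nrm_scl: assumes "x \<in> Qp p" shows "nrm (scl r x) = rn r * nrm x"
proof -
  obtain X where X: "cauchy X" "x = cl X" using assms by (rule Qp_cases)
  have "(\<lambda>n. rn (r * X n)) \<longlonglongrightarrow> nrm (scl r x)"
    using padic_norm_cl[OF cauchy_scale[OF X(1), of r]] X by (simp add: padic_scale_cl)
  moreover have "(\<lambda>n. rn (r * X n)) \<longlonglongrightarrow> rn r * nrm x"
    using tendsto_mult[OF tendsto_const padic_norm_cl[OF X(1)], of "rn r"] X by (simp add: rn_mult)
  ultimately show ?thesis by (rule LIMSEQ_unique)
qed

lemma nrm_dif_le: assumes "x \<in> Qp p" "y \<in> Qp p" shows "nrm (dif x y) \<le> max (nrm x) (nrm y)"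
proof -
  obtain X where X: "cauchy X" "x = cl X" using assms(1) by (rule Qp_cases)
  obtain Y where Y: "cauchy Y" "y = cl Y" using assms(2) by (rule Qp_cases)
  have "(\<lambda>n. rn (X n - Y n)) \<longlonglongrightarrow> nrm (dif x y)"
    using padic_norm_cl[OF cauchy_diff[OF X(1) Y(1)]] X Y by (simp add: padic_diff_cl)
  moreover have "(\<lambda>n. max (rn (X n)) (rn (Y n))) \<longlonglongrightarrow> max (nrm x) (nrm y)"
    using X Y by (auto intro!: tendsto_max padic_norm_cl)
  ultimately show ?thesis by (rule LIMSEQ_le) (auto intro: rn_diff_le)
qed

lemma nrm_commute: "x \<in> Qp p \<Longrightarrow> y \<in> Qp p \<Longrightarrow> nrm (dif x y) = nrm (dif y x)"
proof -
  assume a: "x \<in> Qp p" "y \<in> Qp p"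
  have "dif y x = scl (-1) (dif x y)" using a
    by (auto elim!: Qp_cases simp: padic_scale_cl padic_diff_cl cauchy_diff)
  then show ?thesis using a by (simp add: nrm_scl)
qed

lemma nrm_triangle:
  assumes "x \<in> Qp p" "y \<in> Qp p" "z \<in> Qp p" shows "nrm (dif x z) \<le> max (nrm (dif x y)) (nrm (dif y z))"
proof -
  have "nrm (dif x z) = nrm (dif (dif x y) (dif z y))" using assms by (simp add: dif_dif_cancel)
  also have "\<dots> \<le> max (nrm (dif x y)) (nrm (dif z y))" using assms by (intro nrm_dif_le) auto
  finally show ?thesis using nrm_commute[of z y] assms by simp
qed

lemma rat_dense: assumes "x \<in> Qp p" "e > 0" shows "\<exists>r. nrm (dif x (rat r)) < e"
proof -
  obtain X where X: "cauchy X" "x = cl X" using assms(1) by (rule Qp_cases)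
  obtain M where M: "\<And>m n. m \<ge> M \<Longrightarrow> n \<ge> M \<Longrightarrow> rn (X m - X n) < e / 2"
    using X assms(2) unfolding padic_cauchy_def by (meson half_gt_zero)
  have "(\<lambda>n. rn (X n - X M)) \<longlonglongrightarrow> nrm (dif x (rat (X M)))"
    using padic_norm_cl[OF cauchy_diff[OF X(1) cauchy_const]] X by (simp add: padic_diff_cl padic_of_rat_eq)
  then have "nrm (dif x (rat (X M))) \<le> e / 2"
    using M by (intro LIMSEQ_le_const2[where X="\<lambda>n. rn (X n - X M)"]) (auto intro!: exI[of _ M] less_imp_le)
  then show ?thesis using assms by (intro exI[of _ "X M"]) auto
qed

text \<open>In an ultrametric, a rational closer to x than the norm of x has the same norm as x. The
  completion therefore creates no new norm values.\<close>

lemma nrm_cases: assumes "x \<in> Qp p" "nrm x \<noteq> 0" obtains k where "nrm x = real p powi k"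
proof -
  have pos: "nrm x > 0" using assms nrm_nonneg[of x] by linarith
  obtain r where r: "nrm (dif x (rat r)) < nrm x" using rat_dense[OF assms(1) pos] by blast
  have "rn r \<le> max (nrm (dif x (rat r))) (nrm x)"
    using nrm_triangle[of "rat r" x "rat 0"] nrm_commute[of x "rat r"] assms by simp
  moreover have "nrm x \<le> max (nrm (dif x (rat r))) (rn r)"
    using nrm_triangle[of x "rat r" "rat 0"] assms by simp
  ultimately have "nrm x = rn r" using r by auto
  then show ?thesis using rn_powi[of r] pos that by fastforce
qed

text \<open>Norm values are discrete, hence open and closed balls coincide after a shift of the
  level by one.\<close>

lemma nrm_lt_iff: assumes "x \<in> Qp p" shows "nrm x < real p powi (k + 1) \<longleftrightarrow> nrm x \<le> real p powi k"
proof
  assume l: "nrm x < real p powi (k + 1)"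
  show "nrm x \<le> real p powi k"
  proof (cases "nrm x = 0")
    case False
    then obtain i where i: "nrm x = real p powi i" using nrm_cases assms by blast
    have "i < k + 1"
    proof (rule ccontr)
      assume "\<not> i < k + 1"
      then have "real p powi (k + 1) \<le> real p powi i" using p_gt_1 by (intro power_int_increasing) auto
      then show False using l i by simp
    qed
    then show ?thesis using i p_gt_1 by (auto intro!: power_int_increasing)
  qed simp
next
  assume "nrm x \<le> real p powi k"
  also have "real p powi k < real p powi (k + 1)" using p_gt_1 by (intro power_int_strict_increasing) auto
  finally show "nrm x < real p powi (k + 1)" .
qed

subsection \<open>Digits\<close>

text \<open>Norm at most 1 means that p does not divide the reduced denominator. The latter is then
  invertible modulo p, and the digit is the residue of the numerator times that inverse.\<close>

lemma rat_digit:
  assumes "rn r \<le> 1" shows "\<exists>c<p. rn (r - of_nat c) < 1"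
proof -
  obtain n d where nd: "quotient_of r = (n, d)" by fastforce
  have d: "d > 0" "coprime n d" "r = of_int n / of_int d"
    using quotient_of_denom_pos[OF nd] quotient_of_coprime[OF nd] quotient_of_div[OF nd] by auto
  have nd: "\<not> int p dvd d"
  proof
    assume pd: "int p dvd d"
    then have pn: "\<not> int p dvd n" using d(2) prime_elem_int_p
      by (meson coprime_common_divisor not_prime_elem_one prime_elem_not_unit)
    then have "n \<noteq> 0" by auto
    have "rn r = real p powi (int (multiplicity (int p) d))"
      using rn_fraction[of n d] d \<open>n \<noteq> 0\<close> pn by (simp add: not_dvd_imp_multiplicity_0)
    moreover have "multiplicity (int p) d > 0"
      using pd d p_gt_1 by (subst multiplicity_gt_zero_iff) auto
    ultimately have "rn r > 1" using p_gt_1 by (simp add: power_int_of_nat one_less_power)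
    then show False using assms by simp
  qed
  have "coprime d (int p)"
    using prime_imp_coprime[of "int p" d] nd prime_p by (simp add: coprime_commute)
  then obtain u v where uv: "u * d + v * int p = 1"
    using bezout_int[of d "int p"] by (metis coprime_imp_gcd_eq_1)
  define c where "c = nat ((n * u) mod int p)"
  have c: "int c = (n * u) mod int p" using p_gt_0 by (simp add: c_def)
  have "c < p" using p_gt_0 c by (metis of_nat_0_less_iff of_nat_less_iff pos_mod_bound)
  have "int p dvd n - int c * d"
  proof -
    have "n - int c * d = n * (u * d + v * int p) - int c * d" using uv by simp
    also have "\<dots> = (n * u - int c) * d + int p * (n * v)" by (simp add: algebra_simps)
    finally show ?thesis unfolding c by (simp add: minus_mod_eq_mult_div)
  qed
  then have "rn (of_int (n - int c * d)) < 1" by (simp only: rn_of_int_lt_1_iff)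
  moreover have "r - of_nat c = of_int (n - int c * d) * inverse (of_int d)"
    using d by (simp add: field_simps)
  moreover have "rn (inverse (of_int d)) \<le> 1" using rn_le_1_iff[of d 1] d nd by (simp add: divide_inverse)
  ultimately have "rn (r - of_nat c) < 1"
    using mult_right_le_one_le[of "rn (of_int (n - int c * d))" "rn (inverse (of_int d))"]
    by (simp add: rn_mult del: of_int_diff of_int_mult)
  then show ?thesis using \<open>c < p\<close> by blast
qed

text \<open>The residue classes of the p-adic integers modulo p. Existence comes from a nearby
  rational; two digits for one x would differ by a multiple of p. Both the splitting of balls and
  the refinement of basis functions reduce to this.\<close>

lemma ex1_digit:
  assumes "x \<in> Qp p" "nrm x \<le> 1"
  shows "\<exists>!c. c < p \<and> nrm (dif x (rat (of_nat c))) < 1"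
proof -
  obtain r where r: "nrm (dif x (rat r)) < 1" using rat_dense[OF assms(1), of 1] by auto
  have "rn r \<le> max (nrm (dif x (rat r))) (nrm x)"
    using nrm_triangle[of "rat r" x "rat 0"] nrm_commute[of x "rat r"] assms by simp
  then have "rn r \<le> 1" using r assms by auto
  then obtain c where c: "c < p" "rn (r - of_nat c) < 1" using rat_digit by blast
  have 1: "nrm (dif x (rat (of_nat c))) < 1"
    using nrm_triangle[of x "rat r" "rat (of_nat c)"] assms r c by (simp add: dif_rat)
  show ?thesis
  proof (rule ex1I[of _ c])
    fix d assume d: "d < p \<and> nrm (dif x (rat (of_nat d))) < 1"
    have "nrm (dif (rat (of_nat c)) (rat (of_nat d))) < 1"
      using nrm_triangle[of "rat (of_nat c)" x "rat (of_nat d)"] nrm_commute[of x "rat (of_nat c)"] assms 1 d by (simp add: max_def split: if_splits)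
    then have "rn (of_int (int c - int d)) < 1" by (simp add: dif_rat)
    then have "int p dvd int c - int d" by (simp only: rn_of_int_lt_1_iff)
    then have "int c mod int p = int d mod int p" by (simp add: mod_eq_dvd_iff)
    then show "d = c" using c d by simp
  qed (use c 1 in auto)
qed

text \<open>Division by p turns the open unit ball into the closed one, so a digit condition on y
  becomes membership in a ball of the next level.\<close>

lemma nrm_scl_inverse_le_1_iff:
  assumes "y \<in> Qp p" shows "nrm (scl (1 / of_nat p) y) \<le> 1 \<longleftrightarrow> nrm y < 1"
proof -
  have "rn (1 / of_nat p) = real p" using rn_p rn_inverse[of "of_nat p"] by (simp add: divide_inverse)
  then have "nrm (scl (1 / of_nat p) y) \<le> 1 \<longleftrightarrow> nrm y \<le> real p powi (-1)"
    using assms p_gt_0 by (simp add: nrm_scl power_int_minus field_simps)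
  also have "\<dots> \<longleftrightarrow> nrm y < 1" using nrm_lt_iff[OF assms, of "-1"] by simp
  finally show ?thesis .
qed

end

section \<open>Scalings\<close>

text \<open>The hypothesis on preimages identifies the image measure under \<open>D\<close> with a
  constant multiple of \<open>M\<close>; both claims are then a change of variables. It is applied
  on the line, on Q_p and on the adeles.\<close>

lemma scaled_comp:
  assumes D [measurable]: "D \<in> measurable M M" and c: "0 \<le> c"
    and scale: "\<And>B. B \<in> sets M \<Longrightarrow> emeasure M (D -` B \<inter> space M) = ennreal c * emeasure M B"
    and f: "f \<in> L2 M"
  shows "(\<lambda>x. f (D x)) \<in> L2 M" "l2_sq M (\<lambda>x. f (D x)) = c * l2_sq M f"
proof -
  have [measurable]: "f \<in> borel_measurable M" using f by (simp add: L2_D)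
  have eq: "distr M M D = density M (\<lambda>_. c)"
  proof (rule measure_eqI)
    fix B assume "B \<in> sets (distr M M D)"
    then show "emeasure (distr M M D) B = emeasure (density M (\<lambda>_. c)) B"
      by (simp add: emeasure_distr scale emeasure_density_const)
  qed simp
  have "integrable (density M (\<lambda>_. c)) (\<lambda>x. (cmod (f x))\<^sup>2)"
    using integrable_density[of "\<lambda>x. (cmod (f x))\<^sup>2" M "\<lambda>_. c"] L2_D(2)[OF f] c by simp
  then have "integrable M (\<lambda>x. (cmod (f (D x)))\<^sup>2)"
    using integrable_distr_eq[OF D, of "\<lambda>x. (cmod (f x))\<^sup>2"] unfolding eq by simp
  then show "(\<lambda>x. f (D x)) \<in> L2 M" by (simp add: L2_def)
  have "l2_sq M (\<lambda>x. f (D x)) = integral\<^sup>L (distr M M D) (\<lambda>x. (cmod (f x))\<^sup>2)"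
    unfolding l2_sq_def by (rule integral_distr[symmetric]) auto
  also have "\<dots> = c * l2_sq M f" unfolding eq l2_sq_def
    using c integral_density[of "\<lambda>x. (cmod (f x))\<^sup>2" M "\<lambda>_. c"] by simp
  finally show "l2_sq M (\<lambda>x. f (D x)) = c * l2_sq M f" .
qed

lemma closed_subspace_cong:
  assumes "closed_subspace M V" "f \<in> V" "\<And>x. x \<in> space M \<Longrightarrow> f x = g x"
  shows "g \<in> V"
proof -
  have "f \<in> L2 M" using assms by (auto simp: closed_subspace_def)
  then have "g \<in> L2 M" using L2_cong[of M f g] assms(3) by auto
  then have "g \<in> l2_closure M V"
    using l2_closure_cong_AE[OF l2_closure_base[OF assms(2) \<open>f \<in> L2 M\<close>]] assms(3) by (auto intro: AE_I2)
  then show ?thesis using assms(1) by (auto simp: closed_subspace_def)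
qed

text \<open>Common setting for the line and for Q_p: the dilations \<open>D k\<close> act as the
  group of integers and \<open>S\<close> generates level 0. Everything is prescribed on
  \<open>space M\<close> only, since p-adic scalings are meaningful only on
  \<open>Qp p\<close>.\<close>

locale scaled_mra =
  fixes M :: "'a measure" and V :: "int \<Rightarrow> ('a \<Rightarrow> complex) set" and D :: "int \<Rightarrow> 'a \<Rightarrow> 'a"
    and B :: "int \<Rightarrow> real" and S :: "('a \<Rightarrow> complex) set"
  assumes meas: "\<And>k x. x \<in> space M \<Longrightarrow> D k x \<in> space M"
    and L2: "\<And>k f. f \<in> L2 M \<Longrightarrow> (\<lambda>x. f (D k x)) \<in> L2 M"
    and bd: "\<And>k f. f \<in> L2 M \<Longrightarrow> l2_sq M (\<lambda>x. f (D k x)) \<le> B k * l2_sq M f"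
    and D0: "\<And>x. x \<in> space M \<Longrightarrow> D 0 x = x"
    and DD: "\<And>i k x. x \<in> space M \<Longrightarrow> D i (D k x) = D (i + k) x"
    and V: "\<And>j. closed_subspace M (V j)"
    and step: "\<And>j f. f \<in> L2 M \<Longrightarrow> f \<in> V j \<longleftrightarrow> (\<lambda>x. f (D 1 x)) \<in> V (j + 1)"
    and S: "S \<subseteq> L2 M" "V 0 = closed_span M S"
begin

text \<open>Iterating \<open>step\<close> relates level 0 to level j. An element of level j is
  pulled back to level 0, approximated there, and carried forward by the bounded operator given by
  \<open>D j\<close>.\<close>

lemma scaled_span: "V j = closed_span M ((\<lambda>f x. f (D j x)) ` S)"
proof -
  have sp_cong: "f \<in> V i \<longleftrightarrow> g \<in> V i" if "\<And>x. x \<in> space M \<Longrightarrow> f x = g x" for f g i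
  proof
    assume "f \<in> V i" then show "g \<in> V i" by (rule closed_subspace_cong[OF V[of i], of f g]) (rule that)
  next
    assume "g \<in> V i" then show "f \<in> V i" by (rule closed_subspace_cong[OF V[of i], of g f]) (rule that[symmetric])
  qed
  have up: "f \<in> V j \<longleftrightarrow> (\<lambda>x. f (D (int n) x)) \<in> V (j + int n)" if "f \<in> L2 M" for f j n
  proof (induction n)
    case 0
    have "f \<in> V j \<longleftrightarrow> (\<lambda>x. f (D 0 x)) \<in> V j" by (rule sp_cong) (simp add: D0)
    then show ?case by simp
  next
    case (Suc n)
    have e: "f (D (int n) (D 1 x)) = f (D (int (Suc n)) x)" if "x \<in> space M" for x
      using DD[OF that] by (simp add: add.commute)
    have "f \<in> V j \<longleftrightarrow> (\<lambda>x. f (D (int n) (D 1 x))) \<in> V (j + int n + 1)"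
      using step[of "\<lambda>x. f (D (int n) x)" "j + int n", OF L2[OF that]] Suc by blast
    also have "\<dots> \<longleftrightarrow> (\<lambda>x. f (D (int (Suc n)) x)) \<in> V (j + int n + 1)"
    proof
      assume "(\<lambda>x. f (D (int n) (D 1 x))) \<in> V (j + int n + 1)"
      then show "(\<lambda>x. f (D (int (Suc n)) x)) \<in> V (j + int n + 1)"
        by (rule closed_subspace_cong[OF V]) (rule e)
    next
      assume "(\<lambda>x. f (D (int (Suc n)) x)) \<in> V (j + int n + 1)"
      then show "(\<lambda>x. f (D (int n) (D 1 x))) \<in> V (j + int n + 1)"
        by (rule closed_subspace_cong[OF V]) (rule e[symmetric])
    qed
    also have "j + int n + 1 = j + int (Suc n)" by simp
    finally show ?case .
  qed
  have inv: "f (D i (D k x)) = f x" if "x \<in> space M" "i + k = 0" for f :: "'a \<Rightarrow> complex" and x i k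
    using DD[OF that(1), of i k] D0[OF that(1)] that(2) by simp
  have iff: "f \<in> V 0 \<longleftrightarrow> (\<lambda>x. f (D j x)) \<in> V j" if f: "f \<in> L2 M" for f
  proof (cases "j \<ge> 0")
    case True
    then show ?thesis using up[OF f, of 0 "nat j"] by simp
  next
    case False
    \<comment> \<open>A negative level is treated from below: climbing -j levels from
      \<open>V j\<close> composes with \<open>D (- j)\<close> and arrives at level 0.\<close>
    have "(\<lambda>x. f (D j x)) \<in> V j \<longleftrightarrow> (\<lambda>x. f (D j (D (- j) x))) \<in> V 0"
      using False up[OF L2[OF f], of j j "nat (- j)"] by simp
    also have "\<dots> \<longleftrightarrow> f \<in> V 0" by (rule sp_cong) (rule inv, auto)
    finally show ?thesis ..
  qed
  show ?thesis
  proof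
    show "V j \<subseteq> closed_span M ((\<lambda>f x. f (D j x)) ` S)"
    proof
      fix g assume g: "g \<in> V j"
      then have gL: "g \<in> L2 M" using V[of j] by (auto simp: closed_subspace_def)
      have e: "g (D (- j) (D j x)) = g x" if "x \<in> space M" for x by (rule inv) (use that in auto)
      have "(\<lambda>x. g (D (- j) (D j x))) \<in> V j" using sp_cong[of "\<lambda>x. g (D (- j) (D j x))" g j, OF e] g by simp
      then have g0: "(\<lambda>x. g (D (- j) x)) \<in> V 0" using iff[OF L2[OF gL], of "- j"] by blast
      have "(\<lambda>x. g (D (- j) (D j x))) \<in> closed_span M ((\<lambda>f x. f (D j x)) ` S)"
      proof (rule closed_span_map[where T = "\<lambda>f x. f (D j x)" and M = M and S = S and B = "B j"])
        show "(\<lambda>x. g (D (- j) x)) \<in> closed_span M S" using g0 S(2) by simp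
      qed (use S(1) L2 bd in \<open>auto intro!: closed_span_base\<close>)
      then show "g \<in> closed_span M ((\<lambda>f x. f (D j x)) ` S)"
        by (rule closed_span_cong) (rule e)
    qed
    have "S \<subseteq> V 0" using S closed_span_base by blast
    then have "(\<lambda>f x. f (D j x)) ` S \<subseteq> V j" using iff S(1) by blast
    then show "closed_span M ((\<lambda>f x. f (D j x)) ` S) \<subseteq> V j" by (intro closed_subspace_closed_span V)
  qed
qed

text \<open>By the group law \<open>D i\<close> turns a generator of level j into one of level j +
  i, for either sign of i.\<close>

lemma scaled_map:
  assumes f: "f \<in> V j" shows "(\<lambda>x. f (D i x)) \<in> V (j + i)"
proof (unfold scaled_span[of "j + i"], rule closed_span_map[where T = "\<lambda>f x. f (D i x)" and M = M and B = "B i"])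
  show "f \<in> closed_span M ((\<lambda>f x. f (D j x)) ` S)" using f scaled_span by simp
  show "(\<lambda>f x. f (D j x)) ` S \<subseteq> L2 M" using S L2 by auto
  fix g assume "g \<in> (\<lambda>f x. f (D j x)) ` S"
  then obtain h where h: "h \<in> S" "g = (\<lambda>x. h (D j x))" by auto
  have "(\<lambda>x. h (D (j + i) x)) \<in> closed_span M ((\<lambda>f x. f (D (j + i) x)) ` S)"
    using h(1) S(1) L2 by (intro closed_span_base) auto
  then show "(\<lambda>x. g (D i x)) \<in> closed_span M ((\<lambda>f x. f (D (j + i) x)) ` S)"
    by (rule closed_span_cong) (simp add: h(2) DD)
qed (use L2 bd in auto)

end

section \<open>Haar measure on the p-adic numbers\<close>

locale padic_haar_place = padic_place +
  fixes \<mu> :: "padic measure"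
  assumes haar: "padic_haar p \<mu>"
begin

text \<open>Rational centres make the family countable, and by density they still give balls of
  every radius around every point.\<close>

definition ball :: "int \<Rightarrow> rat \<Rightarrow> padic set" where
  "ball k r = {x \<in> Qp p. nrm (dif x (rat r)) \<le> real p powi k}"

lemma space_haar [simp]: "space \<mu> = Qp p"
  using haar by (simp add: padic_haar_def)

lemma ball_subset: "ball k r \<subseteq> Qp p"
  by (auto simp: ball_def)

lemma ppow_pos [simp]: "real p powi k > 0"
  using p_gt_0 by simp

text \<open>Every point of an ultrametric ball is a centre of it, so one common point forces
  inclusion of the smaller ball.\<close>

lemma ball_nested:
  assumes "x \<in> ball k r" "x \<in> ball i s" "k \<le> i" shows "ball k r \<subseteq> ball i s"
proof
  fix y assume y: "y \<in> ball k r"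
  have x: "x \<in> Qp p" "y \<in> Qp p" "rat r \<in> Qp p" "rat s \<in> Qp p" using assms y by (auto simp: ball_def)
  have le: "real p powi k \<le> real p powi i" using assms p_gt_1 by (intro power_int_increasing) auto
  have "nrm (dif y x) \<le> real p powi k"
    using nrm_triangle[OF x(2,3,1)] nrm_commute[OF x(3,1)] assms y x by (auto simp: ball_def)
  then have "nrm (dif y (rat s)) \<le> real p powi i"
    using nrm_triangle[OF x(2,1,4)] assms le by (auto simp: ball_def)
  then show "y \<in> ball i s" using x by (simp add: ball_def)
qed

lemma ball_disjoint_or_nested:
  "ball k r \<inter> ball i s = {} \<or> ball k r \<subseteq> ball i s \<or> ball i s \<subseteq> ball k r"
  using ball_nested[of _ k r i s] ball_nested[of _ i s k r] by (cases "k \<le> i") fastforce+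

lemma ball_open: "padic_open p (ball k r)"
  unfolding padic_open_def
proof (intro conjI ballI ball_subset)
  fix x assume x: "x \<in> ball k r"
  show "\<exists>\<epsilon>>0. \<forall>y\<in>Qp p. nrm (dif y x) < \<epsilon> \<longrightarrow> y \<in> ball k r"
  proof (intro exI[of _ "real p powi k"] conjI ballI impI ppow_pos)
    fix y assume "y \<in> Qp p" "nrm (dif y x) < real p powi k"
    then show "y \<in> ball k r" using x nrm_triangle[of y x "rat r"] by (auto simp: ball_def)
  qed
qed

lemma Zp_eq_ball: "Zp p = ball 0 0"
  by (auto simp: Zp_def ball_def)

lemma small_power: assumes "e > 0" shows "\<exists>k. real p powi k < e"
proof -
  obtain n where "(1 / real p) ^ n < e"
    using real_arch_pow_inv[of e "1 / real p"] assms p_gt_1 by auto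
  then show ?thesis by (intro exI[of _ "- int n"]) (simp add: power_int_minus divide_inverse power_inverse)
qed

lemma large_power: "\<exists>n. x \<le> real p ^ n"
  using real_arch_pow[of "real p" x] p_gt_1 by (auto intro: less_imp_le)

lemma ball_around: assumes "x \<in> Qp p" shows "\<exists>r. x \<in> ball k r"
  using rat_dense[OF assms ppow_pos[of k]] assms by (auto simp: ball_def intro: less_imp_le)

text \<open>The union is over a countable family, so balls generate the Borel sets.\<close>

lemma open_eq_Union_balls:
  assumes "padic_open p U"
  shows "U = \<Union> (case_prod ball ` {kr. case_prod ball kr \<subseteq> U})"
proof
  show "U \<subseteq> \<Union> (case_prod ball ` {kr. case_prod ball kr \<subseteq> U})"
  proof
    fix x assume x: "x \<in> U"
    then obtain e where e: "e > 0" "\<And>y. y \<in> Qp p \<Longrightarrow> nrm (dif y x) < e \<Longrightarrow> y \<in> U"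
      using assms by (auto simp: padic_open_def)
    have xQ: "x \<in> Qp p" using x assms by (auto simp: padic_open_def)
    obtain k where k: "real p powi k < e" using small_power[OF e(1)] by blast
    obtain r where r: "x \<in> ball k r" using ball_around[OF xQ] by blast
    have "ball k r \<subseteq> U"
    proof
      fix y assume y: "y \<in> ball k r"
      have "nrm (dif y x) \<le> real p powi k"
        using nrm_triangle[of y "rat r" x] nrm_commute[of x "rat r"] r y xQ by (auto simp: ball_def)
      then show "y \<in> U" using e(2)[of y] k y by (auto simp: ball_def)
    qed
    then show "x \<in> \<Union> (case_prod ball ` {kr. case_prod ball kr \<subseteq> U})" using r by force
  qed
qed auto

text \<open>The empty set is added to make the family stable under intersection, as disjoint balls
  occur.\<close>

definition balls :: "padic set set" where "balls = insert {} (range (case_prod ball))"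

lemma sets_haar: "sets \<mu> = sigma_sets (Qp p) balls"
proof -
  have "sigma_sets (Qp p) {U. padic_open p U} = sigma_sets (Qp p) balls"
  proof (rule sigma_sets_eqI)
    fix U assume "U \<in> {U. padic_open p U}"
    then have "U = \<Union> (case_prod ball ` {kr. case_prod ball kr \<subseteq> U})" by (intro open_eq_Union_balls) simp
    also have "\<dots> \<in> sigma_sets (Qp p) balls"
    proof (rule sigma_sets_UNION)
      show "countable (case_prod ball ` {kr. case_prod ball kr \<subseteq> U})" by (intro countable_image) auto
    qed (auto simp: balls_def)
    finally show "U \<in> sigma_sets (Qp p) balls" .
  next
    fix B assume "B \<in> balls"
    then show "B \<in> sigma_sets (Qp p) {U. padic_open p U}"
      using ball_open by (auto simp: balls_def sigma_sets.Empty)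
  qed
  then show ?thesis using haar by (simp add: padic_haar_def)
qed

lemma ball_sets [measurable, simp]: "ball k r \<in> sets \<mu>"
  unfolding sets_haar by (auto simp: balls_def)

lemma Zp_sets [measurable, simp]: "Zp p \<in> sets \<mu>"
  by (simp add: Zp_eq_ball)

lemma Qp_sets [measurable, simp]: "Qp p \<in> sets \<mu>"
  using sets.top[of \<mu>] by simp

lemma Int_stable_balls: "Int_stable balls"
proof -
  have "B \<inter> C \<in> balls" if BC: "B \<in> balls" "C \<in> balls" for B C
  proof (cases "B = {} \<or> C = {}")
    case True
    then show ?thesis by (auto simp: balls_def)
  next
    case False
    then obtain k r i s where "B = ball k r" "C = ball i s" using BC by (auto simp: balls_def)
    then have "B \<inter> C = {} \<or> B \<inter> C = B \<or> B \<inter> C = C" using ball_disjoint_or_nested[of k r i s] by blast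
    then show ?thesis using BC by (auto simp: balls_def)
  qed
  then show ?thesis by (auto simp: Int_stable_def)
qed

lemma Union_balls: "(\<Union>n. ball (int n) 0) = Qp p"
proof
  show "Qp p \<subseteq> (\<Union>n. ball (int n) 0)"
  proof
    fix x assume "x \<in> Qp p"
    then show "x \<in> (\<Union>n. ball (int n) 0)" using large_power[of "nrm x"] by (auto simp: ball_def)
  qed
qed (use ball_subset in auto)

section \<open>The measure of a ball\<close>

lemma ball_translate: "ball k r = (\<lambda>x. dif x (rat (- r))) ` ball k 0"
proof
  show "ball k r \<subseteq> (\<lambda>x. dif x (rat (- r))) ` ball k 0"
  proof
    fix x assume x: "x \<in> ball k r"
    then have "x = dif (dif x (rat r)) (rat (- r))" by (simp add: ball_def dif_rat_rat)
    moreover have "dif x (rat r) \<in> ball k 0" using x by (simp add: ball_def dif_rat_rat)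
    ultimately show "x \<in> (\<lambda>x. dif x (rat (- r))) ` ball k 0" by blast
  qed
  show "(\<lambda>x. dif x (rat (- r))) ` ball k 0 \<subseteq> ball k r"
    by (auto simp: ball_def dif_rat_rat)
qed

text \<open>Invariance is assumed for images under subtraction, so the ball around r is presented as
  the image of the central ball under subtraction of -r.\<close>

lemma emeasure_ball_eq: "emeasure \<mu> (ball k r) = emeasure \<mu> (ball k 0)"
  unfolding ball_translate[of k r] using haar unfolding padic_haar_def
  by (meson ball_sets rat_Qp)

text \<open>Multiplication by p^(k+1) has norm factor p^(-(k+1)). It carries the ball of level k + 1
  onto the integers and the listed balls onto the residue classes modulo p.\<close>

lemma ball_split:
  "ball (k + 1) 0 = (\<Union>c<p. ball k (of_nat c / of_nat p powi (k + 1)))"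
  "disjoint_family_on (\<lambda>c. ball k (of_nat c / of_nat p powi (k + 1))) {..<p}"
proof -
  have pz: "(of_nat p :: rat) \<noteq> 0" using p_gt_0 by simp
  have *: "nrm (dif x (rat (of_nat c / of_nat p powi (k + 1)))) \<le> real p powi k \<longleftrightarrow>
      nrm (dif (scl (of_nat p powi (k + 1)) x) (rat (of_nat c))) < 1" if "x \<in> Qp p" for x c
  proof -
    have "dif (scl (of_nat p powi (k + 1)) x) (rat (of_nat c))
        = scl (of_nat p powi (k + 1)) (dif x (rat (of_nat c / of_nat p powi (k + 1))))"
      using that pz by (simp add: scl_dif scl_rat)
    then have "nrm (dif (scl (of_nat p powi (k + 1)) x) (rat (of_nat c)))
       = nrm (dif x (rat (of_nat c / of_nat p powi (k + 1)))) / real p powi (k + 1)"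
      using that by (simp add: nrm_scl rn_p_powi power_int_minus[of _ "k + 1"] divide_inverse mult.commute
          del: minus_add_distrib)
    then show ?thesis using that nrm_lt_iff[of "dif x (rat (of_nat c / of_nat p powi (k + 1)))" k] ppow_pos[of "k + 1"]
      by (simp add: divide_less_eq)
  qed
  have **: "nrm (dif x (rat 0)) \<le> real p powi (k + 1) \<longleftrightarrow> nrm (scl (of_nat p powi (k + 1)) x) \<le> 1" if "x \<in> Qp p" for x
  proof -
    have "nrm (scl (of_nat p powi (k + 1)) x) = nrm x / real p powi (k + 1)"
      using that by (simp add: nrm_scl rn_p_powi power_int_minus[of _ "k + 1"] divide_inverse mult.commute
          del: minus_add_distrib)
    then show ?thesis using that ppow_pos[of "k + 1"] by (simp add: divide_le_eq)
  qed
  have imp: "nrm y \<le> 1" if "y \<in> Qp p" "nrm (dif y (rat (of_nat c))) < 1" for y c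
    using nrm_triangle[of y "rat (of_nat c)" "rat 0"] that rn_of_int_le_1[of "int c"] by (simp add: max_def split: if_splits)
  show "ball (k + 1) 0 = (\<Union>c<p. ball k (of_nat c / of_nat p powi (k + 1)))"
  proof (rule set_eqI)
    fix x
    have "x \<in> ball (k + 1) 0 \<longleftrightarrow> x \<in> Qp p \<and> nrm (scl (of_nat p powi (k + 1)) x) \<le> 1"
      using **[of x] unfolding ball_def by blast
    also have "\<dots> \<longleftrightarrow> x \<in> Qp p \<and> (\<exists>c<p. nrm (dif (scl (of_nat p powi (k + 1)) x) (rat (of_nat c))) < 1)"
      using ex1_digit[of "scl (of_nat p powi (k + 1)) x"] imp[of "scl (of_nat p powi (k + 1)) x"] by (meson scl_Qp)
    also have "\<dots> \<longleftrightarrow> x \<in> (\<Union>c<p. ball k (of_nat c / of_nat p powi (k + 1)))"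
      using *[of x] unfolding ball_def by blast
    finally show "x \<in> ball (k + 1) 0 \<longleftrightarrow> x \<in> (\<Union>c<p. ball k (of_nat c / of_nat p powi (k + 1)))" .
  qed
  show "disjoint_family_on (\<lambda>c. ball k (of_nat c / of_nat p powi (k + 1))) {..<p}"
    unfolding disjoint_family_on_def
  proof (intro ballI impI equals0I)
    fix c d x assume cd: "c \<in> {..<p}" "d \<in> {..<p}" "c \<noteq> d"
      "x \<in> ball k (of_nat c / of_nat p powi (k + 1)) \<inter> ball k (of_nat d / of_nat p powi (k + 1))"
    then have x: "x \<in> Qp p" and lt: "nrm (dif (scl (of_nat p powi (k + 1)) x) (rat (of_nat c))) < 1"
      "nrm (dif (scl (of_nat p powi (k + 1)) x) (rat (of_nat d))) < 1" by (auto simp: ball_def *)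
    show False using ex1_digit[OF scl_Qp[OF x] imp[OF scl_Qp[OF x] lt(1)]] lt cd by blast
  qed
qed

lemma emeasure_ball_Suc: "emeasure \<mu> (ball (k + 1) 0) = of_nat p * emeasure \<mu> (ball k 0)"
proof -
  have "emeasure \<mu> (ball (k + 1) 0) = (\<Sum>c<p. emeasure \<mu> (ball k (of_nat c / of_nat p powi (k + 1))))"
    unfolding ball_split(1) by (rule sum_emeasure[symmetric]) (use ball_split(2) in auto)
  also have "\<dots> = of_nat p * emeasure \<mu> (ball k 0)" by (subst emeasure_ball_eq) simp
  finally show ?thesis .
qed

text \<open>Splitting multiplies the measure by p from level to level; induction runs in both
  directions from the normalisation at level 0, downwards by cancelling the finite nonzero factor
  p.\<close>

lemma emeasure_ball: "emeasure \<mu> (ball k r) = ennreal (real p powi k)"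
proof -
  have "emeasure \<mu> (ball k 0) = ennreal (real p powi k)"
  proof (induction k rule: int_induct[where k = 0])
    case base
    show ?case using haar by (simp add: padic_haar_def Zp_eq_ball)
  next
    case (step1 i)
    then show ?case using p_gt_0
      by (simp add: emeasure_ball_Suc power_int_add ennreal_mult ennreal_of_nat_eq_real_of_nat mult.commute)
  next
    case (step2 i)
    have eq: "ennreal (real p) * emeasure \<mu> (ball (i - 1) 0) = ennreal (real p) * ennreal (real p powi (i - 1))"
      using step2 emeasure_ball_Suc[of "i - 1"] p_gt_0 power_int_add[of "real p" 1 "i - 1"]
      by (simp add: ennreal_of_nat_eq_real_of_nat flip: ennreal_mult)
    then show ?case using p_gt_0 by (subst (asm) ennreal_mult_cancel_left) auto
  qed
  then show ?thesis by (simp add: emeasure_ball_eq[of k r])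
qed

lemma emeasure_Zp [simp]: "emeasure \<mu> (Zp p) = 1"
  by (simp add: Zp_eq_ball emeasure_ball)

text \<open>Balls form a generator stable under intersection, and the balls around 0 exhaust the
  space with finite measure.\<close>

lemma haar_eqI:
  assumes "sets \<nu> = sets \<mu>" "\<And>k r. emeasure \<nu> (ball k r) = emeasure \<mu> (ball k r)"
  shows "\<nu> = \<mu>"
proof (rule sym, rule measure_eqI_generator_eq)
  show "Int_stable balls" by (rule Int_stable_balls)
  show "balls \<subseteq> Pow (Qp p)" using ball_subset by (auto simp: balls_def)
  show "range (\<lambda>n. ball (int n) 0) \<subseteq> balls" by (auto simp: balls_def)
  show "emeasure \<mu> (ball (int i) 0) \<noteq> \<infinity>" for i by (simp add: emeasure_ball)
qed (use assms sets_haar Union_balls in \<open>auto simp: balls_def\<close>)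

lemma measurable_haarI:
  assumes "\<And>x. x \<in> space M \<Longrightarrow> f x \<in> Qp p" "\<And>k r. f -` ball k r \<inter> space M \<in> sets M"
  shows "f \<in> measurable M \<mu>"
proof (rule measurable_sigma_sets[OF sets_haar])
  show "balls \<subseteq> Pow (Qp p)" using ball_subset by (auto simp: balls_def)
  show "f -` y \<inter> space M \<in> sets M" if "y \<in> balls" for y using that assms by (auto simp: balls_def)
qed (use assms in auto)

lemma sigma_finite_haar: "sigma_finite_measure \<mu>"
proof
  show "\<exists>A. countable A \<and> A \<subseteq> sets \<mu> \<and> \<Union> A = space \<mu> \<and> (\<forall>a\<in>A. emeasure \<mu> a \<noteq> \<infinity>)"
    using Union_balls by (intro exI[of _ "range (\<lambda>n. ball (int n) 0)"]) (auto simp: emeasure_ball)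
qed

section \<open>Scaling of Haar measure by powers of p\<close>

abbreviation pscl :: "int \<Rightarrow> padic \<Rightarrow> padic" where "pscl k \<equiv> scl (of_nat p powi k)"

lemma pscl_ball: "pscl k -` ball i r \<inter> Qp p = ball (i + k) (r / of_nat p powi k)"
proof -
  have pz: "(of_nat p :: rat) \<noteq> 0" using p_gt_0 by simp
  have "nrm (dif (pscl k x) (rat r)) \<le> real p powi i \<longleftrightarrow>
    nrm (dif x (rat (r / of_nat p powi k))) \<le> real p powi (i + k)" if "x \<in> Qp p" for x
  proof -
    have "dif (pscl k x) (rat r) = pscl k (dif x (rat (r / of_nat p powi k)))"
      using that pz by (simp add: scl_dif scl_rat)
    then show ?thesis using that p_gt_0
      by (simp add: nrm_scl rn_p_powi power_int_minus power_int_add field_simps)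
  qed
  then show ?thesis by (auto simp: ball_def)
qed

lemma pscl_measurable [measurable]: "pscl k \<in> measurable \<mu> \<mu>"
  by (rule measurable_haarI) (auto simp: pscl_ball)

text \<open>Multiplication by p^k shrinks norms, so preimages of balls are balls p^k times as large.
  The push-forward multiplied by p^(-k) therefore agrees with \<open>\<mu>\<close> on balls, hence
  everywhere.\<close>

lemma emeasure_pscl:
  assumes "B \<in> sets \<mu>"
  shows "emeasure \<mu> (pscl k -` B \<inter> Qp p) = ennreal (real p powi k) * emeasure \<mu> B"
proof -
  have "density (distr \<mu> \<mu> (pscl k)) (\<lambda>_. ennreal (real p powi (- k))) = \<mu>"
  proof (rule haar_eqI)
    fix i r
    have "emeasure (density (distr \<mu> \<mu> (pscl k)) (\<lambda>_. ennreal (real p powi (- k)))) (ball i r)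
      = ennreal (real p powi (- k)) * emeasure \<mu> (ball (i + k) (r / of_nat p powi k))"
      by (simp add: emeasure_density_const emeasure_distr pscl_ball)
    also have "\<dots> = emeasure \<mu> (ball i r)"
      using p_gt_0 by (simp add: emeasure_ball power_int_add power_int_minus field_simps flip: ennreal_mult)
    finally show "emeasure (density (distr \<mu> \<mu> (pscl k)) (\<lambda>_. ennreal (real p powi (- k)))) (ball i r)
      = emeasure \<mu> (ball i r)" .
  qed simp
  then have "emeasure \<mu> B = ennreal (real p powi (- k)) * emeasure \<mu> (pscl k -` B \<inter> Qp p)"
    using emeasure_density_const[of B "distr \<mu> \<mu> (pscl k)" "ennreal (real p powi (- k))"] assms
    by (simp add: emeasure_distr)
  then have "ennreal (real p powi k) * emeasure \<mu> B
    = ennreal (real p powi k * real p powi (- k)) * emeasure \<mu> (pscl k -` B \<inter> Qp p)"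
    by (simp add: ennreal_mult mult.assoc)
  then show ?thesis using p_gt_0 by (simp add: power_int_minus)
qed

lemma pscl_L2:
  assumes "f \<in> L2 \<mu>"
  shows "(\<lambda>x. f (pscl k x)) \<in> L2 \<mu>" "l2_sq \<mu> (\<lambda>x. f (pscl k x)) = real p powi k * l2_sq \<mu> f"
  by (rule scaled_comp[OF pscl_measurable]; use assms p_gt_0 in \<open>simp add: emeasure_pscl\<close>)+

lemma pscl_pscl: "x \<in> Qp p \<Longrightarrow> pscl i (pscl k x) = pscl (i + k) x"
  using p_gt_0 by (simp add: scl_scl power_int_add)

end

section \<open>The measure on the adeles\<close>

locale adele_measure =
  fixes \<mu> :: "nat \<Rightarrow> padic measure" and A :: "adele measure"
  assumes haar_p: "\<And>p. prime p \<Longrightarrow> padic_haar p (\<mu> p)"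
    and haar_A: "adele_haar \<mu> A"
begin

lemma place: "prime p \<Longrightarrow> padic_haar_place p (\<mu> p)"
  by (simp add: padic_haar_place_def padic_place_def padic_haar_place_axioms_def haar_p)

lemma space_mu: "prime p \<Longrightarrow> space (\<mu> p) = Qp p"
  using padic_haar_place.space_haar[OF place] .

lemma Zp_sets: "prime p \<Longrightarrow> Zp p \<in> sets (\<mu> p)"
  using padic_haar_place.Zp_sets[OF place] .

lemma Qp_sets: "prime p \<Longrightarrow> Qp p \<in> sets (\<mu> p)"
  using padic_haar_place.Qp_sets[OF place] .

lemma emeasure_Zp: "prime p \<Longrightarrow> emeasure (\<mu> p) (Zp p) = 1"
  using padic_haar_place.emeasure_Zp[OF place] .

section \<open>Finite adeles, their boxes, and the volume of a box\<close>

definition Afin :: "(nat \<Rightarrow> padic) set" where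
  "Afin = {y \<in> (\<Pi>\<^sub>E p\<in>{p. prime p}. Qp p). finite {p. prime p \<and> y p \<notin> Zp p}}"

definition fbox :: "(nat \<Rightarrow> padic set) \<Rightarrow> (nat \<Rightarrow> padic) set" where
  "fbox C = (\<Pi>\<^sub>E p\<in>{p. prime p}. C p)"

definition sides :: "(nat \<Rightarrow> padic set) \<Rightarrow> bool" where
  "sides C \<longleftrightarrow> (\<forall>p. prime p \<longrightarrow> C p \<in> sets (\<mu> p)) \<and> finite {p. prime p \<and> C p \<noteq> Zp p}"

definition fboxes where "fboxes = {fbox C |C. sides C}"

definition vol :: "(nat \<Rightarrow> padic set) \<Rightarrow> ennreal" where
  "vol C = (\<Prod>p | prime p \<and> C p \<noteq> Zp p. emeasure (\<mu> p) (C p))"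

lemma adeles_eq: "adeles = UNIV \<times> Afin"
  by (auto simp: adeles_def Afin_def)

lemma adele_box_eq: "adele_box B C = B \<times> fbox C"
  by (simp add: adele_box_def fbox_def)

lemma adele_box_sides_iff: "(B, C) \<in> adele_box_sides \<mu> \<longleftrightarrow> B \<in> sets lborel \<and> sides C"
  by (auto simp: adele_box_sides_def sides_def)

lemma space_A: "space A = UNIV \<times> Afin"
  using haar_A by (simp add: adele_haar_def adeles_eq)

abbreviation gens :: "adele set set" where "gens \<equiv> {B \<times> E |B E. B \<in> sets lborel \<and> E \<in> fboxes}"

lemma sets_A: "sets A = sigma_sets (UNIV \<times> Afin) gens"
proof -
  have "{adele_box B C |B C. (B, C) \<in> adele_box_sides \<mu>} = gens"
    by (auto simp: adele_box_sides_iff adele_box_eq fboxes_def simp del: sets_lborel)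
  then show ?thesis using haar_A by (simp add: adele_haar_def adeles_eq del: sets_lborel)
qed

lemma gensI: "B \<in> sets lborel \<Longrightarrow> sides C \<Longrightarrow> B \<times> fbox C \<in> gens"
  unfolding fboxes_def by blast

lemma emeasure_A_box: "B \<in> sets lborel \<Longrightarrow> sides C \<Longrightarrow> emeasure A (B \<times> fbox C) = emeasure lborel B * vol C"
proof -
  assume "B \<in> sets lborel" "sides C"
  then have "(B, C) \<in> adele_box_sides \<mu>" by (simp add: adele_box_sides_iff del: sets_lborel)
  moreover have "\<forall>(B, C) \<in> adele_box_sides \<mu>.
        emeasure A (adele_box B C) = emeasure lborel B * (\<Prod>p | prime p \<and> C p \<noteq> Zp p. emeasure (\<mu> p) (C p))"
    using haar_A by (simp add: adele_haar_def)
  ultimately show ?thesis by (auto simp: adele_box_eq vol_def)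
qed

text \<open>Sides equal to the integers contribute the factor 1, so any finite set of primes
  containing the exceptional ones may index the product; boxes can then be compared over common
  primes.\<close>

lemma vol_eq:
  assumes "finite S" "S \<subseteq> {p. prime p}" "\<And>p. prime p \<Longrightarrow> p \<notin> S \<Longrightarrow> C p = Zp p"
  shows "vol C = (\<Prod>p\<in>S. emeasure (\<mu> p) (C p))"
  unfolding vol_def using assms
  by (intro prod.mono_neutral_left) (auto simp: emeasure_Zp)

lemma sidesI:
  assumes "finite S" "\<And>p. prime p \<Longrightarrow> p \<notin> S \<Longrightarrow> C p = Zp p" "\<And>p. prime p \<Longrightarrow> C p \<in> sets (\<mu> p)"
  shows "sides C"
  unfolding sides_def using assms
  by (auto intro: finite_subset[of _ S])

lemma sides_sets: "sides C \<Longrightarrow> prime p \<Longrightarrow> C p \<in> sets (\<mu> p)"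
  by (simp add: sides_def)

lemma fbox_subset: "sides C \<Longrightarrow> fbox C \<subseteq> Afin"
proof
  fix y assume C: "sides C" and y: "y \<in> fbox C"
  have "y p \<in> Qp p" if "prime p" for p
    using that C y sets.sets_into_space[of "C p" "\<mu> p"] by (auto simp: fbox_def sides_def space_mu)
  moreover have "finite {p. prime p \<and> y p \<notin> Zp p}"
    using C y by (auto simp: fbox_def sides_def elim!: finite_subset[rotated])
  ultimately show "y \<in> Afin" using y by (auto simp: Afin_def fbox_def PiE_iff)
qed

lemma fboxI: "y \<in> Afin \<Longrightarrow> (\<And>p. prime p \<Longrightarrow> y p \<in> C p) \<Longrightarrow> y \<in> fbox C"
  by (simp add: fbox_def Afin_def PiE_iff)

lemma fboxD: "y \<in> fbox C \<Longrightarrow> prime p \<Longrightarrow> y p \<in> C p"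
  by (auto simp: fbox_def PiE_iff)

lemma fboxes_Pow: "fboxes \<subseteq> Pow Afin"
  using fbox_subset by (auto simp: fboxes_def)

lemma fbox_Int: "fbox C \<inter> fbox D = fbox (\<lambda>p. C p \<inter> D p)"
  by (auto simp: fbox_def)

lemma sides_Int: assumes "sides C" "sides D" shows "sides (\<lambda>p. C p \<inter> D p)"
  using assms
  by (intro sidesI[of "{p. prime p \<and> C p \<noteq> Zp p} \<union> {p. prime p \<and> D p \<noteq> Zp p}"]) (auto simp: sides_def)

lemma Int_stable_fboxes: "Int_stable fboxes"
  unfolding Int_stable_def fboxes_def using fbox_Int sides_Int by blast

text \<open>The boxes over these sides are increasing, have finite volume and exhaust the finite
  adeles: enlarging n relaxes both the primes allowed to be nonintegral and the size at
  them.\<close>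

definition cell :: "nat \<Rightarrow> nat \<Rightarrow> padic set" where
  "cell n p = (if p \<le> n then {x \<in> Qp p. padic_norm p x \<le> real p ^ n} else Zp p)"

lemma cell_ball: "prime p \<Longrightarrow> p \<le> n \<Longrightarrow> cell n p = padic_haar_place.ball p (int n) 0"
proof -
  assume p: "prime p" "p \<le> n"
  interpret padic_haar_place p "\<mu> p" by (rule place) (rule p)
  show ?thesis using p by (auto simp: cell_def ball_def)
qed

lemma cell_sets: "prime p \<Longrightarrow> cell n p \<in> sets (\<mu> p)"
proof -
  assume p: "prime p"
  interpret padic_haar_place p "\<mu> p" by (rule place) (rule p)
  show ?thesis using p cell_ball[OF p, of n] by (cases "p \<le> n") (auto simp: cell_def)
qed

lemma cell_finite: "prime p \<Longrightarrow> emeasure (\<mu> p) (cell n p) < \<infinity>"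
proof -
  assume p: "prime p"
  interpret padic_haar_place p "\<mu> p" by (rule place) (rule p)
  show ?thesis using p cell_ball[OF p, of n]
    by (cases "p \<le> n") (auto simp: cell_def[of n p] emeasure_ball)
qed

lemma sides_cell: "sides (cell n)"
  by (rule sidesI[of "{..n}"]) (auto simp: cell_sets, auto simp: cell_def)

lemma vol_cell: "vol (cell n) < \<infinity>"
  unfolding vol_def using cell_finite
  by (auto simp: less_top[symmetric] ennreal_prod_eq_top)

lemma cell_mono: assumes "prime p" "n \<le> N" shows "cell n p \<subseteq> cell N p"
proof
  fix z assume z: "z \<in> cell n p"
  have le: "real p ^ n \<le> real p ^ N" "1 \<le> real p ^ N"
    using prime_ge_1_nat[OF assms(1)] assms(2) by (auto intro: power_increasing)
  have "padic_norm p z \<le> 1 \<or> padic_norm p z \<le> real p ^ n" "z \<in> Qp p" "p \<le> N \<or> z \<in> Zp p"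
    using z assms(2) by (auto simp: cell_def Zp_def split: if_splits)
  then show "z \<in> cell N p" using le by (auto simp: cell_def)
qed

lemma Afin_cell: assumes "y \<in> Afin" shows "\<exists>n. \<forall>p. prime p \<longrightarrow> y p \<in> cell n p"
proof -
  let ?F = "{p. prime p \<and> y p \<notin> Zp p}"
  have fin: "finite ?F" and yQ: "\<And>p. prime p \<Longrightarrow> y p \<in> Qp p" using assms by (auto simp: Afin_def)
  have "\<exists>k. padic_norm p (y p) \<le> real p ^ k" if "prime p" for p
    using padic_haar_place.large_power[OF place[OF that]] .
  then obtain k where k: "\<And>p. prime p \<Longrightarrow> padic_norm p (y p) \<le> real p ^ k p" by metis
  \<comment> \<open>A sum over the finitely many nonintegral places dominates each of these primes
    as well as the exponent needed there.\<close>
  define n where "n = (\<Sum>p\<in>?F. p + k p)"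
  have n: "p \<le> n \<and> k p \<le> n" if "p \<in> ?F" for p
  proof -
    have "p + k p \<le> n" unfolding n_def using fin that by (intro member_le_sum) auto
    then show ?thesis by auto
  qed
  have "y p \<in> cell n p" if p: "prime p" for p
  proof (cases "p \<in> ?F")
    case True
    have "real p ^ k p \<le> real p ^ n"
      using n[OF True] prime_ge_1_nat[OF p] by (intro power_increasing) auto
    then show ?thesis using k[OF p] n[OF True] yQ[OF p] by (auto simp: cell_def)
  next
    case False
    have "1 \<le> real p ^ n" using prime_ge_1_nat[OF p] by simp
    then show ?thesis using False p by (auto simp: cell_def Zp_def)
  qed
  then show ?thesis by blast
qed

lemma Union_cells: "(\<Union>n. fbox (cell n)) = Afin"
proof
  show "Afin \<subseteq> (\<Union>n. fbox (cell n))"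
  proof
    fix y assume y: "y \<in> Afin"
    then obtain n where "\<forall>p. prime p \<longrightarrow> y p \<in> cell n p" using Afin_cell by blast
    then have "y \<in> fbox (cell n)" using y by (auto simp: fbox_def Afin_def PiE_iff)
    then show "y \<in> (\<Union>n. fbox (cell n))" by blast
  qed
qed (use fbox_subset sides_cell in blast)

section \<open>Factorisation of the adelic measure into the line and the finite adeles\<close>

definition fin_sigma :: "(nat \<Rightarrow> padic) measure" where "fin_sigma = sigma Afin fboxes"

text \<open>Since the unit interval has length 1, a slab over it carries the measure of the finite adeles.\<close>

definition Af :: "(nat \<Rightarrow> padic) measure" where
  "Af = distr (density A (indicator ({0..1} \<times> Afin))) fin_sigma snd"

lemma space_Af [simp]: "space Af = Afin"
  by (simp add: Af_def fin_sigma_def space_measure_of fboxes_Pow)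

lemma sets_Af: "sets Af = sigma_sets Afin fboxes"
  by (simp add: Af_def fin_sigma_def sets_measure_of fboxes_Pow)

lemma fbox_sets [intro]: "sides C \<Longrightarrow> fbox C \<in> sets Af"
  unfolding sets_Af by (auto simp: fboxes_def)

lemma box_sets_A [intro]: "B \<in> sets lborel \<Longrightarrow> sides C \<Longrightarrow> B \<times> fbox C \<in> sets A"
  unfolding sets_A by (rule sigma_sets.Basic) (rule gensI)

text \<open>\<open>Afin\<close> is not a box, since almost all sides of a box are the integers; it
  is reached as a countable union of cells.\<close>

lemma B_Afin_sets: assumes "B \<in> sets lborel" shows "B \<times> Afin \<in> sets A"
proof -
  have "B \<times> Afin = (\<Union>n. B \<times> fbox (cell n))" using Union_cells by auto
  also have "\<dots> \<in> sets A" using assms sides_cell by (intro sets.countable_UN) auto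
  finally show ?thesis .
qed

lemma snd_measurable: "snd \<in> measurable A fin_sigma"
  unfolding fin_sigma_def
proof (rule measurable_measure_of)
  fix E assume "E \<in> fboxes"
  then obtain C where C: "sides C" "E = fbox C" by (auto simp: fboxes_def)
  then have "snd -` E \<inter> space A = UNIV \<times> fbox C" using fbox_subset by (auto simp: space_A)
  then show "snd -` E \<inter> space A \<in> sets A" using C by auto
qed (auto simp: space_A fboxes_Pow)

lemma emeasure_Af_box: assumes "sides C" shows "emeasure Af (fbox C) = vol C"
proof -
  have m: "snd \<in> measurable (density A (indicator ({0..1} \<times> Afin))) fin_sigma"
    using snd_measurable by simp
  have s: "fbox C \<in> sets fin_sigma" using fbox_sets[OF assms] by (simp add: Af_def)
  have U: "snd -` fbox C \<inter> space A \<in> sets A" "{0..1} \<times> Afin \<in> sets A"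
    using measurable_sets[OF snd_measurable s] B_Afin_sets by auto
  have "emeasure Af (fbox C) = emeasure A ({0..1} \<times> Afin \<inter> (snd -` fbox C \<inter> space A))"
    unfolding Af_def using U by (subst emeasure_distr[OF m s], subst emeasure_density)
      (auto simp: indicator_inter_arith[symmetric])
  also have "{0..1} \<times> Afin \<inter> (snd -` fbox C \<inter> space A) = {0..1} \<times> fbox C"
    using fbox_subset[OF assms] by (auto simp: space_A)
  also have "emeasure A ({0..1::real} \<times> fbox C) = vol C" using emeasure_A_box[OF _ assms, of "{0..1}"] by simp
  finally show ?thesis .
qed

lemma sigma_finite_Af: "sigma_finite_measure Af"
proof
  show "\<exists>F. countable F \<and> F \<subseteq> sets Af \<and> \<Union> F = space Af \<and> (\<forall>a\<in>F. emeasure Af a \<noteq> \<infinity>)"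
    using Union_cells sides_cell vol_cell
    by (intro exI[of _ "range (\<lambda>n. fbox (cell n))"]) (auto simp: emeasure_Af_box less_top)
qed

lemma Int_stable_gens: "Int_stable gens"
  proof (rule Int_stableI)
    fix X Y assume "X \<in> gens" "Y \<in> gens"
    then obtain B E B' E' where XY: "X = B \<times> E" "Y = B' \<times> E'" and h: "B \<in> sets lborel" "E \<in> fboxes" "B' \<in> sets lborel" "E' \<in> fboxes"
      by blast
    have "E \<inter> E' \<in> fboxes" using h Int_stable_fboxes by (auto simp: Int_stable_def)
    then show "X \<inter> Y \<in> gens"
      unfolding XY Times_Int_Times using sets.Int[OF h(1,3)] by blast
  qed

lemma gens_Pow: "gens \<subseteq> Pow (UNIV \<times> Afin)"
  using fboxes_Pow by auto

lemma Union_K: "(\<Union>n. {- real n..real n} \<times> fbox (cell n)) = UNIV \<times> Afin"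
  proof
    show "UNIV \<times> Afin \<subseteq> (\<Union>n. {- real n..real n} \<times> fbox (cell n))"
    proof
      fix x :: adele assume x: "x \<in> UNIV \<times> Afin"
      then have "snd x \<in> Afin" by auto
      then obtain n where n: "snd x \<in> fbox (cell n)" using Union_cells by blast
      obtain k where k: "\<bar>fst x\<bar> \<le> real k" using real_arch_simple by blast
      have "snd x \<in> fbox (cell (max n k))"
      proof -
        have "cell n p \<subseteq> cell (max n k) p" if "prime p" for p
          by (rule cell_mono) (use that in auto)
        then show ?thesis using n unfolding fbox_def PiE_iff by blast
      qed
      then show "x \<in> (\<Union>n. {- real n..real n} \<times> fbox (cell n))" using k
        by (intro UN_I[of "max n k"]) (auto simp: mem_Times_iff)
    qed
    show "(\<Union>n. {- real n..real n} \<times> fbox (cell n)) \<subseteq> UNIV \<times> Afin"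
      using fbox_subset[OF sides_cell] by blast
  qed

lemma incseq_K: "incseq (\<lambda>n. {- real n..real n} \<times> fbox (cell n))"
proof (rule incseq_SucI)
  fix n
  have "fbox (cell n) \<subseteq> fbox (cell (Suc n))"
    using cell_mono[of _ n "Suc n"] unfolding fbox_def by (intro PiE_mono) auto
  moreover have "{- real n..real n} \<subseteq> {- real (Suc n)..real (Suc n)}" by auto
  ultimately show "{- real n..real n} \<times> fbox (cell n) \<subseteq> {- real (Suc n)..real (Suc n)} \<times> fbox (cell (Suc n))"
    by blast
qed

text \<open>Uniqueness from the values on boxes, with products of intervals and cells as exhaustion
  by sets of finite measure. It serves to recognise the product measure and the measure rescaled by
  a dilation.\<close>

lemma A_eqI:
  assumes sets: "sets N = sets A"
    and eq: "\<And>B C. B \<in> sets lborel \<Longrightarrow> sides C \<Longrightarrow> emeasure N (B \<times> fbox C) = emeasure lborel B * vol C"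
  shows "N = A"
proof (rule sym, rule measure_eqI_generator_eq[where E = "gens"
      and \<Omega> = "UNIV \<times> Afin" and A = "\<lambda>n. {- real n..real n} \<times> fbox (cell n)"])
  show "Int_stable gens" by (rule Int_stable_gens)
  show "gens \<subseteq> Pow (UNIV \<times> Afin)" by (rule gens_Pow)
  show "range (\<lambda>n. {- real n..real n} \<times> fbox (cell n)) \<subseteq> gens"
    using gensI[OF _ sides_cell] by (simp add: image_subset_iff)
  show "(\<Union>n. {- real n..real n} \<times> fbox (cell n)) = UNIV \<times> Afin" by (rule Union_K)
  show "emeasure A ({- real i..real i} \<times> fbox (cell i)) \<noteq> \<infinity>" for i
    using vol_cell[of i] by (subst emeasure_A_box) (auto simp: sides_cell ennreal_mult_eq_top_iff)
  show "emeasure A X = emeasure N X" if X: "X \<in> gens" for X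
  proof -
    obtain B C where "X = B \<times> fbox C" "B \<in> sets lborel" "sides C" using X unfolding fboxes_def by blast
    then show ?thesis using eq emeasure_A_box by simp
  qed
  show "sets A = sigma_sets (UNIV \<times> Afin) gens" by (rule sets_A)
  then show "sets N = sigma_sets (UNIV \<times> Afin) gens" by (simp only: sets)
qed

text \<open>Opens the adeles to Tonelli and Fubini: both measures have the same values on
  boxes.\<close>

lemma A_eq_pair: "lborel \<Otimes>\<^sub>M Af = A"
proof (rule A_eqI)
  have "sets (lborel \<Otimes>\<^sub>M Af) = sets (sigma (space lborel \<times> space Af) gens)"
  proof (rule sets_pair_eq[where Ca = "{UNIV}" and Cb = "range (\<lambda>n. fbox (cell n))"])
    show "sets (lborel :: real measure) = sigma_sets (space lborel) (sets lborel)"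
      by (rule sets.sigma_sets_eq[symmetric])
    show "sets Af = sigma_sets (space Af) fboxes" by (simp add: sets_Af)
    show "\<Union> (range (\<lambda>n. fbox (cell n))) = space Af" using Union_cells by simp
  qed (use fboxes_Pow sides_cell in \<open>auto simp: fboxes_def\<close>)
  also have "\<dots> = sigma_sets (UNIV \<times> Afin) gens"
    using fboxes_Pow by (subst sets_measure_of) (auto simp del: sets_lborel)
  finally show "sets (lborel \<Otimes>\<^sub>M Af) = sets A" by (simp only: sets_A)
  fix B C assume "B \<in> sets lborel" "sides C"
  then show "emeasure (lborel \<Otimes>\<^sub>M Af) (B \<times> fbox C) = emeasure lborel B * vol C"
    using sigma_finite_measure.emeasure_pair_measure_Times[OF sigma_finite_Af, of B lborel "fbox C"]
    by (simp add: emeasure_Af_box fbox_sets)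
qed

sublocale Af: sigma_finite_measure Af by (rule sigma_finite_Af)
sublocale LA: pair_sigma_finite "lborel :: real measure" Af ..

text \<open>A condition on one component leaves the others free and is not a box, so the preimage is
  written as a union of cells with the side at p replaced.\<close>

lemma component_measurable: assumes p: "prime p" shows "(\<lambda>y. y p) \<in> measurable Af (\<mu> p)"
proof (rule measurableI)
  show "y p \<in> space (\<mu> p)" if "y \<in> space Af" for y using that p by (auto simp: Afin_def space_mu)
  fix B assume B: "B \<in> sets (\<mu> p)"
  have s: "sides ((cell n)(p := B))" for n
    using B by (intro sidesI[of "insert p {..n}"]) (auto simp: cell_sets, auto simp: cell_def)
  have "(\<lambda>y. y p) -` B \<inter> space Af = (\<Union>n. fbox ((cell n)(p := B)))"
  proof
    show "(\<lambda>y. y p) -` B \<inter> space Af \<subseteq> (\<Union>n. fbox ((cell n)(p := B)))"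
    proof
      fix y assume y: "y \<in> (\<lambda>y. y p) -` B \<inter> space Af"
      then have yA: "y \<in> Afin" "y p \<in> B" by auto
      then obtain n where "\<forall>q. prime q \<longrightarrow> y q \<in> cell n q" using Afin_cell by blast
      then have "y \<in> fbox ((cell n)(p := B))" using yA by (intro fboxI) auto
      then show "y \<in> (\<Union>n. fbox ((cell n)(p := B)))" by blast
    qed
    show "(\<Union>n. fbox ((cell n)(p := B))) \<subseteq> (\<lambda>y. y p) -` B \<inter> space Af"
    proof
      fix y assume "y \<in> (\<Union>n. fbox ((cell n)(p := B)))"
      then obtain n where n: "y \<in> fbox ((cell n)(p := B))" by blast
      have "y p \<in> B" using fboxD[OF n p] by simp
      then show "y \<in> (\<lambda>y. y p) -` B \<inter> space Af" using n fbox_subset[OF s, of n] by auto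
    qed
  qed
  also have "\<dots> \<in> sets Af" using s by (intro sets.countable_UN) auto
  finally show "(\<lambda>y. y p) -` B \<inter> space Af \<in> sets Af" .
qed

subsection \<open>Finite products\<close>

text \<open>The library's finite products require a $\sigma$-finite measure at every index, prime or not.\<close>

definition total_mu :: "nat \<Rightarrow> padic measure" where "total_mu p = (if prime p then \<mu> p else count_space {})"

lemma total_mu_prime [simp]: "prime p \<Longrightarrow> total_mu p = \<mu> p"
  by (simp add: total_mu_def)

sublocale product_sigma_finite total_mu
  unfolding product_sigma_finite_def
proof (rule allI)
  show "sigma_finite_measure (total_mu i)" for i
    using padic_haar_place.sigma_finite_haar[OF place, of i]
    by (cases "prime i") (auto simp: total_mu_def intro: sigma_finite_measure_count_space_finite)
qed

text \<open>Contains the support of every tensor whose factors outside \<open>S\<close> are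
  indicators of the integers; on this set such a tensor is a finite product.\<close>

definition integral_off :: "nat set \<Rightarrow> (nat \<Rightarrow> padic) set" where
  "integral_off S = {y \<in> Afin. \<forall>p. prime p \<longrightarrow> p \<notin> S \<longrightarrow> y p \<in> Zp p}"

lemma integral_off_eq_fbox:
  assumes "finite S" shows "integral_off S = fbox (\<lambda>p. if p \<in> S then Qp p else Zp p)" "sides (\<lambda>p. if p \<in> S then Qp p else Zp p)"
proof -
  show s: "sides (\<lambda>p. if p \<in> S then Qp p else Zp p)"
    by (rule sidesI[OF assms]) (auto simp: Zp_sets Qp_sets)
  show "integral_off S = fbox (\<lambda>p. if p \<in> S then Qp p else Zp p)"
  proof
    show "fbox (\<lambda>p. if p \<in> S then Qp p else Zp p) \<subseteq> integral_off S"
    proof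
      fix y assume y: "y \<in> fbox (\<lambda>p. if p \<in> S then Qp p else Zp p)"
      have "y p \<in> Zp p" if "prime p" "p \<notin> S" for p using fboxD[OF y that(1)] that(2) by simp
      moreover have "y \<in> Afin" using fbox_subset[OF s] y by blast
      ultimately show "y \<in> integral_off S" unfolding integral_off_def by blast
    qed
    show "integral_off S \<subseteq> fbox (\<lambda>p. if p \<in> S then Qp p else Zp p)"
      by (auto simp: integral_off_def Afin_def PiE_iff intro!: fboxI)
  qed
qed

lemma integral_off_sets: "finite S \<Longrightarrow> integral_off S \<in> sets Af"
  by (simp add: integral_off_eq_fbox fbox_sets)

text \<open>On \<open>integral_off S\<close> the remaining coordinates range over integers of
  measure 1. Projection to the coordinates in \<open>S\<close> thus pushes the restricted measure to
  the finite product measure, and Tonelli applies there.\<close>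

lemma nn_integral_finite_product:
  assumes S: "finite S" "S \<subseteq> {p. prime p}"
    and v: "\<And>p. p \<in> S \<Longrightarrow> v p \<in> borel_measurable (\<mu> p)"
  shows "(\<integral>\<^sup>+y. indicator (integral_off S) y * (\<Prod>p\<in>S. v p (y p)) \<partial>Af) = (\<Prod>p\<in>S. \<integral>\<^sup>+z. v p z \<partial>\<mu> p)"
proof -
  have m: "(\<lambda>y. restrict y S) \<in> measurable Af (PiM S total_mu)"
    using S component_measurable by (intro measurable_restrict) auto
  have Rs: "integral_off S \<in> sets Af" using S integral_off_sets by auto
  have eq: "distr (density Af (indicator (integral_off S))) (PiM S total_mu) (\<lambda>y. restrict y S) = PiM S total_mu"
  proof (rule PiM_eqI)
    fix C assume C: "\<And>i. i \<in> S \<Longrightarrow> C i \<in> sets (total_mu i)"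
    \<comment> \<open>The preimage of a finite product of sets within \<open>integral_off S\<close>
      is the box with integer sides elsewhere.\<close>
    define D where "D p = (if p \<in> S then C p else Zp p)" for p
    have D: "sides D" using S C by (intro sidesI[of S]) (auto simp: D_def Zp_sets subset_iff)
    have PS: "Pi\<^sub>E S C \<in> sets (PiM S total_mu)" using S C by (intro sets_PiM_I_finite) auto
    have "emeasure (distr (density Af (indicator (integral_off S))) (PiM S total_mu) (\<lambda>y. restrict y S)) (Pi\<^sub>E S C)
      = emeasure Af (integral_off S \<inter> ((\<lambda>y. restrict y S) -` Pi\<^sub>E S C \<inter> space Af))"
      using m PS Rs measurable_sets[OF m PS]
      by (subst emeasure_distr, simp, simp, subst emeasure_density) (auto simp: indicator_inter_arith[symmetric])
    also have "integral_off S \<inter> ((\<lambda>y. restrict y S) -` Pi\<^sub>E S C \<inter> space Af) = fbox D"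
    proof
      show "integral_off S \<inter> ((\<lambda>y. restrict y S) -` Pi\<^sub>E S C \<inter> space Af) \<subseteq> fbox D"
      proof
        fix y assume y: "y \<in> integral_off S \<inter> ((\<lambda>y. restrict y S) -` Pi\<^sub>E S C \<inter> space Af)"
        have "y p \<in> C p" if "p \<in> S" for p using y that by (auto simp: PiE_iff)
        then show "y \<in> fbox D" using y by (intro fboxI) (auto simp: D_def integral_off_def)
      qed
      show "fbox D \<subseteq> integral_off S \<inter> ((\<lambda>y. restrict y S) -` Pi\<^sub>E S C \<inter> space Af)"
      proof
        fix y assume y: "y \<in> fbox D"
        have yA: "y \<in> Afin" using fbox_subset[OF D] y by blast
        have "y p \<in> Zp p" if "prime p" "p \<notin> S" for p using fboxD[OF y that(1)] that(2) by (simp add: D_def)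
        moreover have "y p \<in> C p" if "p \<in> S" for p using fboxD[OF y, of p] that S by (auto simp: D_def)
        ultimately show "y \<in> integral_off S \<inter> ((\<lambda>y. restrict y S) -` Pi\<^sub>E S C \<inter> space Af)"
          using yA by (simp add: integral_off_def)
      qed
    qed
    also have "emeasure Af (fbox D) = (\<Prod>p\<in>S. emeasure (\<mu> p) (D p))"
      using D S by (simp add: emeasure_Af_box vol_eq[of S] D_def)
    also have "\<dots> = (\<Prod>i\<in>S. emeasure (total_mu i) (C i))" using S by (intro prod.cong) (auto simp: D_def)
    finally show "emeasure (distr (density Af (indicator (integral_off S))) (PiM S total_mu) (\<lambda>y. restrict y S)) (Pi\<^sub>E S C)
      = (\<Prod>i\<in>S. emeasure (total_mu i) (C i))" .
  qed (use S in auto)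
  have v': "\<And>p. p \<in> S \<Longrightarrow> v p \<in> borel_measurable (total_mu p)" using v S by (auto simp: subset_iff)
  have meas: "(\<lambda>z. \<Prod>p\<in>S. v p (z p)) \<in> borel_measurable (PiM S total_mu)"
    using v' by (intro borel_measurable_prod_ennreal measurable_compose[OF measurable_component_singleton]) auto
  have "(\<Prod>p\<in>S. \<integral>\<^sup>+z. v p z \<partial>\<mu> p) = (\<Prod>p\<in>S. integral\<^sup>N (total_mu p) (v p))"
    using S by (intro prod.cong) auto
  also have "\<dots> = (\<integral>\<^sup>+z. (\<Prod>p\<in>S. v p (z p)) \<partial>PiM S total_mu)"
    using S v' by (intro product_nn_integral_prod[symmetric]) auto
  also have "\<dots> = (\<integral>\<^sup>+z. (\<Prod>p\<in>S. v p (z p)) \<partial>distr (density Af (indicator (integral_off S))) (PiM S total_mu) (\<lambda>y. restrict y S))"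
    by (simp only: eq)
  also have "\<dots> = (\<integral>\<^sup>+y. (\<Prod>p\<in>S. v p (restrict y S p)) \<partial>density Af (indicator (integral_off S)))"
    using m meas by (intro nn_integral_distr) auto
  also have "\<dots> = (\<integral>\<^sup>+y. indicator (integral_off S) y * (\<Prod>p\<in>S. v p (restrict y S p)) \<partial>Af)"
    using Rs measurable_compose[OF m meas] by (intro nn_integral_density) auto
  also have "\<dots> = (\<integral>\<^sup>+y. indicator (integral_off S) y * (\<Prod>p\<in>S. v p (y p)) \<partial>Af)" by simp
  finally show ?thesis by (rule sym)
qed

end

section \<open>Square-integrable functions on product measures\<close>

lemma nn_integral_l2_sq: "f \<in> L2 M \<Longrightarrow> (\<integral>\<^sup>+x. ennreal ((cmod (f x))\<^sup>2) \<partial>M) = ennreal (l2_sq M f)"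
  unfolding l2_sq_def by (intro nn_integral_eq_integral) (auto simp: L2_D)

lemma L2I_nn_integral:
  assumes "f \<in> borel_measurable M" "(\<integral>\<^sup>+x. ennreal ((cmod (f x))\<^sup>2) \<partial>M) = ennreal r" "0 \<le> r"
  shows "f \<in> L2 M" "l2_sq M f = r"
proof -
  have "integrable M (\<lambda>x. (cmod (f x))\<^sup>2)"
    using assms by (intro integrableI_bounded) auto
  then show "f \<in> L2 M" using assms by (simp add: L2_def)
  then show "l2_sq M f = r" using nn_integral_l2_sq[of f M] assms by simp
qed

lemma L2_prod_integrable:
  assumes "f \<in> L2 M" "g \<in> L2 M" shows "integrable M (\<lambda>x. f x * cnj (g x))"
proof (rule Bochner_Integration.integrable_bound[where f = "\<lambda>x. (cmod (f x))\<^sup>2 + (cmod (g x))\<^sup>2"])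
  show "integrable M (\<lambda>x. (cmod (f x))\<^sup>2 + (cmod (g x))\<^sup>2)" using assms by (auto simp: L2_D)
  have [measurable]: "f \<in> borel_measurable M" "g \<in> borel_measurable M" using assms by (auto simp: L2_D)
  show "(\<lambda>x. f x * cnj (g x)) \<in> borel_measurable M"
    by (intro borel_measurable_times borel_measurable_continuous_on[of cnj]) (auto intro: continuous_intros)
  have "cmod (f x * cnj (g x)) \<le> (cmod (f x))\<^sup>2 + (cmod (g x))\<^sup>2" for x
  proof -
    have "2 * (cmod (f x) * cmod (g x)) \<le> (cmod (f x))\<^sup>2 + (cmod (g x))\<^sup>2"
      using sum_squares_bound[of "cmod (f x)" "cmod (g x)"] by simp
    moreover have "0 \<le> cmod (f x) * cmod (g x)" by simp
    ultimately show ?thesis unfolding norm_mult complex_mod_cnj by linarith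
  qed
  then show "AE x in M. norm (f x * cnj (g x)) \<le> norm ((cmod (f x))\<^sup>2 + (cmod (g x))\<^sup>2)"
    by (intro AE_I2) (simp add: abs_of_nonneg)
qed

text \<open>Pythagoras: a vector in the closed span of a set that is orthogonal to the set is at distance
  at least its own norm from all linear combinations.\<close>

lemma closed_span_orthogonal_zero:
  assumes F: "F \<in> closed_span M T" and T: "T \<subseteq> L2 M"
    and orth: "\<And>t. t \<in> T \<Longrightarrow> (LINT x|M. F x * cnj (t x)) = 0"
  shows "AE x in M. F x = 0"
proof -
  have FL: "F \<in> L2 M" using F closed_span_subset_L2 by blast
  have lt: "l2_sq M F < e" if e: "e > 0" for e
  proof -
    obtain w where w: "w \<in> lin_span T" "w \<in> L2 M" "l2_sq M (\<lambda>x. F x - w x) < e"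
      using F e by (auto simp: closed_span_def l2_closure_iff)
    obtain c S where S: "finite S" "S \<subseteq> T" "w = (\<lambda>x. \<Sum>g\<in>S. c g * g x)"
      using w by (auto simp: lin_span_def)
    have "(LINT x|M. F x * cnj (w x)) = (LINT x|M. (\<Sum>g\<in>S. cnj (c g) * (F x * cnj (g x))))"
      by (simp add: S sum_distrib_left mult_ac)
    also have "\<dots> = (\<Sum>g\<in>S. cnj (c g) * (LINT x|M. F x * cnj (g x)))"
      using S T FL by (subst Bochner_Integration.integral_sum) (auto intro!: L2_prod_integrable)
    also have "\<dots> = 0" using S orth by (simp add: subset_iff)
    finally have z: "(LINT x|M. F x * cnj (w x)) = 0" .
    have i: "integrable M (\<lambda>x. F x * cnj (w x))" by (rule L2_prod_integrable) (use FL w in auto)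
    have "(LINT x|M. Re (F x * cnj (w x))) = 0" using z integral_Re[OF i] by simp
    moreover have "l2_sq M (\<lambda>x. F x - w x) = (LINT x|M. (cmod (F x))\<^sup>2 + (cmod (w x))\<^sup>2 - 2 * Re (F x * cnj (w x)))"
    proof -
      have "(cmod (a - b))\<^sup>2 = (cmod a)\<^sup>2 + (cmod b)\<^sup>2 - 2 * Re (a * cnj b)" for a b
        by (simp only: cmod_power2) (simp add: power2_eq_square algebra_simps)
      then show ?thesis by (simp only: l2_sq_def)
    qed
    ultimately have "l2_sq M (\<lambda>x. F x - w x) = l2_sq M F + l2_sq M w"
    proof -
      have "integrable M (\<lambda>x. Re (F x * cnj (w x)))" using i by (rule integrable_Re)
      then show ?thesis
        using \<open>l2_sq M (\<lambda>x. F x - w x) = _\<close> \<open>(LINT x|M. Re (F x * cnj (w x))) = 0\<close> L2_D(2)[OF FL] L2_D(2)[OF w(2)]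
        by (simp add: l2_sq_def del: times_complex.sel complex_cnj)
    qed
    then show ?thesis using w l2_sq_nonneg[of M w] by linarith
  qed
  \<comment> \<open>A positive squared norm would be smaller than itself.\<close>
  have "l2_sq M F = 0" using lt[of "l2_sq M F"] l2_sq_nonneg[of M F] by linarith
  then show ?thesis using FL l2_sq_eq_0_iff by blast
qed

section \<open>Density of indicators of generating sets\<close>

lemma closed_span_indicator_incseq:
  assumes E: "range E \<subseteq> sets M" "incseq E" "emeasure M (\<Union>i. E i) < \<infinity>"
    and X: "\<And>i::nat. (\<lambda>x. indicator (E i) x) \<in> closed_span M T"
  shows "(\<lambda>x. indicator (\<Union>i. E i) x) \<in> closed_span M T"
proof -
  let ?U = "\<Union>i. E i"
  have U: "?U \<in> sets M" using E by auto
  have "(\<lambda>x. indicator ?U x) \<in> l2_closure M (closed_span M T)" unfolding l2_closure_iff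
  proof (intro conjI allI impI)
    show "(\<lambda>x. indicator ?U x) \<in> L2 M" using U E(3) by (intro L2_indicator)
    fix e :: real assume e: "e > 0"
    have lim: "(\<lambda>i. measure M (E i)) \<longlonglongrightarrow> measure M ?U" using E by (intro Lim_measure_incseq) auto
    then have "eventually (\<lambda>i. measure M ?U - e < measure M (E i)) sequentially"
      using e by (intro order_tendstoD(1)) auto
    then obtain i where i: "measure M ?U - e < measure M (E i)" by (auto simp: eventually_sequentially)
    \<comment> \<open>The squared distance of nested indicators is the measure of the difference
      set, which tends to 0 by continuity from below.\<close>
    have "(cmod (indicator ?U x - indicator (E i) x))\<^sup>2 = indicator (?U - E i) x" for x
      by (auto simp: indicator_def)
    then have "l2_sq M (\<lambda>x. indicator ?U x - indicator (E i) x) = measure M (?U - E i)"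
      using U E by (simp add: l2_sq_def Int_absorb2 sets.sets_into_space)
    also have "\<dots> = measure M ?U - measure M (E i)"
      using E U by (intro measure_Diff) auto
    also have "\<dots> < e" using i by simp
    finally show "\<exists>g\<in>closed_span M T \<inter> L2 M. l2_sq M (\<lambda>x. indicator ?U x - g x) < e"
      using X[of i] closed_span_subset_L2 by blast
  qed
  then show ?thesis by (simp add: l2_closure_closed_span)
qed

text \<open>Dynkin's argument: the sets whose truncated indicators lie in the span are closed under
  complement and countable disjoint union. Truncation by \<open>K n\<close> keeps measures finite
  and is removed at the end by letting n grow.\<close>

lemma L2_eq_closed_span_generator:
  assumes Gn: "Int_stable Gn" "Gn \<subseteq> Pow \<Omega>" "sets M = sigma_sets \<Omega> Gn"
    and K: "range K \<subseteq> sets M" "incseq K" "(\<Union>n::nat. K n) = \<Omega>" "\<And>n. emeasure M (K n) < \<infinity>"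
    and X: "\<And>E n. E \<in> Gn \<Longrightarrow> (\<lambda>x. indicator (E \<inter> K n) x) \<in> closed_span M T"
      "\<And>n. (\<lambda>x. indicator (K n) x) \<in> closed_span M T"
  shows "L2 M = closed_span M T"
proof (rule antisym[OF _ closed_span_subset_L2])
  have Kn: "K n \<in> sets M" for n using K by auto
  have fin: "emeasure M (E \<inter> K n) < \<infinity>" if "E \<in> sets M" for E n
    using emeasure_mono[of "E \<inter> K n" "K n" M] Kn K(4)[of n] by (auto simp: less_top[symmetric] top_unique)
  have sub: "E \<in> sigma_sets \<Omega> Gn \<Longrightarrow> E \<subseteq> \<Omega>" for E using sigma_sets_into_sp[OF Gn(2)] .
  have step: "(\<lambda>x. indicator (E \<inter> K n) x) \<in> closed_span M T" if "E \<in> sigma_sets \<Omega> Gn" for E n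
    using Gn(1,2) that
  proof (induction rule: sigma_sets_induct_disjoint)
    case (basic E) then show ?case by (rule X)
  next
    case empty then show ?case by (simp add: closed_span_zero)
  next
    case (compl E)
    show ?case
    proof (rule closed_span_cong)
      show "(\<lambda>x. indicator (K n) x + (-1) * indicator (E \<inter> K n) x) \<in> closed_span M T"
        using compl X(2) by (intro closed_span_add) auto
    qed (use sub compl K(3) in \<open>auto simp: indicator_def\<close>)
  next
    case (union E)
    let ?F = "\<lambda>m. (\<Union>i<m. E i) \<inter> K n"
    have Es: "E i \<in> sets M" for i using union(2) Gn(3) by auto
    have eq: "(\<Union>m. ?F m) = (\<Union>i. E i) \<inter> K n" by auto
    have "(\<lambda>x. indicator (\<Union>m. ?F m) x) \<in> closed_span M T"
    proof (rule closed_span_indicator_incseq)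
      show "range ?F \<subseteq> sets M" using Es Kn by auto
      show "incseq ?F" by (rule incseq_SucI) (auto simp: lessThan_Suc)
      show "emeasure M (\<Union>m. ?F m) < \<infinity>" unfolding eq using Es by (intro fin) auto
      show "(\<lambda>x. indicator (?F m) x) \<in> closed_span M T" for m
      proof (rule closed_span_cong)
        show "(\<lambda>x. \<Sum>i<m. 1 * indicator (E i \<inter> K n) x) \<in> closed_span M T"
          using union(3) by (intro closed_span_lincomb) auto
        show "(\<Sum>i<m. 1 * indicator (E i \<inter> K n) x) = (indicator (?F m) x :: complex)" for x :: 'a
        proof (cases "x \<in> ?F m")
          case True
          then obtain i where i: "i < m" "x \<in> E i" "x \<in> K n" by auto
          then have "x \<notin> E k" if "k \<noteq> i" for k using union(1) that by (auto simp: disjoint_family_on_def)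
          then have "(\<Sum>k<m. 1 * indicator (E k \<inter> K n) x :: complex) = (\<Sum>k<m. if k = i then 1 else 0)"
            using i by (intro sum.cong) (auto simp: indicator_def)
          also have "\<dots> = 1" using i(1) by simp
          finally show ?thesis using True by simp
        qed (auto intro!: sum.neutral)
      qed
    qed
    then show ?case unfolding eq .
  qed
  have "(\<lambda>x. indicator E x) \<in> closed_span M T" if E: "E \<in> sets M" "emeasure M E < \<infinity>" for E
  proof -
    have "E \<subseteq> \<Omega>" using E sub Gn(3) by auto
    then have eq: "(\<Union>n. E \<inter> K n) = E" using K(3) by blast
    have "(\<lambda>x. indicator (\<Union>n. E \<inter> K n) x) \<in> closed_span M T"
    proof (rule closed_span_indicator_incseq)
      show "range (\<lambda>n. E \<inter> K n) \<subseteq> sets M" using E(1) Kn by auto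
      show "incseq (\<lambda>n. E \<inter> K n)" using K(2) by (auto simp: incseq_def)
      show "emeasure M (\<Union>n. E \<inter> K n) < \<infinity>" unfolding eq by (rule E(2))
      show "(\<lambda>x. indicator (E \<inter> K n) x) \<in> closed_span M T" for n using step[of E n] E(1) Gn(3) by simp
    qed
    then show ?thesis unfolding eq .
  qed
  then show "L2 M \<subseteq> closed_span M T"
    unfolding L2_eq_closed_span_indicators[of M] by (intro closed_span_minimal) auto
qed

context pair_sigma_finite
begin

lemma L2_pair:
  assumes f: "f \<in> L2 M1" and h: "h \<in> L2 M2"
  shows "(\<lambda>x. f (fst x) * h (snd x)) \<in> L2 (M1 \<Otimes>\<^sub>M M2)"
    "l2_sq (M1 \<Otimes>\<^sub>M M2) (\<lambda>x. f (fst x) * h (snd x)) = l2_sq M1 f * l2_sq M2 h"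
proof -
  have [measurable]: "f \<in> borel_measurable M1" "h \<in> borel_measurable M2" using f h by (auto simp: L2_D)
  have m: "(\<lambda>x. f (fst x) * h (snd x)) \<in> borel_measurable (M1 \<Otimes>\<^sub>M M2)" by measurable
  have "(\<integral>\<^sup>+x. ennreal ((cmod (f (fst x) * h (snd x)))\<^sup>2) \<partial>(M1 \<Otimes>\<^sub>M M2))
      = (\<integral>\<^sup>+x. \<integral>\<^sup>+y. ennreal ((cmod (f x))\<^sup>2) * ennreal ((cmod (h y))\<^sup>2) \<partial>M2 \<partial>M1)"
    by (subst M2.nn_integral_fst[symmetric]) (auto simp: norm_mult power_mult_distrib ennreal_mult)
  also have "\<dots> = ennreal (l2_sq M1 f) * ennreal (l2_sq M2 h)"
    using f h by (simp add: nn_integral_cmult nn_integral_multc nn_integral_l2_sq)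
  also have "\<dots> = ennreal (l2_sq M1 f * l2_sq M2 h)" by (simp add: ennreal_mult)
  finally have e: "(\<integral>\<^sup>+x. ennreal ((cmod (f (fst x) * h (snd x)))\<^sup>2) \<partial>(M1 \<Otimes>\<^sub>M M2)) = ennreal (l2_sq M1 f * l2_sq M2 h)" .
  show "(\<lambda>x. f (fst x) * h (snd x)) \<in> L2 (M1 \<Otimes>\<^sub>M M2)"
    "l2_sq (M1 \<Otimes>\<^sub>M M2) (\<lambda>x. f (fst x) * h (snd x)) = l2_sq M1 f * l2_sq M2 h"
    using L2I_nn_integral[OF m e] by auto
qed

text \<open>Partial inner product with the indicator of \<open>K\<close> in the second variable; it
  transfers questions about the product to the first factor.\<close>

definition slice :: "'b set \<Rightarrow> ('a \<times> 'b \<Rightarrow> complex) \<Rightarrow> 'a \<Rightarrow> complex" where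
  "slice K F x = (LINT y|M2. indicator K y * F (x, y))"

text \<open>Cauchy-Schwarz against the indicator of \<open>K\<close>. With nonnegative integrals it
  holds at every x, before any integrability is known.\<close>

lemma slice_sq_le:
  assumes [measurable]: "F \<in> borel_measurable (M1 \<Otimes>\<^sub>M M2)" "K \<in> sets M2" and x: "x \<in> space M1"
  shows "(\<integral>\<^sup>+y. ennreal (cmod (indicator K y * F (x, y))) \<partial>M2)\<^sup>2
    \<le> emeasure M2 K * (\<integral>\<^sup>+y. ennreal ((cmod (F (x, y)))\<^sup>2) \<partial>M2)"
proof -
  have [measurable]: "(\<lambda>y. F (x, y)) \<in> borel_measurable M2"
    using x by (intro measurable_Pair2[OF assms(1)])
  have "(\<integral>\<^sup>+y. ennreal (cmod (indicator K y * F (x, y))) \<partial>M2) = (\<integral>\<^sup>+y. indicator K y * ennreal (cmod (F (x, y))) \<partial>M2)"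
    by (intro nn_integral_cong) (auto simp: indicator_def)
  then have "(\<integral>\<^sup>+y. ennreal (cmod (indicator K y * F (x, y))) \<partial>M2)\<^sup>2
      \<le> (\<integral>\<^sup>+y. (indicator K y)\<^sup>2 \<partial>M2) * (\<integral>\<^sup>+y. (ennreal (cmod (F (x, y))))\<^sup>2 \<partial>M2)"
    by (simp only:) (rule Cauchy_Schwarz_nn_integral; measurable)
  also have "(\<integral>\<^sup>+y. (indicator K y :: ennreal)\<^sup>2 \<partial>M2) = emeasure M2 K"
    by (subst nn_integral_indicator[symmetric], simp) (intro nn_integral_cong, auto simp: indicator_def)
  finally show ?thesis by (simp add: ennreal_power)
qed

text \<open>Integrating the pointwise bound over the first variable gives the operator bound
  \<open>measure M2 K\<close>. The same bound gives integrability wherever the inner integral of the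
  squared modulus is finite, that is, almost everywhere.\<close>

lemma slice_L2:
  assumes F: "F \<in> L2 (M1 \<Otimes>\<^sub>M M2)" and K [measurable]: "K \<in> sets M2" and fin: "emeasure M2 K < \<infinity>"
  shows "slice K F \<in> L2 M1" "l2_sq M1 (slice K F) \<le> measure M2 K * l2_sq (M1 \<Otimes>\<^sub>M M2) F"
    and slice_integrable: "AE x in M1. integrable M2 (\<lambda>y. indicator K y * F (x, y))"
proof -
  have [measurable]: "F \<in> borel_measurable (M1 \<Otimes>\<^sub>M M2)" using F by (simp add: L2_D)
  have Km: "emeasure M2 K = ennreal (measure M2 K)" using fin by (simp add: emeasure_eq_ennreal_measure less_top)
  have m: "slice K F \<in> borel_measurable M1"
    unfolding slice_def by (rule M2.borel_measurable_lebesgue_integral) measurable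
  have le: "ennreal ((cmod (slice K F x))\<^sup>2) \<le> emeasure M2 K * (\<integral>\<^sup>+y. ennreal ((cmod (F (x, y)))\<^sup>2) \<partial>M2)"
    if x: "x \<in> space M1" for x
  proof -
    \<comment> \<open>Where the integrand is not integrable, its Bochner integral is 0 by convention
      and the estimate is trivial.\<close>
    have "ennreal (cmod (slice K F x)) \<le> (\<integral>\<^sup>+y. ennreal (cmod (indicator K y * F (x, y))) \<partial>M2)"
      unfolding slice_def
      by (cases "integrable M2 (\<lambda>y. indicator K y * F (x, y))")
        (auto intro: integral_norm_bound_ennreal simp: not_integrable_integral_eq)
    then have "ennreal (cmod (slice K F x)) ^ 2 \<le> (\<integral>\<^sup>+y. ennreal (cmod (indicator K y * F (x, y))) \<partial>M2)\<^sup>2"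
      by (intro power_mono) auto
    also have "\<dots> \<le> emeasure M2 K * (\<integral>\<^sup>+y. ennreal ((cmod (F (x, y)))\<^sup>2) \<partial>M2)"
      using x by (intro slice_sq_le) auto
    finally show ?thesis by (simp add: ennreal_power)
  qed
  have int: "(\<integral>\<^sup>+x. \<integral>\<^sup>+y. ennreal ((cmod (F (x, y)))\<^sup>2) \<partial>M2 \<partial>M1) = ennreal (l2_sq (M1 \<Otimes>\<^sub>M M2) F)"
    using F by (subst M2.nn_integral_fst) (auto simp: nn_integral_l2_sq)
  have "(\<integral>\<^sup>+x. ennreal ((cmod (slice K F x))\<^sup>2) \<partial>M1)
     \<le> (\<integral>\<^sup>+x. emeasure M2 K * (\<integral>\<^sup>+y. ennreal ((cmod (F (x, y)))\<^sup>2) \<partial>M2) \<partial>M1)"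
    by (intro nn_integral_mono le) auto
  also have "\<dots> = ennreal (measure M2 K * l2_sq (M1 \<Otimes>\<^sub>M M2) F)"
    by (simp add: nn_integral_cmult int Km ennreal_mult)
  finally have le2: "(\<integral>\<^sup>+x. ennreal ((cmod (slice K F x))\<^sup>2) \<partial>M1) \<le> ennreal (measure M2 K * l2_sq (M1 \<Otimes>\<^sub>M M2) F)" .
  then have "integrable M1 (\<lambda>x. (cmod (slice K F x))\<^sup>2)"
    using m by (intro integrableI_bounded) (auto intro: le_less_trans)
  then show L: "slice K F \<in> L2 M1" using m by (simp add: L2_def)
  show "l2_sq M1 (slice K F) \<le> measure M2 K * l2_sq (M1 \<Otimes>\<^sub>M M2) F"
    using le2 unfolding nn_integral_l2_sq[OF L] by (simp add: ennreal_le_iff)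
  have "AE x in M1. (\<integral>\<^sup>+y. ennreal ((cmod (F (x, y)))\<^sup>2) \<partial>M2) \<noteq> \<infinity>"
    by (rule nn_integral_PInf_AE) (auto simp: int)
  then show "AE x in M1. integrable M2 (\<lambda>y. indicator K y * F (x, y))"
  proof (rule AE_mp, intro AE_I2 impI)
    fix x assume x: "x \<in> space M1" and nt: "(\<integral>\<^sup>+y. ennreal ((cmod (F (x, y)))\<^sup>2) \<partial>M2) \<noteq> \<infinity>"
    have [measurable]: "(\<lambda>y. F (x, y)) \<in> borel_measurable M2"
      using x by (intro measurable_Pair2) auto
    have "(\<integral>\<^sup>+y. ennreal (cmod (indicator K y * F (x, y))) \<partial>M2)\<^sup>2 < \<infinity>"
      using slice_sq_le[of F K x] x nt fin
      by (auto intro!: le_less_trans[OF slice_sq_le] simp: ennreal_mult_less_top less_top)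
    then have "(\<integral>\<^sup>+y. ennreal (cmod (indicator K y * F (x, y))) \<partial>M2) < \<infinity>"
      by (cases "(\<integral>\<^sup>+y. ennreal (cmod (indicator K y * F (x, y))) \<partial>M2)") (auto simp: power2_eq_square ennreal_mult_top)
    then show "integrable M2 (\<lambda>y. indicator K y * F (x, y))"
      by (intro integrableI_bounded) auto
  qed
qed

lemma slice_add:
  assumes F: "F \<in> L2 (M1 \<Otimes>\<^sub>M M2)" "H \<in> L2 (M1 \<Otimes>\<^sub>M M2)" and K: "K \<in> sets M2" "emeasure M2 K < \<infinity>"
  shows "AE x in M1. slice K (\<lambda>z. F z + c * H z) x = slice K F x + c * slice K H x"
  using slice_integrable[OF F(1) K] slice_integrable[OF F(2) K]
proof (rule AE_mp[OF _ AE_mp], intro AE_I2 impI)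
  fix x assume "integrable M2 (\<lambda>y. indicator K y * F (x, y))" "integrable M2 (\<lambda>y. indicator K y * H (x, y))"
  then show "slice K (\<lambda>z. F z + c * H z) x = slice K F x + c * slice K H x"
    by (simp add: slice_def distrib_left mult.left_commute[of _ c])
qed

lemma slice_tensor: "slice K (\<lambda>z. f (fst z) * h (snd z)) x = f x * (LINT y|M2. indicator K y * h y)"
  by (simp add: slice_def mult.left_commute[of _ "f x"])

text \<open>By Fubini, pairing \<open>F\<close> with a rectangle integrates a slice of
  \<open>F\<close>; a null slice over \<open>K\<close> makes \<open>F\<close> orthogonal to all
  rectangles over \<open>K\<close>.\<close>

lemma integral_rectangle:
  assumes F: "F \<in> L2 (M1 \<Otimes>\<^sub>M M2)" and B: "B \<in> sets M1" "emeasure M1 B < \<infinity>"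
    and K: "K \<in> sets M2" "emeasure M2 K < \<infinity>"
  shows "(LINT z|(M1 \<Otimes>\<^sub>M M2). F z * indicator (B \<times> K) z) = (LINT x|M1. indicator B x * slice K F x)"
proof -
  have fin: "emeasure (M1 \<Otimes>\<^sub>M M2) (B \<times> K) < \<infinity>"
    using B K by (simp add: M2.emeasure_pair_measure_Times ennreal_mult_less_top)
  have "integrable (M1 \<Otimes>\<^sub>M M2) (\<lambda>z. F z * cnj (indicator (B \<times> K) z))"
    using F fin B K by (intro L2_prod_integrable L2_indicator) auto
  moreover have "cnj (indicator (B \<times> K) z) = indicator (B \<times> K) z" for z :: "'a \<times> 'b" by (simp add: indicator_def)
  ultimately have "integrable (M1 \<Otimes>\<^sub>M M2) (\<lambda>z. F z * indicator (B \<times> K) z)" by simp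
  from integral_fst'[OF this]
  have "(LINT z|(M1 \<Otimes>\<^sub>M M2). F z * indicator (B \<times> K) z) = (LINT x|M1. LINT y|M2. F (x, y) * indicator (B \<times> K) (x, y))"
    by simp
  also have "\<dots> = (LINT x|M1. indicator B x * slice K F x)"
    by (intro Bochner_Integration.integral_cong refl)
      (auto simp: slice_def indicator_times mult_ac simp flip: integral_mult_right_zero)
  finally show ?thesis .
qed

end

text \<open>The product of two square-integrable functions is integrable, so Fubini applies and the
  inner integral is a constant.\<close>

lemma (in pair_sigma_finite) l2_inner_pair:
  assumes f: "f \<in> L2 M1" "f' \<in> L2 M1" and h: "h \<in> L2 M2" "h' \<in> L2 M2"
  shows "l2_inner (M1 \<Otimes>\<^sub>M M2) (\<lambda>z. f (fst z) * h (snd z)) (\<lambda>z. f' (fst z) * h' (snd z))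
    = l2_inner M1 f f' * l2_inner M2 h h'"
proof -
  have "integrable (M1 \<Otimes>\<^sub>M M2) (\<lambda>z. (f (fst z) * h (snd z)) * cnj (f' (fst z) * h' (snd z)))"
    using f h by (intro L2_prod_integrable L2_pair)
  from integral_fst'[OF this]
  have "l2_inner (M1 \<Otimes>\<^sub>M M2) (\<lambda>z. f (fst z) * h (snd z)) (\<lambda>z. f' (fst z) * h' (snd z))
    = (LINT x|M1. LINT y|M2. (f x * cnj (f' x)) * (h y * cnj (h' y)))"
    by (simp add: l2_inner_def mult_ac)
  also have "\<dots> = (LINT x|M1. (f x * cnj (f' x)) * l2_inner M2 h h')"
    unfolding l2_inner_def by simp
  also have "\<dots> = l2_inner M1 f f' * l2_inner M2 h h'"
    unfolding l2_inner_def by simp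
  finally show ?thesis .
qed

subsection \<open>Tensors on the adeles\<close>

context adele_measure
begin

definition fin_tensor :: "(nat \<Rightarrow> padic \<Rightarrow> complex) \<Rightarrow> (nat \<Rightarrow> padic) \<Rightarrow> complex" where
  "fin_tensor g y = (\<Prod>p | prime p \<and> g p (y p) \<noteq> 1. g p (y p))"

text \<open>Standard factors are described by their values on \<open>Qp p\<close> alone, so both
  \<open>\<phi>p\<close> and the indicator of the integers qualify although they may differ
  elsewhere.\<close>

definition standard_off :: "nat set \<Rightarrow> (nat \<Rightarrow> padic \<Rightarrow> complex) \<Rightarrow> bool" where
  "standard_off S g \<longleftrightarrow> finite S \<and> S \<subseteq> {p. prime p} \<and>
     (\<forall>p x. prime p \<longrightarrow> p \<notin> S \<longrightarrow> x \<in> Qp p \<longrightarrow> g p x = indicator (Zp p) x)"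

lemma tensor_eq_fin_tensor: "tensor f g x = f (fst x) * fin_tensor g (snd x)"
  by (simp add: tensor_def fin_tensor_def)

lemma Afin_Qp: "y \<in> Afin \<Longrightarrow> prime p \<Longrightarrow> y p \<in> Qp p"
  by (auto simp: Afin_def)

text \<open>If all components outside \<open>S\<close> are integral, their factors are 1. Otherwise
  one factor is 0, and so are both sides.\<close>

lemma fin_tensor_eq:
  assumes g: "standard_off S g" and y: "y \<in> Afin"
  shows "fin_tensor g y = indicator (integral_off S) y * (\<Prod>p\<in>S. g p (y p))"
proof (cases "y \<in> integral_off S")
  case True
  have out: "g p (y p) = 1" if "prime p" "p \<notin> S" for p
    using g that True Afin_Qp[OF y that(1)] by (auto simp: standard_off_def integral_off_def indicator_def)
  have "fin_tensor g y = (\<Prod>p\<in>S. g p (y p))" unfolding fin_tensor_def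
    using g out by (intro prod.mono_neutral_left) (auto simp: standard_off_def)
  then show ?thesis using True by simp
next
  case False
  then obtain p where p: "prime p" "p \<notin> S" "y p \<notin> Zp p" using y by (auto simp: integral_off_def)
  have z: "g p (y p) = 0" using g p Afin_Qp[OF y p(1)] by (auto simp: standard_off_def indicator_def)
  \<comment> \<open>Finiteness of the index set matters: a product over an infinite set would be 1
    and the zero factor would be lost.\<close>
  have "{q. prime q \<and> g q (y q) \<noteq> 1} \<subseteq> S \<union> {q. prime q \<and> y q \<notin> Zp q}"
    using g Afin_Qp[OF y] by (auto simp: standard_off_def indicator_def)
  moreover have "finite (S \<union> {q. prime q \<and> y q \<notin> Zp q})" using g y by (auto simp: standard_off_def Afin_def)
  ultimately have fin: "finite {q. prime q \<and> g q (y q) \<noteq> 1}" by (rule finite_subset)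
  have "fin_tensor g y = 0" unfolding fin_tensor_def
    using fin p z by (intro prod_zero) auto
  then show ?thesis using False by simp
qed

lemma fin_tensor_L2:
  assumes g: "standard_off S g" and L: "\<And>p. p \<in> S \<Longrightarrow> g p \<in> L2 (\<mu> p)"
  shows "fin_tensor g \<in> L2 Af" "l2_sq Af (fin_tensor g) = (\<Prod>p\<in>S. l2_sq (\<mu> p) (g p))"
proof -
  have S: "finite S" "S \<subseteq> {p. prime p}" using g by (auto simp: standard_off_def)
  have Rs [measurable]: "integral_off S \<in> sets Af" using S integral_off_sets by auto
  have m: "(\<lambda>y. g p (y p)) \<in> borel_measurable Af" if "p \<in> S" for p
    using that S L by (intro measurable_compose[OF component_measurable]) (auto simp: L2_D)
  have "(\<lambda>y. indicator (integral_off S) y * (\<Prod>p\<in>S. g p (y p))) \<in> borel_measurable Af"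
    by (intro borel_measurable_times borel_measurable_prod m) auto
  then have meas: "fin_tensor g \<in> borel_measurable Af"
    using fin_tensor_eq[OF g] by (subst measurable_cong[where g = "\<lambda>y. indicator (integral_off S) y * (\<Prod>p\<in>S. g p (y p))"]) auto
  have "(\<integral>\<^sup>+y. ennreal ((cmod (fin_tensor g y))\<^sup>2) \<partial>Af) = (\<integral>\<^sup>+y. indicator (integral_off S) y * (\<Prod>p\<in>S. ennreal ((cmod (g p (y p)))\<^sup>2)) \<partial>Af)"
  proof (rule nn_integral_cong)
    fix y assume "y \<in> space Af"
    then have "fin_tensor g y = indicator (integral_off S) y * (\<Prod>p\<in>S. g p (y p))" using fin_tensor_eq[OF g] by simp
    then show "ennreal ((cmod (fin_tensor g y))\<^sup>2) = indicator (integral_off S) y * (\<Prod>p\<in>S. ennreal ((cmod (g p (y p)))\<^sup>2))"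
      by (simp add: prod_ennreal indicator_def prod_norm[symmetric] prod_power_distrib)
  qed
  also have "\<dots> = (\<Prod>p\<in>S. \<integral>\<^sup>+z. ennreal ((cmod (g p z))\<^sup>2) \<partial>\<mu> p)"
    using S L by (intro nn_integral_finite_product) (auto dest!: L2_D)
  also have "\<dots> = (\<Prod>p\<in>S. ennreal (l2_sq (\<mu> p) (g p)))"
    using L by (intro prod.cong) (auto simp: nn_integral_l2_sq)
  also have "\<dots> = ennreal (\<Prod>p\<in>S. l2_sq (\<mu> p) (g p))" by (intro prod_ennreal) auto
  finally have e: "(\<integral>\<^sup>+y. ennreal ((cmod (fin_tensor g y))\<^sup>2) \<partial>Af) = ennreal (\<Prod>p\<in>S. l2_sq (\<mu> p) (g p))" .
  show "fin_tensor g \<in> L2 Af" "l2_sq Af (fin_tensor g) = (\<Prod>p\<in>S. l2_sq (\<mu> p) (g p))"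
    using L2I_nn_integral[OF meas e] by (simp_all add: prod_nonneg)
qed

lemma tensor_L2:
  assumes f: "f \<in> L2 lborel" and g: "standard_off S g" and L: "\<And>p. p \<in> S \<Longrightarrow> g p \<in> L2 (\<mu> p)"
  shows "tensor f g \<in> L2 A" "l2_sq A (tensor f g) = l2_sq lborel f * (\<Prod>p\<in>S. l2_sq (\<mu> p) (g p))"
proof -
  have e: "tensor f g = (\<lambda>x. f (fst x) * fin_tensor g (snd x))" by (simp add: tensor_eq_fin_tensor fun_eq_iff)
  show "tensor f g \<in> L2 A"
    unfolding e using LA.L2_pair(1)[OF f fin_tensor_L2(1)[OF g L]] by (simp add: A_eq_pair)
  show "l2_sq A (tensor f g) = l2_sq lborel f * (\<Prod>p\<in>S. l2_sq (\<mu> p) (g p))"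
    unfolding e using LA.L2_pair(2)[OF f fin_tensor_L2(1)[OF g L]] fin_tensor_L2(2)[OF g L] by (simp add: A_eq_pair)
qed

lemma tensor_cong:
  assumes "\<And>p x. prime p \<Longrightarrow> x \<in> Qp p \<Longrightarrow> g p x = g' p x" "x \<in> space A"
  shows "tensor f g x = tensor f g' x"
proof -
  have "snd x \<in> Afin" using assms(2) by (auto simp: space_A)
  then have e: "g p (snd x p) = g' p (snd x p)" if "prime p" for p
    using assms(1)[OF that] Afin_Qp that by auto
  have "{p. prime p \<and> g p (snd x p) \<noteq> 1} = {p. prime p \<and> g' p (snd x p) \<noteq> 1}" using e by auto
  then show ?thesis unfolding tensor_def using e by (auto intro!: prod.cong)
qed

lemma tensor_add_real: "tensor (\<lambda>r. f r + c * f' r) g x = tensor f g x + c * tensor f' g x"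
  by (simp add: tensor_def algebra_simps)

lemma standard_off_upd: "standard_off S g \<Longrightarrow> q \<in> S \<Longrightarrow> standard_off S (g(q := h))"
  by (auto simp: standard_off_def)

text \<open>Isolates the factor at q: the remaining expression is independent of \<open>h\<close>,
  which makes a tensor linear in each single factor.\<close>

lemma tensor_upd:
  assumes g: "standard_off S g" and q: "q \<in> S" and x: "x \<in> space A"
  shows "tensor f (g(q := h)) x
    = h (snd x q) * (f (fst x) * indicator (integral_off S) (snd x) * (\<Prod>p\<in>S - {q}. g p (snd x p)))"
proof -
  have S: "finite S" using g by (simp add: standard_off_def)
  have y: "snd x \<in> Afin" using x by (auto simp: space_A)
  have "(\<Prod>p\<in>S. (g(q := h)) p (snd x p)) = h (snd x q) * (\<Prod>p\<in>S - {q}. g p (snd x p))"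
    using S q by (subst prod.remove[of S q]) (auto intro!: prod.cong)
  then show ?thesis using fin_tensor_eq[OF standard_off_upd[OF g q] y, of h] by (simp add: tensor_eq_fin_tensor mult_ac)
qed

lemma tensor_add_place:
  assumes "standard_off S g" "q \<in> S" "x \<in> space A"
  shows "tensor f (g(q := \<lambda>z. h z + c * h' z)) x = tensor f (g(q := h)) x + c * tensor f (g(q := h')) x"
  using assms by (simp add: tensor_upd algebra_simps)

text \<open>The factors are moved into their closed spans one place at a time.\<close>

lemma tensor_closed_span:
  assumes g0: "standard_off S g0"
    and Sr: "Sr \<subseteq> L2 lborel" and Sp: "\<And>p. p \<in> S \<Longrightarrow> Sp p \<subseteq> L2 (\<mu> p)"
    and T: "\<And>f g. f \<in> Sr \<Longrightarrow> (\<And>p. p \<in> S \<Longrightarrow> g p \<in> Sp p) \<Longrightarrow> (\<And>p. p \<notin> S \<Longrightarrow> g p = g0 p) \<Longrightarrow>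
             tensor f g \<in> closed_span A T"
    and f: "f \<in> closed_span lborel Sr" and gS: "\<And>p. p \<in> S \<Longrightarrow> g0 p \<in> closed_span (\<mu> p) (Sp p)"
  shows "tensor f g0 \<in> closed_span A T"
proof -
  have S: "finite S" using g0 by (simp add: standard_off_def)
  \<comment> \<open>\<open>D\<close> is the set of places whose factor is known only to lie in the
    closed span; at the other places of \<open>S\<close> the factor is still a generator.\<close>
  have step: "tensor f' g \<in> closed_span A T"
    if "D \<subseteq> S" "f' \<in> Sr" "\<And>p. p \<in> D \<Longrightarrow> g p \<in> closed_span (\<mu> p) (Sp p)"
      "\<And>p. p \<in> S - D \<Longrightarrow> g p \<in> Sp p" "\<And>p. p \<notin> S \<Longrightarrow> g p = g0 p" for D f' g
    using finite_subset[OF that(1) S] that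
  proof (induction D arbitrary: g rule: finite_induct)
    case empty
    then show ?case by (intro T) auto
  next
    case (insert q D)
    have standard_off: "standard_off S g" using g0 insert.prems(5) by (simp add: standard_off_def)
    have qS: "q \<in> S" using insert.prems(1) by auto
    have gL: "g p \<in> L2 (\<mu> p)" if "p \<in> S" for p
      using insert.prems(3,4)[of p] Sp[OF that] closed_span_subset_L2[of "\<mu> p" "Sp p"] that by blast
    have f'L: "f' \<in> L2 lborel" using insert.prems(2) Sr by auto
    have L: "(g(q := h)) p \<in> L2 (\<mu> p)" if "h \<in> L2 (\<mu> q)" "p \<in> S" for h p
      using gL[OF that(2)] that by (cases "p = q") auto
    \<comment> \<open>The trivial update exposes the factor at q as the argument of a linear
      operator, bounded by the norms of the other factors.\<close>
    have "tensor f' (g(q := g q)) \<in> closed_span A T"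
    proof (rule closed_span_map[where T = "\<lambda>h. tensor f' (g(q := h))" and M = "\<mu> q" and N = A and S = "Sp q"
          and B = "l2_sq lborel f' * (\<Prod>p\<in>S - {q}. l2_sq (\<mu> p) (g p))"])
      show "tensor f' (g(q := h)) \<in> L2 A" if "h \<in> L2 (\<mu> q)" for h
        using L[OF that] by (intro tensor_L2(1)[OF f'L standard_off_upd[OF standard_off qS]])
      show "AE y in A. tensor f' (g(q := \<lambda>x. h x + c * h' x)) y
         = tensor f' (g(q := h)) y + c * tensor f' (g(q := h')) y" for h h' c
        by (intro AE_I2) (rule tensor_add_place[OF standard_off qS])
      show "l2_sq A (tensor f' (g(q := h))) \<le> (l2_sq lborel f' * (\<Prod>p\<in>S - {q}. l2_sq (\<mu> p) (g p))) * l2_sq (\<mu> q) h"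
        if "h \<in> L2 (\<mu> q)" for h
      proof -
        have "(\<Prod>p\<in>S. l2_sq (\<mu> p) ((g(q := h)) p)) = l2_sq (\<mu> q) h * (\<Prod>p\<in>S - {q}. l2_sq (\<mu> p) (g p))"
          using S qS by (subst prod.remove[of S q]) (auto intro!: prod.cong)
        moreover have "l2_sq A (tensor f' (g(q := h))) = l2_sq lborel f' * (\<Prod>p\<in>S. l2_sq (\<mu> p) ((g(q := h)) p))"
          by (rule tensor_L2(2)[OF f'L standard_off_upd[OF standard_off qS, of h] L[OF that]])
        ultimately show ?thesis by (simp only: mult_ac order_refl)
      qed
      show "tensor f' (g(q := h)) \<in> closed_span A T" if hq: "h \<in> Sp q" for h
      proof (rule insert.IH)
        show "(g(q := h)) p \<in> closed_span (\<mu> p) (Sp p)" if "p \<in> D" for p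
          using that insert.hyps(2) insert.prems(3)[of p] by auto
        show "(g(q := h)) p \<in> Sp p" if "p \<in> S - D" for p
          using that hq insert.prems(4)[of p] by (cases "p = q") auto
        show "(g(q := h)) p = g0 p" if "p \<notin> S" for p
          using that qS insert.prems(5)[of p] by auto
      qed (use insert.prems in auto)
      show "Sp q \<subseteq> L2 (\<mu> q)" using Sp qS by auto
      show "g q \<in> closed_span (\<mu> q) (Sp q)" using insert.prems(3) by auto
    qed
    then show ?case by simp
  qed
  have gL: "g0 p \<in> L2 (\<mu> p)" if "p \<in> S" for p
    using gS[OF that] closed_span_subset_L2 by blast
  show ?thesis
  proof (rule closed_span_map[where T = "\<lambda>h. tensor h g0" and M = lborel and N = A and S = Sr
        and B = "\<Prod>p\<in>S. l2_sq (\<mu> p) (g0 p)"])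
    show "tensor h g0 \<in> L2 A" if "h \<in> L2 lborel" for h
      using that gL by (intro tensor_L2(1)[OF _ g0])
    show "AE y in A. tensor (\<lambda>x. h x + c * h' x) g0 y = tensor h g0 y + c * tensor h' g0 y" for h h' c
      by (intro AE_I2) (rule tensor_add_real)
    show "l2_sq A (tensor h g0) \<le> (\<Prod>p\<in>S. l2_sq (\<mu> p) (g0 p)) * l2_sq lborel h" if "h \<in> L2 lborel" for h
      using tensor_L2(2)[OF that g0 gL] by (simp only: mult_ac order_refl)
    show "tensor h g0 \<in> closed_span A T" if "h \<in> Sr" for h
      using that gS by (intro step[of S]) auto
  qed (use Sr f in auto)
qed

lemma indicator_box_eq_tensor:
  assumes C: "sides C" and x: "x \<in> space A"
  shows "indicator (B \<times> fbox C) x = tensor (indicator B) (\<lambda>p. indicator (C p)) x"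
    and "standard_off {p. prime p \<and> C p \<noteq> Zp p} (\<lambda>p. indicator (C p))"
proof -
  let ?S = "{p. prime p \<and> C p \<noteq> Zp p}"
  show s: "standard_off ?S (\<lambda>p. indicator (C p))" using C by (auto simp: standard_off_def sides_def)
  have y: "snd x \<in> Afin" using x by (auto simp: space_A)
  have S: "finite ?S" using C by (simp add: sides_def)
  have "indicator (integral_off ?S) (snd x) * (\<Prod>p\<in>?S. indicator (C p) (snd x p)) = (indicator (fbox C) (snd x) :: complex)"
  proof (cases "snd x \<in> fbox C")
    case True
    have "snd x p \<in> C p" if "prime p" for p using fboxD[OF True that] .
    then show ?thesis using True y by (auto simp: integral_off_def indicator_def)
  next
    case False
    then obtain p where p: "prime p" "snd x p \<notin> C p" using fboxI[OF y] by blast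
    show ?thesis
    proof (cases "p \<in> ?S")
      case True
      then have "(\<Prod>p\<in>?S. indicator (C p) (snd x p)) = (0 :: complex)"
        using S p by (intro prod_zero) auto
      then show ?thesis using False by simp
    next
      case False
      then have "snd x \<notin> integral_off ?S" using p by (auto simp: integral_off_def)
      then show ?thesis using \<open>snd x \<notin> fbox C\<close> by simp
    qed
  qed
  then show "indicator (B \<times> fbox C) x = tensor (indicator B) (\<lambda>p. indicator (C p)) x"
    using fin_tensor_eq[OF s y] by (simp add: tensor_eq_fin_tensor indicator_times)
qed

text \<open>Finiteness is asked of every side and not of the volume alone, which can be 0 with an
  infinite side; each factor of the tensor is then square-integrable.\<close>

definition finite_boxes :: "(adele \<Rightarrow> complex) set" where
  "finite_boxes = {\<lambda>x. indicator (B \<times> fbox C) x |B C. B \<in> sets lborel \<and> emeasure lborel B < \<infinity> \<and>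
     sides C \<and> (\<forall>p. prime p \<longrightarrow> emeasure (\<mu> p) (C p) < \<infinity>)}"

lemma finite_boxesI:
  "B \<in> sets lborel \<Longrightarrow> emeasure lborel B < \<infinity> \<Longrightarrow> sides C \<Longrightarrow> (\<And>p. prime p \<Longrightarrow> emeasure (\<mu> p) (C p) < \<infinity>) \<Longrightarrow>
    (\<lambda>x. indicator (B \<times> fbox C) x) \<in> finite_boxes"
  unfolding finite_boxes_def by blast

lemma vol_finite: "sides C \<Longrightarrow> (\<And>p. prime p \<Longrightarrow> emeasure (\<mu> p) (C p) < \<infinity>) \<Longrightarrow> vol C < \<infinity>"
  unfolding vol_def by (auto simp: less_top[symmetric] ennreal_prod_eq_top)

lemma finite_boxes_L2: "finite_boxes \<subseteq> L2 A"
proof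
  fix t assume "t \<in> finite_boxes"
  then obtain B C where t: "t = (\<lambda>x. indicator (B \<times> fbox C) x)" "B \<in> sets lborel" "emeasure lborel B < \<infinity>"
     "sides C" "\<And>p. prime p \<Longrightarrow> emeasure (\<mu> p) (C p) < \<infinity>" unfolding finite_boxes_def by blast
  have "emeasure A (B \<times> fbox C) < \<infinity>"
    using t vol_finite[OF t(4,5)] by (simp add: emeasure_A_box ennreal_mult_less_top)
  then show "t \<in> L2 A" unfolding t(1) using t by (intro L2_indicator box_sets_A)
qed

lemma L2_A_eq: "L2 A = closed_span A finite_boxes"
proof (rule L2_eq_closed_span_generator[where Gn = gens and \<Omega> = "UNIV \<times> Afin"
      and K = "\<lambda>n. {- real n..real n} \<times> fbox (cell n)"])
  have K: "(\<lambda>x. indicator ({- real n..real n} \<times> fbox (cell n)) x) \<in> finite_boxes" for n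
    by (rule finite_boxesI) (use sides_cell cell_finite in auto)
  show "(\<lambda>x. indicator ({- real n..real n} \<times> fbox (cell n)) x) \<in> closed_span A finite_boxes" for n
    using K finite_boxes_L2 by (intro closed_span_base) auto
  show "(\<lambda>x. indicator (E \<inter> {- real n..real n} \<times> fbox (cell n)) x) \<in> closed_span A finite_boxes" if E: "E \<in> gens" for E n
  proof -
    obtain B C where BC: "E = B \<times> fbox C" "B \<in> sets lborel" "sides C" using E unfolding fboxes_def by blast
    have eq: "E \<inter> {- real n..real n} \<times> fbox (cell n) = (B \<inter> {- real n..real n}) \<times> fbox (\<lambda>p. C p \<inter> cell n p)"
      using BC fbox_Int[of C "cell n"] by auto
    have fin: "emeasure (\<mu> p) (C p \<inter> cell n p) < \<infinity>" if "prime p" for p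
      using emeasure_mono[of "C p \<inter> cell n p" "cell n p" "\<mu> p"] cell_sets[OF that] cell_finite[OF that, of n]
      by (auto intro: le_less_trans)
    have finB: "emeasure lborel (B \<inter> {- real n..real n}) < \<infinity>"
      using emeasure_mono[of "B \<inter> {- real n..real n}" "{- real n..real n}" lborel] by (auto intro: le_less_trans)
    have "(\<lambda>x. indicator (E \<inter> {- real n..real n} \<times> fbox (cell n)) x) \<in> finite_boxes"
      unfolding eq
    proof (rule finite_boxesI)
      show "B \<inter> {- real n..real n} \<in> sets lborel" using BC(2) by auto
    qed (use fin finB sides_Int[OF BC(3) sides_cell] in auto)
    then show ?thesis using finite_boxes_L2 by (intro closed_span_base) auto
  qed
  show "emeasure A ({- real n..real n} \<times> fbox (cell n)) < \<infinity>" for n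
    using vol_cell[of n] by (subst emeasure_A_box) (auto simp: sides_cell ennreal_mult_less_top)
  show "range (\<lambda>n. {- real n..real n} \<times> fbox (cell n)) \<subseteq> sets A" using sides_cell by auto
qed (rule Int_stable_gens gens_Pow sets_A incseq_K Union_K)+

end

section \<open>Multiresolution analyses on the adeles\<close>

lemma emeasure_lborel_scale:
  fixes c :: real
  assumes c: "c > 0" and B: "B \<in> sets lborel"
  shows "emeasure lborel ((\<lambda>x. c * x) -` B) = ennreal (1 / c) * emeasure lborel B"
proof -
  have "emeasure lborel B = emeasure (density (distr lborel borel (\<lambda>x. 0 + c * x)) (\<lambda>_. ennreal \<bar>c\<bar>)) B"
    using lborel_real_affine[of c 0] c by simp
  also have "\<dots> = ennreal c * emeasure lborel ((\<lambda>x. c * x) -` B)"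
    using B c by (simp add: emeasure_density_const emeasure_distr)
  finally have "emeasure lborel B = ennreal c * emeasure lborel ((\<lambda>x. c * x) -` B)" .
  then have "ennreal (1 / c) * emeasure lborel B = ennreal (1 / c * c) * emeasure lborel ((\<lambda>x. c * x) -` B)"
    using c by (simp only: ennreal_mult mult.assoc) (simp add: ennreal_mult[symmetric] mult.assoc[symmetric])
  then show ?thesis using c by simp
qed

lemma real_scaled_mra:
  assumes "real_mra V \<phi>"
  shows "scaled_mra lborel V (\<lambda>j x. 2 powi j * x) (\<lambda>j. 2 powi (- j)) (range (\<lambda>(n::int) x. \<phi> (x - of_int n)))"
proof -
  have sub: "V j \<subseteq> L2 lborel" for j using assms by (auto simp: real_mra_def closed_subspace_def)
  have dil: "(\<lambda>x. f (2 powi k * x)) \<in> L2 lborel" "l2_sq lborel (\<lambda>x. f (2 powi k * x)) = 2 powi (- k) * l2_sq lborel f"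
    if f: "f \<in> L2 lborel" for f :: "real \<Rightarrow> complex" and k
  proof -
    have D: "(\<lambda>x::real. 2 powi k * x) \<in> measurable lborel lborel" by simp
    have e: "emeasure lborel ((\<lambda>x. 2 powi k * x) -` B \<inter> space lborel) = ennreal (2 powi (- k)) * emeasure lborel B"
      if B: "B \<in> sets lborel" for B :: "real set"
      using emeasure_lborel_scale[OF _ B, of "2 powi k"] by (simp add: power_int_minus_divide)
    show "(\<lambda>x. f (2 powi k * x)) \<in> L2 lborel" by (rule scaled_comp(1)[OF D _ e f]) auto
    show "l2_sq lborel (\<lambda>x. f (2 powi k * x)) = 2 powi (- k) * l2_sq lborel f" by (rule scaled_comp(2)[OF D _ e f]) auto
  qed
  show ?thesis
  proof
    show "range (\<lambda>(n::int) x. \<phi> (x - of_int n)) \<subseteq> L2 lborel"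
      using assms sub[of 0] by (auto simp: real_mra_def orthonormal_basis_def)
    show "V 0 = closed_span lborel (range (\<lambda>(n::int) x. \<phi> (x - of_int n)))"
      using assms by (simp add: real_mra_def orthonormal_basis_def)
    show "closed_subspace lborel (V j)" for j using assms by (simp add: real_mra_def)
    show "f \<in> V j \<longleftrightarrow> (\<lambda>x. f (2 powi 1 * x)) \<in> V (j + 1)" if "f \<in> L2 lborel" for j f
      using assms that by (simp add: real_mra_def)
    show "(2::real) powi i * (2 powi k * x) = 2 powi (i + k) * x" for i k x by (simp add: power_int_add)
  qed (use dil in auto)
qed

context padic_haar_place
begin

text \<open>The sign is reversed against the real case: going up one level substitutes x/p, so level
  j corresponds to multiplication by p^(-j).\<close>

lemma padic_scaled_mra:
  assumes "padic_mra p \<mu> V \<phi>"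
  shows "scaled_mra \<mu> V (\<lambda>j. pscl (- j)) (\<lambda>j. real p powi (- j)) ((\<lambda>a x. \<phi> (dif x a)) ` Ip p)"
proof
  have sub: "V j \<subseteq> L2 \<mu>" for j using assms by (auto simp: padic_mra_def closed_subspace_def)
  show "(\<lambda>a x. \<phi> (dif x a)) ` Ip p \<subseteq> L2 \<mu>"
    using assms sub[of 0] by (auto simp: padic_mra_def orthonormal_basis_def)
  show "V 0 = closed_span \<mu> ((\<lambda>a x. \<phi> (dif x a)) ` Ip p)"
    using assms by (simp add: padic_mra_def orthonormal_basis_def)
  show "closed_subspace \<mu> (V j)" for j using assms by (simp add: padic_mra_def)
  show "f \<in> V j \<longleftrightarrow> (\<lambda>x. f (pscl (- 1) x)) \<in> V (j + 1)" if "f \<in> L2 \<mu>" for j f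
    using assms that by (simp add: padic_mra_def power_int_minus inverse_eq_divide)
  show "pscl (- i) (pscl (- k) x) = pscl (- (i + k)) x" if "x \<in> space \<mu>" for i k x
    using that pscl_pscl[of x "- i" "- k"] by simp
  show "l2_sq \<mu> (\<lambda>x. f (pscl (- k) x)) \<le> real p powi (- k) * l2_sq \<mu> f" if "f \<in> L2 \<mu>" for f k
    using pscl_L2(2)[OF that, of "- k"] by simp
qed (use pscl_L2(1) in auto)

section \<open>Finite digit expansions as rational numbers\<close>

definition Ir :: "rat set" where
  "Ir = {(\<Sum>i=1..\<gamma>. of_nat (a i) / of_nat p ^ i) |a \<gamma>. \<forall>i. a i < p}"

lemma Ip_eq: "Ip p = rat ` Ir"
  by (auto simp: Ip_def Ir_def)

lemma Ip_Qp: "a \<in> Ip p \<Longrightarrow> a \<in> Qp p"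
  by (auto simp: Ip_eq)

lemma zero_Ir: "0 \<in> Ir"
  unfolding Ir_def using p_gt_0 by (intro CollectI exI[of _ "\<lambda>_. 0"] exI[of _ 0]) auto

text \<open>Division by p shifts every digit one place, and c becomes the new first digit.\<close>

lemma Ir_step: assumes "r \<in> Ir" "c < p" shows "(r + of_nat c) / of_nat p \<in> Ir"
proof -
  obtain a n where a: "r = (\<Sum>i=1..n. of_nat (a i) / of_nat p ^ i)" "\<forall>i. a i < p"
    using assms(1) by (auto simp: Ir_def)
  \<comment> \<open>Index 0 does not enter the sums, but the digit bound is demanded at every index;
    c is a harmless value there.\<close>
  define b where "b i = (if i \<le> 1 then c else a (i - 1))" for i
  have "(\<Sum>i=1..Suc n. of_nat (b i) / of_nat p ^ i :: rat)
      = of_nat (b 1) / of_nat p + (\<Sum>i=1..n. of_nat (b (Suc i)) / of_nat p ^ Suc i)"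
    by (subst sum.atLeast_Suc_atMost, simp, subst sum.shift_bounds_cl_Suc_ivl[symmetric]) (simp add: numeral_2_eq_2)
  also have "(\<Sum>i=1..n. of_nat (b (Suc i)) / of_nat p ^ Suc i) = r / of_nat p"
    unfolding a(1) sum_divide_distrib by (intro sum.cong) (auto simp: b_def)
  finally have "(r + of_nat c) / of_nat p = (\<Sum>i=1..Suc n. of_nat (b i) / of_nat p ^ i)"
    by (simp add: b_def add_divide_distrib)
  moreover have "\<forall>i. b i < p" using a assms(2) by (auto simp: b_def)
  ultimately show ?thesis unfolding Ir_def by blast
qed

end

locale haar_padic_mra = padic_haar_place +
  fixes V :: "int \<Rightarrow> (padic \<Rightarrow> complex) set" and \<phi> :: "padic \<Rightarrow> complex"
  assumes mra: "padic_mra p \<mu> V \<phi>"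
    and phi: "x \<in> Qp p \<Longrightarrow> \<phi> x = (if padic_norm p x \<le> 1 then 1 else 0)"
begin

sublocale scaled: scaled_mra \<mu> V "\<lambda>j. pscl (- j)" "\<lambda>j. real p powi (- j)" "(\<lambda>a x. \<phi> (dif x a)) ` Ip p"
  by (rule padic_scaled_mra) (rule mra)

text \<open>The factor p^(j/2) is omitted because only spans are compared; without it the values are
  0 and 1 and balls can be added and subtracted.\<close>

definition padic_basis :: "int \<Rightarrow> padic \<Rightarrow> padic \<Rightarrow> complex" where
  "padic_basis j a x = \<phi> (dif (pscl (- j) x) a)"

lemma V_eq: "V j = closed_span \<mu> (padic_basis j ` Ip p)"
  using scaled.scaled_span[of j] by (simp add: padic_basis_def[abs_def] image_image)

lemma V_subset_L2: "V j \<subseteq> L2 \<mu>"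
  using scaled.V[of j] by (simp add: closed_subspace_def)

lemma padic_basis_V: "a \<in> Ip p \<Longrightarrow> padic_basis j a \<in> V j"
  using scaled.scaled_map[of "\<lambda>x. \<phi> (dif x a)" 0 j] mra
  by (auto simp: padic_basis_def[abs_def] padic_mra_def orthonormal_basis_def)

lemma padic_basis_L2: "a \<in> Ip p \<Longrightarrow> padic_basis j a \<in> L2 \<mu>"
  using padic_basis_V V_subset_L2 by blast

lemma padic_basis_val: "x \<in> Qp p \<Longrightarrow> a \<in> Qp p \<Longrightarrow> padic_basis j a x = (if nrm (dif (pscl (- j) x) a) \<le> 1 then 1 else 0)"
  by (simp add: padic_basis_def phi)

lemma V_mono: "i \<le> j \<Longrightarrow> V i \<subseteq> V j"
proof (induction j rule: int_ge_induct)
  case (step j)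
  then show ?case using mra unfolding padic_mra_def by blast
qed simp

lemma phi_V0: "\<phi> \<in> V 0"
  using mra by (simp add: padic_mra_def)

text \<open>If a and b were within distance 1, the two translates of \<open>\<phi>\<close> would
  both be the indicator of one ball of measure 1, with inner product 1; orthonormality demands
  0.\<close>

lemma Ip_far:
  assumes a: "a \<in> Ip p" and b: "b \<in> Ip p" and "a \<noteq> b" shows "nrm (dif a b) > 1"
proof (rule ccontr)
  assume "\<not> nrm (dif a b) > 1"
  then have ab: "nrm (dif a b) \<le> 1" "nrm (dif b a) \<le> 1" using nrm_commute a b Ip_Qp by auto
  have Q: "a \<in> Qp p" "b \<in> Qp p" using a b Ip_Qp by auto
  obtain r where r: "a = rat r" using a by (auto simp: Ip_eq)
  have e: "\<phi> (dif x a) * cnj (\<phi> (dif x b)) = complex_of_real (indicator (ball 0 r) x)" if "x \<in> Qp p" for x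
  proof -
    have "nrm (dif x a) \<le> 1 \<longleftrightarrow> nrm (dif x b) \<le> 1"
      using nrm_triangle[OF that Q] nrm_triangle[OF that Q(2,1)] ab by auto
    then show ?thesis using that Q r by (auto simp: phi ball_def)
  qed
  have "l2_inner \<mu> (\<lambda>x. \<phi> (dif x a)) (\<lambda>x. \<phi> (dif x b)) = 0"
    using mra a b \<open>a \<noteq> b\<close> by (auto simp: padic_mra_def orthonormal_basis_def)
  moreover have "l2_inner \<mu> (\<lambda>x. \<phi> (dif x a)) (\<lambda>x. \<phi> (dif x b)) = (LINT x|\<mu>. complex_of_real (indicator (ball 0 r) x))"
    unfolding l2_inner_def by (intro Bochner_Integration.integral_cong) (auto simp: e)
  ultimately show False
    using ball_subset[of 0 r] by (simp add: measure_def emeasure_ball Int_absorb2)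
qed

text \<open>With y = p^(-j) x - r, the index (r + c)/p at level j + 1 tests whether (y - c)/p is
  integral, that is, whether c is the digit of y. An integral y has exactly one digit, any other y
  has none.\<close>

lemma padic_basis_split:
  assumes "x \<in> Qp p"
  shows "padic_basis j (rat r) x = (\<Sum>c<p. padic_basis (j + 1) (rat ((r + of_nat c) / of_nat p)) x)"
proof -
  have pz: "(of_nat p :: rat) \<noteq> 0" using p_gt_0 by simp
  define y where "y = dif (pscl (- j) x) (rat r)"
  have y: "y \<in> Qp p" using assms by (simp add: y_def)
  have *: "padic_basis (j + 1) (rat ((r + of_nat c) / of_nat p)) x = (if nrm (dif y (rat (of_nat c))) < 1 then 1 else 0)" for c
  proof -
    have "pscl (- (j + 1)) x = scl (1 / of_nat p) (pscl (- j) x)"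
    proof -
      have "(of_nat p powi (-1) :: rat) = 1 / of_nat p" by (simp add: power_int_minus inverse_eq_divide)
      moreover have "(-1) + (- j) = - (j + 1)" by simp
      ultimately show ?thesis using pscl_pscl[OF assms, of "-1" "- j"] by (simp only:)
    qed
    then have "dif (pscl (- (j + 1)) x) (rat ((r + of_nat c) / of_nat p)) = scl (1 / of_nat p) (dif y (rat (of_nat c)))"
      using assms pz by (simp add: y_def dif_rat_rat scl_dif scl_rat)
    then show ?thesis using assms nrm_scl_inverse_le_1_iff[of "dif y (rat (of_nat c))"] y by (simp add: padic_basis_val)
  qed
  have lhs: "padic_basis j (rat r) x = (if nrm y \<le> 1 then 1 else 0)" using assms by (simp add: padic_basis_val y_def)
  show ?thesis
  proof (cases "nrm y \<le> 1")
    case True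
    obtain d where d: "d < p \<and> nrm (dif y (rat (of_nat d))) < 1"
      "\<forall>c. c < p \<and> nrm (dif y (rat (of_nat c))) < 1 \<longrightarrow> c = d"
      using ex1_digit[OF y True] by (elim ex1E)
    have "(\<Sum>c<p. padic_basis (j + 1) (rat ((r + of_nat c) / of_nat p)) x) = (\<Sum>c<p. if c = d then 1 else 0)"
    proof (rule sum.cong)
      fix c assume "c \<in> {..<p}"
      then have "nrm (dif y (rat (of_nat c))) < 1 \<longleftrightarrow> c = d" using d by blast
      then show "padic_basis (j + 1) (rat ((r + of_nat c) / of_nat p)) x = (if c = d then 1 else 0)"
        unfolding * by simp
    qed simp
    then show ?thesis using lhs True d(1) by simp
  next
    case False
    have "\<not> nrm (dif y (rat (of_nat c))) < 1" for c
    proof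
      assume "nrm (dif y (rat (of_nat c))) < 1"
      then have "nrm y \<le> 1"
        using nrm_triangle[of y "rat (of_nat c)" "rat 0"] y rn_of_int_le_1[of "int c"] by (simp add: max_def split: if_splits)
      then show False using False by simp
    qed
    then show ?thesis using lhs False unfolding * by simp
  qed
qed

lemma rat_eq_0_iff: "rat r = rat 0 \<longleftrightarrow> r = 0"
  using padic_norm_of_rat[of r] padic_norm_of_rat[of 0] by (metis rn_0 rn_eq_0_iff)

text \<open>A nonzero r in \<open>Ir\<close> has distance above 1 from the index 0, whereas -c has
  norm at most 1.\<close>

lemma child_nonzero: assumes "r \<in> Ir" "r \<noteq> 0" shows "r + of_nat c \<noteq> 0"
proof
  assume "r + of_nat c = 0"
  then have "rn r = rn (of_int (int c))" by (metis add_eq_0_iff rn_minus of_int_of_nat_eq minus_minus)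
  then have "rn r \<le> 1" using rn_of_int_le_1[of "int c"] by simp
  moreover have "nrm (dif (rat r) (rat 0)) > 1"
    using assms zero_Ir rat_eq_0_iff by (intro Ip_far) (auto simp: Ip_eq)
  ultimately show False by simp
qed

end

locale adele_mra = adele_measure +
  fixes Vr :: "int \<Rightarrow> (real \<Rightarrow> complex) set" and \<phi>r :: "real \<Rightarrow> complex"
    and Vp :: "nat \<Rightarrow> int \<Rightarrow> (padic \<Rightarrow> complex) set" and \<phi>p :: "nat \<Rightarrow> padic \<Rightarrow> complex"
  assumes real_mra: "real_mra Vr \<phi>r"
    and padic_mra: "\<And>p. prime p \<Longrightarrow> padic_mra p (\<mu> p) (Vp p) (\<phi>p p)"
    and phi_val: "\<And>p x. prime p \<Longrightarrow> x \<in> Qp p \<Longrightarrow> \<phi>p p x = (if padic_norm p x \<le> 1 then 1 else 0)"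
begin

lemma place_mra: "prime p \<Longrightarrow> haar_padic_mra p (\<mu> p) (Vp p) (\<phi>p p)"
  using place padic_mra phi_val by (simp add: haar_padic_mra_def haar_padic_mra_axioms_def)

sublocale rs: scaled_mra lborel Vr "\<lambda>j x. 2 powi j * x" "\<lambda>j. 2 powi (- j)" "range (\<lambda>(n::int) x. \<phi>r (x - of_int n))"
  by (rule real_scaled_mra) (rule real_mra)

definition real_basis :: "int \<Rightarrow> int \<Rightarrow> real \<Rightarrow> complex" where
  "real_basis j n x = \<phi>r (2 powi j * x - of_int n)"

text \<open>Agrees with \<open>padic_basis\<close> at primes; being defined for every p, it can be
  used in families over all places.\<close>

definition place_basis :: "nat \<Rightarrow> int \<Rightarrow> padic \<Rightarrow> padic \<Rightarrow> complex" where
  "place_basis p j a x = \<phi>p p (padic_diff p (padic_mult p (padic_of_rat p (of_nat p powi (- j))) x) a)"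

lemma Vr_eq: "Vr j = closed_span lborel (range (real_basis j))"
  using rs.scaled_span[of j] by (simp add: real_basis_def[abs_def] image_image)

lemma Vr_L2: "Vr j \<subseteq> L2 lborel"
  using rs.V[of j] by (simp add: closed_subspace_def)

lemma real_basis_Vr: "real_basis j n \<in> Vr j"
proof -
  have "(\<lambda>x. \<phi>r (x - of_int n)) \<in> Vr 0"
    using real_mra by (simp add: real_mra_def orthonormal_basis_def)
  from rs.scaled_map[OF this, of j] show ?thesis by (simp add: real_basis_def[abs_def])
qed

lemma real_basis_L2: "real_basis j n \<in> L2 lborel"
  using real_basis_Vr Vr_L2 by blast

lemma Vr_mono: "i \<le> j \<Longrightarrow> Vr i \<subseteq> Vr j"
proof (induction j rule: int_ge_induct)
  case (step j)
  then show ?case using real_mra unfolding real_mra_def by blast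
qed simp

lemma place_basis_eq: "prime p \<Longrightarrow> place_basis p = haar_padic_mra.padic_basis p (\<phi>p p)"
  by (intro ext) (simp add: place_basis_def haar_padic_mra.padic_basis_def[OF place_mra])

lemma place_basis_Vp: "prime p \<Longrightarrow> a \<in> Ip p \<Longrightarrow> place_basis p j a \<in> Vp p j"
  using haar_padic_mra.padic_basis_V[OF place_mra] by (simp add: place_basis_eq)

lemma place_basis_L2: "prime p \<Longrightarrow> a \<in> Ip p \<Longrightarrow> place_basis p j a \<in> L2 (\<mu> p)"
  using haar_padic_mra.padic_basis_L2[OF place_mra] by (simp add: place_basis_eq)

lemma Vp_eq: "prime p \<Longrightarrow> Vp p j = closed_span (\<mu> p) (place_basis p j ` Ip p)"
  using haar_padic_mra.V_eq[OF place_mra] by (simp add: place_basis_eq)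

lemma Vp_L2: "prime p \<Longrightarrow> Vp p j \<subseteq> L2 (\<mu> p)"
  using haar_padic_mra.V_subset_L2[OF place_mra] .

lemma Vp_mono: "prime p \<Longrightarrow> i \<le> j \<Longrightarrow> Vp p i \<subseteq> Vp p j"
  using haar_padic_mra.V_mono[OF place_mra] .

lemma phi_mem_Vp: "prime p \<Longrightarrow> 0 \<le> j \<Longrightarrow> \<phi>p p \<in> Vp p j"
  using haar_padic_mra.phi_V0[OF place_mra] Vp_mono by blast

lemma phi_indicator: "prime p \<Longrightarrow> x \<in> Qp p \<Longrightarrow> \<phi>p p x = indicator (Zp p) x"
  by (auto simp: phi_val Zp_def indicator_def)

abbreviation rt :: "nat \<Rightarrow> rat \<Rightarrow> padic" where "rt \<equiv> padic_of_rat"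

lemma Ip_Qp: "prime p \<Longrightarrow> a \<in> Ip p \<Longrightarrow> a \<in> Qp p"
  using padic_haar_place.Ip_Qp[OF place] .

lemma zero_Ip: "prime p \<Longrightarrow> rt p 0 \<in> Ip p"
  using padic_haar_place.Ip_eq[OF place] padic_haar_place.zero_Ir[OF place] by blast

lemma diff_zero: "prime p \<Longrightarrow> x \<in> Qp p \<Longrightarrow> padic_diff p x (rt p 0) = x"
  using padic_place.dif_0[of p x] by (simp add: padic_place_def)

lemma place_basis_0_0: "prime p \<Longrightarrow> x \<in> Qp p \<Longrightarrow> place_basis p 0 (rt p 0) x = \<phi>p p x"
  using padic_place.scl_1[of p x] by (simp add: place_basis_def diff_zero padic_place_def)

subsection \<open>Spanning sets\<close>

definition primes_upto :: "nat \<Rightarrow> nat set" where "primes_upto m = {p. prime p \<and> p \<le> m}"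

definition bracket_gens :: "int \<Rightarrow> nat \<Rightarrow> (adele \<Rightarrow> complex) set" where
  "bracket_gens j m = {tensor f g |f g. f \<in> Vr j \<and> (\<forall>p. prime p \<longrightarrow> (if p \<le> m then g p \<in> Vp p j else g p = \<phi>p p))}"

definition basis_factor :: "int \<Rightarrow> nat \<Rightarrow> (nat \<Rightarrow> padic) \<Rightarrow> nat \<Rightarrow> padic \<Rightarrow> complex" where
  "basis_factor j m b p = (if p \<le> m then place_basis p j (b p) else \<phi>p p)"

definition basis_tensor :: "int \<Rightarrow> nat \<Rightarrow> int \<Rightarrow> (nat \<Rightarrow> padic) \<Rightarrow> adele \<Rightarrow> complex" where
  "basis_tensor j m n b = tensor (real_basis j n) (basis_factor j m b)"

text \<open>The last condition expresses that m is the top place of the index: either m is the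
  infinite place or the component at m is nonzero. Constants of the dilations are dropped.\<close>

definition translate_gens :: "int \<Rightarrow> (adele \<Rightarrow> complex) set" where
  "translate_gens j = {basis_tensor j m n b |m n b. m \<in> places \<and> (\<forall>p\<in>primes_upto m. b p \<in> Ip p) \<and> (m = 0 \<or> b m \<noteq> rt m 0)}"

lemma primes_upto_standard_off: "(\<And>p. prime p \<Longrightarrow> p > m \<Longrightarrow> g p = \<phi>p p) \<Longrightarrow> standard_off (primes_upto m) g"
  by (auto simp: standard_off_def primes_upto_def phi_indicator)

lemma basis_factor_standard_off: "standard_off (primes_upto m) (basis_factor j m b)"
  by (rule primes_upto_standard_off) (simp add: basis_factor_def)

lemma bracket_gens_L2: "bracket_gens j m \<subseteq> L2 A"
proof
  fix t assume "t \<in> bracket_gens j m"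
  then obtain f g where t: "t = tensor f g" "f \<in> Vr j"
    "\<forall>p. prime p \<longrightarrow> (if p \<le> m then g p \<in> Vp p j else g p = \<phi>p p)" unfolding bracket_gens_def by blast
  have "standard_off (primes_upto m) g" using t(3) by (intro primes_upto_standard_off) (metis not_le)
  moreover have "g p \<in> L2 (\<mu> p)" if "p \<in> primes_upto m" for p
    using t(3) that Vp_L2[of p j] by (auto simp: primes_upto_def split: if_splits)
  ultimately show "t \<in> L2 A" unfolding t(1) using t(2) Vr_L2 by (intro tensor_L2(1)) auto
qed

lemma basis_tensor_bracket_gens: "(\<forall>p\<in>primes_upto m. b p \<in> Ip p) \<Longrightarrow> basis_tensor j m n b \<in> bracket_gens j m"
  unfolding bracket_gens_def basis_tensor_def
  by (intro CollectI exI[of _ "real_basis j n"] exI[of _ "basis_factor j m b"]) (auto simp: basis_factor_def primes_upto_def real_basis_Vr place_basis_Vp)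

lemma basis_tensor_L2: "(\<forall>p\<in>primes_upto m. b p \<in> Ip p) \<Longrightarrow> basis_tensor j m n b \<in> L2 A"
  using basis_tensor_bracket_gens bracket_gens_L2 by blast

lemma translate_gens_base: "m \<in> places \<Longrightarrow> \<forall>p\<in>primes_upto m. b p \<in> Ip p \<Longrightarrow> m = 0 \<or> b m \<noteq> rt m 0 \<Longrightarrow> basis_tensor j m n b \<in> closed_span A (translate_gens j)"
  by (intro closed_span_base basis_tensor_L2) (unfold translate_gens_def, blast)

lemma bracket_eq: "V_bracket A Vr Vp \<phi>p m j = closed_span A (bracket_gens j m)"
  by (simp add: V_bracket_def bracket_gens_def)

text \<open>By \<open>tensor_closed_span\<close> each factor may be replaced by local basis
  functions, so inclusions of bracket spaces need checking on basis tensors only.\<close>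

lemma bracket_gens_closed_span:
  assumes T: "\<And>n b. (\<forall>p\<in>primes_upto m. b p \<in> Ip p) \<Longrightarrow> basis_tensor j m n b \<in> closed_span A T"
  shows "bracket_gens j m \<subseteq> closed_span A T"
proof
  fix t assume "t \<in> bracket_gens j m"
  then obtain f g where t: "t = tensor f g" "f \<in> Vr j"
    "\<forall>p. prime p \<longrightarrow> (if p \<le> m then g p \<in> Vp p j else g p = \<phi>p p)" unfolding bracket_gens_def by blast
  have standard_off: "standard_off (primes_upto m) g" using t(3) by (intro primes_upto_standard_off) (metis not_le)
  show "t \<in> closed_span A T" unfolding t(1)
  proof (rule tensor_closed_span[OF standard_off])
    show "range (real_basis j) \<subseteq> L2 lborel" using real_basis_L2 by auto
    show "place_basis p j ` Ip p \<subseteq> L2 (\<mu> p)" if "p \<in> primes_upto m" for p using that place_basis_L2 by (auto simp: primes_upto_def)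
    show "f \<in> closed_span lborel (range (real_basis j))" using t(2) Vr_eq by simp
    show "g p \<in> closed_span (\<mu> p) (place_basis p j ` Ip p)" if "p \<in> primes_upto m" for p
      using t(3) that Vp_eq[of p j] by (auto simp: primes_upto_def split: if_splits)
    fix f' g' assume f': "f' \<in> range (real_basis j)" and g': "\<And>p. p \<in> primes_upto m \<Longrightarrow> g' p \<in> place_basis p j ` Ip p"
      "\<And>p. p \<notin> primes_upto m \<Longrightarrow> g' p = g p"
    obtain n where n: "f' = real_basis j n" using f' by auto
    have "\<exists>b. p \<in> primes_upto m \<longrightarrow> b \<in> Ip p \<and> g' p = place_basis p j b" for p using g'(1)[of p] by auto
    then obtain b where b: "\<And>p. p \<in> primes_upto m \<Longrightarrow> b p \<in> Ip p \<and> g' p = place_basis p j (b p)" by metis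
    show "tensor f' g' \<in> closed_span A T"
    proof (rule closed_span_cong[OF T])
      show "\<forall>p\<in>primes_upto m. b p \<in> Ip p" using b by blast
      fix x assume x: "x \<in> space A"
      show "basis_tensor j m n b x = tensor f' g' x" unfolding basis_tensor_def n
      proof (rule tensor_cong[OF _ x])
        fix p :: nat and z assume p: "prime p"
        show "basis_factor j m b p z = g' p z"
        proof (cases "p \<le> m")
          case True
          then show ?thesis using b[of p] p by (simp add: basis_factor_def primes_upto_def)
        next
          case False
          then have "g' p = g p" using g'(2)[of p] by (simp add: primes_upto_def)
          moreover have "g p = \<phi>p p" using t(3) p False by auto
          ultimately show ?thesis using False by (simp add: basis_factor_def)
        qed
      qed
    qed
  qed
qed

lemma brackets_eq: "V_by_brackets A Vr Vp \<phi>p j = closed_span A (\<Union>m\<in>places. bracket_gens j m)"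
proof
  show "V_by_brackets A Vr Vp \<phi>p j \<subseteq> closed_span A (\<Union>m\<in>places. bracket_gens j m)"
    unfolding V_by_brackets_def bracket_eq
  proof (rule closed_span_minimal, rule UN_least)
    fix m assume "m \<in> places"
    then show "closed_span A (bracket_gens j m) \<subseteq> closed_span A (\<Union>m\<in>places. bracket_gens j m)" by (intro closed_span_mono) auto
  qed
  show "closed_span A (\<Union>m\<in>places. bracket_gens j m) \<subseteq> V_by_brackets A Vr Vp \<phi>p j"
    unfolding V_by_brackets_def bracket_eq
    using bracket_gens_L2 by (intro closed_span_mono) (auto intro!: closed_span_base)
qed

text \<open>The largest place not exceeding N. It turns an arbitrary bound on the primes involved
  into a place.\<close>

lemma prev_place: "\<exists>m\<in>places. m \<le> N \<and> (\<forall>q. prime q \<longrightarrow> q > m \<longrightarrow> q > N)"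
proof -
  have f: "finite (places \<inter> {..N})" "0 \<in> places \<inter> {..N}" by (auto simp: places_def)
  define m where "m = Max (places \<inter> {..N})"
  have "m \<in> places \<inter> {..N}" unfolding m_def using f by (intro Max_in) auto
  moreover have "q > N" if "prime q" "q > m" for q
  proof (rule ccontr)
    assume "\<not> q > N"
    then have "q \<in> places \<inter> {..N}" using that by (auto simp: places_def)
    then have "q \<le> m" unfolding m_def using f by (intro Max_ge) auto
    then show False using that by simp
  qed
  ultimately show ?thesis by blast
qed

lemma top_place_props:
  assumes a: "a \<in> IA"
  shows "top_place a \<in> places" "\<And>q. prime q \<Longrightarrow> q > top_place a \<Longrightarrow> snd a q = rt q 0"
    "top_place a = 0 \<or> snd a (top_place a) \<noteq> rt (top_place a) 0"
proof -
  let ?Q = "\<lambda>m. m \<in> places \<and> (\<forall>q>m. prime q \<longrightarrow> snd a q = rt q 0)"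
  obtain N where N: "\<forall>p>N. prime p \<longrightarrow> snd a p = rt p 0" using a by (auto simp: IA_def)
  obtain m0 where "m0 \<in> places" "\<forall>q. prime q \<longrightarrow> q > m0 \<longrightarrow> q > N" using prev_place[of N] by blast
  then have "?Q m0" using N by blast
  then have Q: "?Q (top_place a)" unfolding top_place_def by (rule LeastI)
  then show "top_place a \<in> places" "\<And>q. prime q \<Longrightarrow> q > top_place a \<Longrightarrow> snd a q = rt q 0" by auto
  show "top_place a = 0 \<or> snd a (top_place a) \<noteq> rt (top_place a) 0"
  proof (rule ccontr)
    assume "\<not> ?thesis"
    then have t: "top_place a \<noteq> 0" "snd a (top_place a) = rt (top_place a) 0" by auto
    \<comment> \<open>If the component at the top place vanished, the preceding place would already
      qualify, against minimality.\<close>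
    obtain m' where m': "m' \<in> places" "m' \<le> top_place a - 1" "\<forall>q. prime q \<longrightarrow> q > m' \<longrightarrow> q > top_place a - 1"
      using prev_place[of "top_place a - 1"] by blast
    have "snd a q = rt q 0" if "q > m'" "prime q" for q
    proof (cases "q = top_place a")
      case False
      have "q > top_place a - 1" using m'(3) that by blast
      then have "q > top_place a" using False by linarith
      then show ?thesis using Q that by blast
    qed (use t in simp)
    then have "?Q m'" using m' by blast
    then have "top_place a \<le> m'" unfolding top_place_def by (rule Least_le)
    then show False using m'(2) t(1) by linarith
  qed
qed

definition adele_of :: "nat \<Rightarrow> int \<Rightarrow> (nat \<Rightarrow> padic) \<Rightarrow> adele" where
  "adele_of m n b = (of_int n, \<lambda>p\<in>{p. prime p}. if p \<le> m then b p else rt p 0)"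

lemma adele_of_IA: "\<forall>p\<in>primes_upto m. b p \<in> Ip p \<Longrightarrow> adele_of m n b \<in> IA"
  by (auto simp: IA_def adele_of_def primes_upto_def zero_Ip intro!: exI[of _ m])

lemma top_place_adele_of:
  assumes m: "m \<in> places" "m = 0 \<or> b m \<noteq> rt m 0"
  shows "top_place (adele_of m n b) = m"
  unfolding top_place_def
proof (rule Least_equality)
  show "m \<in> places \<and> (\<forall>q>m. prime q \<longrightarrow> snd (adele_of m n b) q = rt q 0)"
    using m by (auto simp: adele_of_def)
  fix y assume y: "y \<in> places \<and> (\<forall>q>y. prime q \<longrightarrow> snd (adele_of m n b) q = rt q 0)"
  show "m \<le> y"
  proof (rule ccontr)
    assume "\<not> m \<le> y"
    then have "prime m" "m > y" using m(1) by (auto simp: places_def)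
    then have "b m = rt m 0" using y by (auto simp: adele_of_def)
    then show False using m(2) \<open>m > y\<close> by simp
  qed
qed

section \<open>Dilated shifts as tensors of basis functions\<close>

abbreviation \<Phi> :: "adele \<Rightarrow> complex" where "\<Phi> \<equiv> tensor \<phi>r \<phi>p"

definition dilation_const :: "nat \<Rightarrow> int \<Rightarrow> complex" where
  "dilation_const m j = complex_of_real (2 powr (of_int j / 2) * (\<Prod>q | prime q \<and> q \<le> m. real q powr (of_int j / 2)))"

lemma dilation_const_nz: "dilation_const m j \<noteq> 0"
proof -
  have "(\<Prod>q | prime q \<and> q \<le> m. real q powr (of_int j / 2)) > 0"
    by (intro prod_pos) (auto simp: prime_gt_0_nat)
  then show ?thesis by (simp add: dilation_const_def del: of_real_mult)
qed

text \<open>Any m above which the index vanishes is allowed, not only the top place. The floor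
  merely converts the integral real component of \<open>a\<close> to type
  \<open>int\<close>.\<close>

lemma dilation_shift:
  assumes a: "a \<in> IA" "\<And>q. prime q \<Longrightarrow> q > m \<Longrightarrow> snd a q = rt q 0" and x: "x \<in> space A"
  shows "dilation m j (shift a \<Phi>) x = dilation_const m j * basis_tensor j m (floor (fst a)) (snd a) x"
proof -
  let ?y = "(2 powi j * fst x, \<lambda>q\<in>{q. prime q}.
            if q \<le> m then padic_mult q (padic_of_rat q (of_nat q powi (- j))) (snd x q) else snd x q)"
  have y: "snd x \<in> Afin" using x by (auto simp: space_A)
  have fa: "of_int (floor (fst a)) = fst a" using a by (auto simp: IA_def elim: Ints_cases)
  have e: "\<phi>p p (snd (adele_diff ?y a) p) = basis_factor j m (snd a) p (snd x p)" if p: "prime p" for p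
    using p a(2)[OF p] Afin_Qp[OF y p] by (auto simp: adele_diff_def basis_factor_def place_basis_def diff_zero)
  have "\<Phi> (adele_diff ?y a) = basis_tensor j m (floor (fst a)) (snd a) x"
  proof -
    have "{p. prime p \<and> \<phi>p p (snd (adele_diff ?y a) p) \<noteq> 1} = {p. prime p \<and> basis_factor j m (snd a) p (snd x p) \<noteq> 1}"
      using e by auto
    then have "(\<Prod>p | prime p \<and> \<phi>p p (snd (adele_diff ?y a) p) \<noteq> 1. \<phi>p p (snd (adele_diff ?y a) p))
      = (\<Prod>p | prime p \<and> basis_factor j m (snd a) p (snd x p) \<noteq> 1. basis_factor j m (snd a) p (snd x p))"
      using e by (intro prod.cong) auto
    moreover have "fst (adele_diff ?y a) = 2 powi j * fst x - fst a" by (simp add: adele_diff_def)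
    ultimately show ?thesis by (simp only: tensor_def basis_tensor_def real_basis_def fa)
  qed
  then show ?thesis by (simp only: dilation_def shift_def dilation_const_def)
qed

text \<open>Nonzero constants are absorbed by the span. Conversely, \<open>adele_of\<close> supplies
  an index whose top place is the prescribed m.\<close>

lemma translates_eq: "V_by_translates A \<Phi> j = closed_span A (translate_gens j)"
proof
  show "V_by_translates A \<Phi> j \<subseteq> closed_span A (translate_gens j)"
    unfolding V_by_translates_def
  proof (rule closed_span_minimal, rule subsetI)
    fix t assume "t \<in> {dilation m j (shift a \<Phi>) |m a. a \<in> IA \<and> m \<in> places \<and> top_place a = m}"
    then obtain a where a: "a \<in> IA" "t = dilation (top_place a) j (shift a \<Phi>)" by blast
    let ?m = "top_place a"
    have "\<forall>p\<in>primes_upto ?m. snd a p \<in> Ip p" using a by (auto simp: IA_def primes_upto_def PiE_iff)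
    then have "basis_tensor j ?m (floor (fst a)) (snd a) \<in> closed_span A (translate_gens j)"
      using top_place_props[OF a(1)] by (intro translate_gens_base) auto
    then have "(\<lambda>x. 0 + dilation_const ?m j * basis_tensor j ?m (floor (fst a)) (snd a) x) \<in> closed_span A (translate_gens j)"
      by (intro closed_span_add closed_span_zero)
    then show "t \<in> closed_span A (translate_gens j)"
      by (rule closed_span_cong) (simp add: a(2) dilation_shift[OF a(1) top_place_props(2)[OF a(1)]])
  qed
  show "closed_span A (translate_gens j) \<subseteq> V_by_translates A \<Phi> j"
    unfolding V_by_translates_def
  proof (rule closed_span_minimal, rule subsetI)
    fix t assume "t \<in> translate_gens j"
    then obtain m n b where t: "t = basis_tensor j m n b" "m \<in> places" "\<forall>p\<in>primes_upto m. b p \<in> Ip p" "m = 0 \<or> b m \<noteq> rt m 0"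
      unfolding translate_gens_def by blast
    let ?a = "adele_of m n b"
    have a: "?a \<in> IA" "top_place ?a = m" using adele_of_IA[OF t(3)] top_place_adele_of[of m b n] t(2,4) by simp_all
    have e: "dilation m j (shift ?a \<Phi>) x = dilation_const m j * t x" if x: "x \<in> space A" for x
    proof -
      have "basis_tensor j m (floor (fst ?a)) (snd ?a) x = t x"
      proof -
        have "tensor (real_basis j n) (basis_factor j m (snd ?a)) x = tensor (real_basis j n) (basis_factor j m b) x"
          by (rule tensor_cong[OF _ x]) (simp add: basis_factor_def adele_of_def)
        then show ?thesis by (simp add: basis_tensor_def t(1) adele_of_def)
      qed
      then show ?thesis
        using dilation_shift[OF a(1) top_place_props(2)[OF a(1)] x, where j = j] a(2) by simp
    qed
    have tL: "t \<in> L2 A" using t basis_tensor_L2 by simp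
    have "dilation m j (shift ?a \<Phi>) \<in> L2 A"
      using L2_cong[of A "dilation m j (shift ?a \<Phi>)" "\<lambda>x. dilation_const m j * t x"] e L2_scale[OF tL] by auto
    then have "dilation m j (shift ?a \<Phi>) \<in> closed_span A {dilation m j (shift a \<Phi>) |m a. a \<in> IA \<and> m \<in> places \<and> top_place a = m}"
      using a t(2) by (intro closed_span_base) blast+
    then have "(\<lambda>x. 0 + (1 / dilation_const m j) * dilation m j (shift ?a \<Phi>) x)
       \<in> closed_span A {dilation m j (shift a \<Phi>) |m a. a \<in> IA \<and> m \<in> places \<and> top_place a = m}"
      by (intro closed_span_add closed_span_zero)
    then show "t \<in> closed_span A {dilation m j (shift a \<Phi>) |m a. a \<in> IA \<and> m \<in> places \<and> top_place a = m}"
      by (rule closed_span_cong) (simp add: e dilation_const_nz)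
  qed
qed

section \<open>Comparison of the two spans and their growth with the level\<close>

lemma translates_subset: "V_by_translates A \<Phi> j \<subseteq> V_by_brackets A Vr Vp \<phi>p j"
  unfolding translates_eq brackets_eq
proof (rule closed_span_mono, rule subsetI)
  fix t assume "t \<in> translate_gens j"
  then show "t \<in> (\<Union>m\<in>places. bracket_gens j m)" unfolding translate_gens_def using basis_tensor_bracket_gens by blast
qed

text \<open>Above m the factor is \<open>\<phi>p\<close> at both levels, so local inclusions up to m
  suffice; this covers negative levels too.\<close>

lemma brackets_mono: "V_by_brackets A Vr Vp \<phi>p j \<subseteq> V_by_brackets A Vr Vp \<phi>p (j + 1)"
proof -
  have "bracket_gens j m \<subseteq> bracket_gens (j + 1) m" for m
  proof
    fix t assume "t \<in> bracket_gens j m"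
    then obtain f g where t: "t = tensor f g" "f \<in> Vr j"
      "\<forall>p. prime p \<longrightarrow> (if p \<le> m then g p \<in> Vp p j else g p = \<phi>p p)" unfolding bracket_gens_def by blast
    have "f \<in> Vr (j + 1)" using t(2) Vr_mono[of j "j + 1"] by auto
    moreover have "\<forall>p. prime p \<longrightarrow> (if p \<le> m then g p \<in> Vp p (j + 1) else g p = \<phi>p p)"
    proof (intro allI impI)
      fix p :: nat assume "prime p"
      then show "if p \<le> m then g p \<in> Vp p (j + 1) else g p = \<phi>p p"
        using t(3)[rule_format, of p] Vp_mono[of p j "j + 1"] by (auto split: if_splits)
    qed
    ultimately show "t \<in> bracket_gens (j + 1) m" unfolding bracket_gens_def t(1) by blast
  qed
  then show ?thesis unfolding brackets_eq by (intro closed_span_mono) blast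
qed

lemma place_basis_split:
  assumes "prime p" "x \<in> Qp p"
  shows "place_basis p j (rt p r) x = (\<Sum>c<p. place_basis p (j + 1) (rt p ((r + of_nat c) / of_nat p)) x)"
  unfolding place_basis_eq[OF assms(1)] by (rule haar_padic_mra.padic_basis_split[OF place_mra[OF assms(1)] assms(2)])

abbreviation Ir :: "nat \<Rightarrow> rat set" where "Ir p \<equiv> padic_haar_place.Ir p"

lemma Ip_Ir: "prime p \<Longrightarrow> Ip p = rt p ` Ir p"
  using padic_haar_place.Ip_eq[OF place] .

lemma Ir_child: "prime p \<Longrightarrow> r \<in> Ir p \<Longrightarrow> c < p \<Longrightarrow> (r + of_nat c) / of_nat p \<in> Ir p"
  using padic_haar_place.Ir_step[OF place] .

lemma rt_eq_0_iff: "prime p \<Longrightarrow> rt p r = rt p 0 \<longleftrightarrow> r = 0"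
  using haar_padic_mra.rat_eq_0_iff[OF place_mra] .

lemma child_nonzero: "prime p \<Longrightarrow> r \<in> Ir p \<Longrightarrow> r \<noteq> 0 \<Longrightarrow> (r + of_nat c) / of_nat p \<noteq> 0"
  using haar_padic_mra.child_nonzero[OF place_mra] by (simp add: prime_gt_0_nat)

text \<open>A ball not containing 0 has no child containing 0, hence refining a basis function
  preserves the top place.\<close>

lemma place_basis_refine:
  assumes p: "prime p" and a: "a \<in> Ip p" "a \<noteq> rt p 0"
  shows "place_basis p j a \<in> closed_span (\<mu> p) (place_basis p (j + 1) ` (Ip p - {rt p 0}))"
proof -
  obtain r where r: "a = rt p r" "r \<in> Ir p" using a Ip_Ir[OF p] by auto
  have r0: "r \<noteq> 0" using a r by auto
  show ?thesis
  proof (rule closed_span_cong)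
    show "(\<lambda>x. \<Sum>c<p. 1 * place_basis p (j + 1) (rt p ((r + of_nat c) / of_nat p)) x)
      \<in> closed_span (\<mu> p) (place_basis p (j + 1) ` (Ip p - {rt p 0}))"
    proof (rule closed_span_lincomb)
      fix c assume "c \<in> {..<p}"
      then have "rt p ((r + of_nat c) / of_nat p) \<in> Ip p - {rt p 0}"
        using Ir_child[OF p r(2)] child_nonzero[OF p r(2) r0, of c] rt_eq_0_iff[OF p] Ip_Ir[OF p] by auto
      then show "place_basis p (j + 1) (rt p ((r + of_nat c) / of_nat p)) \<in> closed_span (\<mu> p) (place_basis p (j + 1) ` (Ip p - {rt p 0}))"
        using place_basis_L2[OF p] by (intro closed_span_base) auto
    qed simp
  qed (use place_basis_split[OF p] space_mu[OF p] r in simp)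
qed

text \<open>Each factor is refined by one level. The refined tensors must keep m as top place, so at
  m itself the refinement that avoids the index 0 is used.\<close>

lemma translates_mono: "V_by_translates A \<Phi> j \<subseteq> V_by_translates A \<Phi> (j + 1)"
  unfolding translates_eq
proof (rule closed_span_minimal, rule subsetI)
  fix t assume "t \<in> translate_gens j"
  then obtain m n b where t: "t = basis_tensor j m n b" "m \<in> places" "\<forall>p\<in>primes_upto m. b p \<in> Ip p" "m = 0 \<or> b m \<noteq> rt m 0"
    unfolding translate_gens_def by blast
  \<comment> \<open>Admissible indices after refinement: 0 is excluded at the top place
    only.\<close>
  define I where "I p = (if p = m then Ip p - {rt p 0} else Ip p)" for p
  show "t \<in> closed_span A (translate_gens (j + 1))" unfolding t(1) basis_tensor_def
  proof (rule tensor_closed_span[OF basis_factor_standard_off, where Sr = "range (real_basis (j + 1))" and Sp = "\<lambda>p. place_basis p (j + 1) ` I p"])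
    show "range (real_basis (j + 1)) \<subseteq> L2 lborel" using real_basis_L2 by auto
    show "place_basis p (j + 1) ` I p \<subseteq> L2 (\<mu> p)" if "p \<in> primes_upto m" for p
      using that place_basis_L2 by (auto simp: primes_upto_def I_def split: if_splits)
    show "real_basis j n \<in> closed_span lborel (range (real_basis (j + 1)))"
      using real_basis_Vr[of j n] Vr_mono[of j "j + 1"] Vr_eq[of "j + 1"] by auto
    show "basis_factor j m b p \<in> closed_span (\<mu> p) (place_basis p (j + 1) ` I p)" if pm: "p \<in> primes_upto m" for p
    proof -
      have p: "prime p" "p \<le> m" "b p \<in> Ip p" using pm t(3) by (auto simp: primes_upto_def)
      show ?thesis
      proof (cases "p = m")
        case True
        then have "m \<noteq> 0" using p(1) by auto
        then show ?thesis using place_basis_refine[OF p(1,3), of j] True t(4) p(2) by (simp add: basis_factor_def I_def)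
      next
        case False
        then show ?thesis using place_basis_Vp[OF p(1,3), of j] Vp_mono[OF p(1), of j "j + 1"] Vp_eq[OF p(1), of "j + 1"] p(2)
          by (auto simp: basis_factor_def I_def)
      qed
    qed
    fix f' g' assume f': "f' \<in> range (real_basis (j + 1))" and g': "\<And>p. p \<in> primes_upto m \<Longrightarrow> g' p \<in> place_basis p (j + 1) ` I p"
      "\<And>p. p \<notin> primes_upto m \<Longrightarrow> g' p = basis_factor j m b p"
    obtain n' where n: "f' = real_basis (j + 1) n'" using f' by auto
    have "\<exists>b'. p \<in> primes_upto m \<longrightarrow> b' \<in> I p \<and> g' p = place_basis p (j + 1) b'" for p using g'(1)[of p] by auto
    then obtain b' where b': "\<And>p. p \<in> primes_upto m \<Longrightarrow> b' p \<in> I p \<and> g' p = place_basis p (j + 1) (b' p)" by metis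
    show "tensor f' g' \<in> closed_span A (translate_gens (j + 1))"
    proof (rule closed_span_cong)
      show "basis_tensor (j + 1) m n' b' \<in> closed_span A (translate_gens (j + 1))"
      proof (rule translate_gens_base[OF t(2)])
        have "b' p \<in> Ip p" if "p \<in> primes_upto m" for p using b'[OF that] unfolding I_def by (metis DiffD1)
        then show "\<forall>p\<in>primes_upto m. b' p \<in> Ip p" by blast
        show "m = 0 \<or> b' m \<noteq> rt m 0"
        proof (cases "m = 0")
          case False
          then have "m \<in> primes_upto m" using t(2) by (auto simp: primes_upto_def places_def)
          then show ?thesis using b'[of m] by (auto simp: I_def)
        qed simp
      qed
      fix x assume x: "x \<in> space A"
      show "basis_tensor (j + 1) m n' b' x = tensor f' g' x" unfolding basis_tensor_def n
      proof (rule tensor_cong[OF _ x])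
        fix p :: nat and z assume p: "prime p"
        show "basis_factor (j + 1) m b' p z = g' p z"
          using b'[of p] g'(2)[of p] p by (cases "p \<le> m") (auto simp: basis_factor_def primes_upto_def)
      qed
    qed
  qed
qed

subsection \<open>Nonnegative levels\<close>

text \<open>At a level \<^term>\<open>j \<ge> 0\<close> the indicator of $p^j \mathbf{Z}_p$ is the indicator of
  $\mathbf{Z}_p$ minus basis functions at points other than 0.  This removes the basis functions
  with a vanishing last index one place at a time.\<close>

lemma basis_tensor_closed_span_translate_gens:
  assumes b: "\<forall>p\<in>primes_upto m. b p \<in> Ip p"
  shows "basis_tensor (int J) m n b \<in> closed_span A (translate_gens (int J))"
  using b
proof (induction m arbitrary: b)
  case 0
  show ?case by (rule translate_gens_base) (auto simp: places_def primes_upto_def)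
next
  case (Suc m0)
  define m where "m = Suc m0"
  have prev: "basis_tensor (int J) m0 n b \<in> closed_span A (translate_gens (int J))"
    using Suc.prems by (intro Suc.IH) (auto simp: primes_upto_def)
  show ?case
  proof (cases "prime m")
    case False
    show ?thesis
    proof (rule closed_span_cong[OF prev])
      fix x assume x: "x \<in> space A"
      show "basis_tensor (int J) m0 n b x = basis_tensor (int J) (Suc m0) n b x" unfolding basis_tensor_def
      proof (rule tensor_cong[OF _ x])
        fix p :: nat and z assume "prime p"
        then have "p \<noteq> Suc m0" using False by (auto simp: m_def)
        then show "basis_factor (int J) m0 b p z = basis_factor (int J) (Suc m0) b p z" by (auto simp: basis_factor_def)
      qed
    qed
  next
    case pm: True
    let ?g = "basis_factor (int J) m b"
    have mP: "m \<in> primes_upto m" using pm by (simp add: primes_upto_def)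
    \<comment> \<open>All factors but the one at m are frozen; this makes the claim a property of
      \<open>h\<close> that is preserved by linear combinations.\<close>
    define X where "X h \<longleftrightarrow> tensor (real_basis (int J) n) (?g(m := h)) \<in> closed_span A (translate_gens (int J))" for h
    have X_cong: "X h'" if "X h" "\<And>z. z \<in> Qp m \<Longrightarrow> h z = h' z" for h h'
      using that(1) unfolding X_def
    proof (rule closed_span_cong)
      fix x assume "x \<in> space A"
      then show "tensor (real_basis (int J) n) (?g(m := h)) x = tensor (real_basis (int J) n) (?g(m := h')) x"
        by (rule tensor_cong[rotated]) (auto simp: that(2))
    qed
    have X_add: "X (\<lambda>z. h z + c * h' z)" if "X h" "X h'" for h h' c
    proof -
      have "(\<lambda>x. tensor (real_basis (int J) n) (?g(m := h)) x + c * tensor (real_basis (int J) n) (?g(m := h')) x) \<in> closed_span A (translate_gens (int J))"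
        using that unfolding X_def by (rule closed_span_add)
      then show ?thesis unfolding X_def
        by (rule closed_span_cong) (rule tensor_add_place[OF basis_factor_standard_off mP, symmetric])
    qed
    have X_0: "X (\<lambda>z. 0)" unfolding X_def
      by (rule closed_span_cong[OF closed_span_zero]) (simp add: tensor_upd[OF basis_factor_standard_off mP])
    have X_sum: "X (\<lambda>z. \<Sum>c\<in>F. h c z)" if "finite F" "\<And>c. c \<in> F \<Longrightarrow> X (h c)" for F :: "nat set" and h
      using that
    proof (induction F)
      case (insert c F)
      have "X (\<lambda>z. (\<Sum>c\<in>F. h c z) + 1 * h c z)" using insert by (intro X_add) auto
      then show ?case using insert by (simp add: add.commute)
    qed (use X_0 in simp)
    \<comment> \<open>With \<open>\<phi>p\<close> at m the tensor involves only places up to m0,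
      where the induction hypothesis applies.\<close>
    have X_phi: "X (\<phi>p m)"
    proof -
      have "?g(m := \<phi>p m) = basis_factor (int J) m0 b" by (auto simp: basis_factor_def m_def fun_eq_iff)
      then show ?thesis using prev by (simp add: X_def basis_tensor_def)
    qed
    have X_nonzero: "X (place_basis m (int k) (rt m r))" if "k \<le> J" "r \<in> Ir m" "r \<noteq> 0" for k r
      using that
    \<comment> \<open>Descent from level J, where the tensor is itself a generator; at a lower level
      it is the sum over its children, all with nonzero index.\<close>
    proof (induction "J - k" arbitrary: k r)
      case 0
      let ?b = "b(m := rt m r)"
      have "basis_tensor (int J) m n ?b \<in> closed_span A (translate_gens (int J))"
        using 0 Suc.prems pm rt_eq_0_iff[OF pm] Ip_Ir[OF pm]
        by (intro translate_gens_base) (auto simp: places_def m_def)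
      moreover have "?g(m := place_basis m (int J) (rt m r)) = basis_factor (int J) m ?b" by (auto simp: basis_factor_def fun_eq_iff)
      moreover have "k = J" using 0 by simp
      ultimately show ?case by (simp add: X_def basis_tensor_def)
    next
      case (Suc d)
      have "X (\<lambda>z. \<Sum>c<m. place_basis m (int (Suc k)) (rt m ((r + of_nat c) / of_nat m)) z)"
        using Suc Ir_child[OF pm Suc.prems(2)] child_nonzero[OF pm Suc.prems(2,3)]
        by (intro X_sum Suc.hyps(1)) auto
      then show ?case
        by (rule X_cong) (use place_basis_split[OF pm, of _ "int k" r] in \<open>simp add: add.commute\<close>)
    qed
    have X_zero: "X (place_basis m (int k) (rt m 0))" if "k \<le> J" for k
      using that
    proof (induction k)
      case 0
      show ?case by (rule X_cong[OF X_phi]) (simp add: place_basis_0_0[OF pm])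
    next
      case (Suc k)
      let ?e = "\<lambda>c. place_basis m (int (Suc k)) (rt m (of_nat c / of_nat m))"
      have zI: "0 \<in> Ir m" using padic_haar_place.zero_Ir[OF place[OF pm]] .
      have e: "X (?e c)" if "c \<in> {1..<m}" for c
        using that Suc.prems Ir_child[OF pm zI, of c] by (intro X_nonzero) auto
      \<comment> \<open>Of the m children of the ball around 0 only c = 0 contains 0; the others,
        subtracted here, are covered by \<open>X_nonzero\<close>.\<close>
      have "X (\<lambda>z. place_basis m (int k) (rt m 0) z + (-1) * (\<Sum>c\<in>{1..<m}. ?e c z))"
        using Suc e by (intro X_add X_sum) auto
      then show ?case
      proof (rule X_cong)
        fix z assume z: "z \<in> Qp m"
        have "{..<m} = insert 0 {1..<m}" using prime_gt_0_nat[OF pm] by auto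
        then have "place_basis m (int k) (rt m 0) z = ?e 0 z + (\<Sum>c\<in>{1..<m}. ?e c z)"
          using place_basis_split[OF pm z, of "int k" 0] by (simp add: add.commute)
        then show "place_basis m (int k) (rt m 0) z + (-1) * (\<Sum>c\<in>{1..<m}. ?e c z) = place_basis m (int (Suc k)) (rt m 0) z"
          by simp
      qed
    qed
    have "b m \<in> Ip m" using Suc.prems mP by (simp add: m_def)
    then obtain r where r: "b m = rt m r" "r \<in> Ir m" using Ip_Ir[OF pm] by auto
    have "X (place_basis m (int J) (b m))" using X_zero[of J] X_nonzero[of J r] r by (cases "r = 0") auto
    moreover have "?g(m := place_basis m (int J) (b m)) = ?g" by (auto simp: basis_factor_def fun_eq_iff)
    ultimately show ?thesis by (simp add: X_def basis_tensor_def m_def)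
  qed
qed

lemma brackets_eq_translates: assumes "0 \<le> j" shows "V_by_brackets A Vr Vp \<phi>p j = V_by_translates A \<Phi> j"
proof (rule antisym[OF _ translates_subset])
  obtain J where J: "j = int J" using assms by (metis nonneg_int_cases)
  show "V_by_brackets A Vr Vp \<phi>p j \<subseteq> V_by_translates A \<Phi> j"
    unfolding brackets_eq translates_eq J
    by (intro closed_span_minimal UN_least bracket_gens_closed_span basis_tensor_closed_span_translate_gens) auto
qed

text \<open>The generating sets are literally equal: for j >= 0 the function \<open>\<phi>p\<close>
  belongs to every local space, and finitely many exceptional primes lie below some place.\<close>

lemma brackets_eq_tensor_space:
  assumes j: "0 \<le> j"
  shows "V_by_brackets A Vr Vp \<phi>p j = tensor_space A \<phi>p (Vr j) (\<lambda>p. Vp p j)"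
proof -
  have "(\<Union>m\<in>places. bracket_gens j m) = {tensor f g |f g. f \<in> Vr j \<and> (\<forall>p. prime p \<longrightarrow> g p \<in> Vp p j) \<and>
      finite {p. prime p \<and> g p \<noteq> \<phi>p p}}" (is "?L = ?integral_off")
  proof
    show "?L \<subseteq> ?integral_off"
    proof
      fix t assume "t \<in> ?L"
      then obtain m where "t \<in> bracket_gens j m" by blast
      then obtain f g where t: "t = tensor f g" "f \<in> Vr j"
        "\<forall>p. prime p \<longrightarrow> (if p \<le> m then g p \<in> Vp p j else g p = \<phi>p p)" unfolding bracket_gens_def by blast
      have "\<forall>p. prime p \<longrightarrow> g p \<in> Vp p j"
        using t(3) phi_mem_Vp[OF _ j] by metis
      moreover have "finite {p. prime p \<and> g p \<noteq> \<phi>p p}"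
        by (rule finite_subset[of _ "{..m}"]) (use t(3) in \<open>auto split: if_splits\<close>)
      ultimately show "t \<in> ?integral_off" using t by blast
    qed
    show "?integral_off \<subseteq> ?L"
    proof
      fix t assume "t \<in> ?integral_off"
      then obtain f g where t: "t = tensor f g" "f \<in> Vr j" "\<forall>p. prime p \<longrightarrow> g p \<in> Vp p j"
        and fin: "finite {p. prime p \<and> g p \<noteq> \<phi>p p}" by blast
      obtain N where N: "\<forall>p\<in>{p. prime p \<and> g p \<noteq> \<phi>p p}. p \<le> N" using fin by (meson finite_nat_set_iff_bounded_le)
      obtain m where m: "m \<in> places" "\<forall>q. prime q \<longrightarrow> q > m \<longrightarrow> q > N" using prev_place[of N] by blast
      have "\<forall>p. prime p \<longrightarrow> (if p \<le> m then g p \<in> Vp p j else g p = \<phi>p p)"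
        using t(3) m(2) N by (auto simp: not_le) (meson leD)
      then have "t \<in> bracket_gens j m" unfolding bracket_gens_def using t(1,2) by blast
      then show "t \<in> ?L" using m(1) by blast
    qed
  qed
  then show ?thesis unfolding brackets_eq tensor_space_def by simp
qed

subsection \<open>Density and triviality of the intersection\<close>

text \<open>A finite box is a tensor of indicators. Its finitely many nonstandard factors are
  approximated by elements of the one-dimensional analyses, which have the dense unions needed at
  each place.\<close>

lemma dense_brackets: "L2 A \<subseteq> closed_span A (\<Union>j\<in>{0..}. V_by_brackets A Vr Vp \<phi>p j)"
  unfolding L2_A_eq
proof (rule closed_span_minimal, rule subsetI)
  let ?U = "\<Union>j\<in>{0..}. V_by_brackets A Vr Vp \<phi>p j"
  fix t assume "t \<in> finite_boxes"
  then obtain D C where t: "t = (\<lambda>x. indicator (D \<times> fbox C) x)" "D \<in> sets lborel" "emeasure lborel D < \<infinity>"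
     "sides C" "\<And>p. prime p \<Longrightarrow> emeasure (\<mu> p) (C p) < \<infinity>" unfolding finite_boxes_def by blast
  define S where "S = {p. prime p \<and> C p \<noteq> Zp p}"
  have S: "finite S" "\<And>p. p \<in> S \<Longrightarrow> prime p" "\<And>p. prime p \<Longrightarrow> p \<notin> S \<Longrightarrow> C p = Zp p"
    using t(4) by (auto simp: S_def sides_def)
  have standard_off: "standard_off S (\<lambda>p. indicator (C p))" using S by (auto simp: standard_off_def)
  have "tensor (indicator D) (\<lambda>p. indicator (C p)) \<in> closed_span A ?U"
  proof (rule tensor_closed_span[OF standard_off, where Sr = "\<Union>j. Vr j" and Sp = "\<lambda>p. \<Union>j. Vp p j"])
    show "(\<Union>j. Vr j) \<subseteq> L2 lborel" using Vr_L2 by auto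
    show "(\<Union>j. Vp p j) \<subseteq> L2 (\<mu> p)" if "p \<in> S" for p using S(2)[OF that] Vp_L2 by auto
    show "indicator D \<in> closed_span lborel (\<Union>j. Vr j)"
    proof -
      have "indicator D \<in> L2 lborel" using t by (intro L2_indicator) auto
      also have "L2 lborel = l2_closure lborel (\<Union>j. Vr j)" using real_mra by (simp add: real_mra_def l2_dense_def)
      also have "\<dots> \<subseteq> closed_span lborel (\<Union>j. Vr j)"
        unfolding closed_span_def by (intro l2_closure_mono) (auto intro: lin_span_base)
      finally show ?thesis .
    qed
    show "indicator (C p) \<in> closed_span (\<mu> p) (\<Union>j. Vp p j)" if p: "p \<in> S" for p
    proof -
      have "indicator (C p) \<in> L2 (\<mu> p)" using t(4,5) S(2)[OF p] sides_sets by (intro L2_indicator) auto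
      also have "L2 (\<mu> p) = l2_closure (\<mu> p) (\<Union>j. Vp p j)"
        using padic_mra[of p] S(2)[OF p] by (simp add: padic_mra_def l2_dense_def)
      also have "\<dots> \<subseteq> closed_span (\<mu> p) (\<Union>j. Vp p j)"
        unfolding closed_span_def by (intro l2_closure_mono) (auto intro: lin_span_base)
      finally show ?thesis .
    qed
    fix f g assume f: "f \<in> (\<Union>j. Vr j)" and g: "\<And>p. p \<in> S \<Longrightarrow> g p \<in> (\<Union>j. Vp p j)"
      "\<And>p. p \<notin> S \<Longrightarrow> g p = indicator (C p)"
    obtain j0 where j0: "f \<in> Vr j0" using f by blast
    have "\<exists>i. p \<in> S \<longrightarrow> g p \<in> Vp p i" for p using g(1)[of p] by blast
    then obtain i where i: "\<And>p. p \<in> S \<Longrightarrow> g p \<in> Vp p (i p)" by metis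
    \<comment> \<open>The factors come from different levels; the maximum is a common one, and 0 is
      included so that \<open>\<phi>p\<close> lies at level j as well.\<close>
    define j where "j = max 0 (Max (insert j0 (i ` S)))"
    have j: "0 \<le> j" "j0 \<le> j" "\<And>p. p \<in> S \<Longrightarrow> i p \<le> j"
      using S(1) by (auto simp: j_def le_max_iff_disj intro!: disjI2 Max_ge)
    \<comment> \<open>Outside \<open>S\<close> the indicator of the integers is exchanged for
      \<open>\<phi>p\<close> itself, since the tensor space asks for equality of functions and not
      just of values on \<open>Qp p\<close>.\<close>
    define g' where "g' p = (if p \<in> S then g p else \<phi>p p)" for p
    have "tensor f g' \<in> tensor_space A \<phi>p (Vr j) (\<lambda>p. Vp p j)"
      unfolding tensor_space_def
    proof (rule closed_span_base)
      have *: "\<forall>p. prime p \<longrightarrow> g' p \<in> Vp p j"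
      proof (intro allI impI)
        fix p :: nat assume p: "prime p"
        show "g' p \<in> Vp p j"
          using i[of p] j(3)[of p] Vp_mono[OF p, of "i p" j] phi_mem_Vp[OF p j(1)]
          by (cases "p \<in> S") (auto simp: g'_def)
      qed
      have **: "finite {p. prime p \<and> g' p \<noteq> \<phi>p p}"
        by (rule finite_subset[OF _ S(1)]) (auto simp: g'_def)
      have f': "f \<in> Vr j" using j0 j(2) Vr_mono by blast
      show "tensor f g' \<in> {tensor f g |f g. f \<in> Vr j \<and> (\<forall>p. prime p \<longrightarrow> g p \<in> Vp p j) \<and> finite {p. prime p \<and> g p \<noteq> \<phi>p p}}"
        using * ** f' by blast
      have "standard_off S g'" using S(1,2) by (auto simp: standard_off_def g'_def phi_indicator)
      then show "tensor f g' \<in> L2 A"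
      proof (rule tensor_L2(1)[rotated 1])
        show "f \<in> L2 lborel" using f' Vr_L2 by blast
        show "g' p \<in> L2 (\<mu> p)" if "p \<in> S" for p using * S(2)[OF that] Vp_L2 by blast
      qed
    qed
    then have "tensor f g' \<in> ?U" using j(1) brackets_eq_tensor_space[OF j(1)] by auto
    then have "tensor f g' \<in> closed_span A ?U"
      using closed_span_subset_L2 brackets_eq by (intro closed_span_base) auto
    then show "tensor f g \<in> closed_span A ?U"
    proof (rule closed_span_cong)
      fix x assume x: "x \<in> space A"
      show "tensor f g' x = tensor f g x"
      proof (rule tensor_cong[OF _ x])
        fix p :: nat and z assume p: "prime p" "z \<in> Qp p"
        show "g' p z = g p z" using g(2)[of p] S(3)[of p] p by (cases "p \<in> S") (auto simp: g'_def phi_indicator)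
      qed
    qed
  qed
  then show "t \<in> closed_span A ?U"
    by (rule closed_span_cong) (simp add: t(1) indicator_box_eq_tensor[OF t(4)])
qed

text \<open>In an increasing chain every finite combination already lies in one member, so the
  closure of the union is the closed span.\<close>

lemma increasing_union_dense:
  assumes L: "\<And>j. W j = closed_span A (T j)" and mono: "\<And>i j :: int. i \<le> j \<Longrightarrow> W i \<subseteq> W j"
    and dense: "L2 A \<subseteq> closed_span A (\<Union>j\<in>{0..}. W j)"
  shows "l2_dense A (\<Union>j. W j)"
proof -
  have WL: "W j \<subseteq> L2 A" for j unfolding L by (rule closed_span_subset_L2)
  have "lin_span (\<Union>j\<in>{0..}. W j) \<subseteq> (\<Union>j. W j)"
  proof
    fix w assume "w \<in> lin_span (\<Union>j\<in>{0..}. W j)"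
    then obtain c F where F: "finite F" "F \<subseteq> (\<Union>j\<in>{0..}. W j)" "w = (\<lambda>x. \<Sum>g\<in>F. c g * g x)"
      by (auto simp: lin_span_def)
    have "\<exists>i. h \<in> F \<longrightarrow> h \<in> W i" for h using F(2) by blast
    then obtain i where i: "\<And>h. h \<in> F \<Longrightarrow> h \<in> W (i h)" by metis
    define j where "j = Max (insert 0 (i ` F))"
    have "h \<in> W j" if "h \<in> F" for h
    proof -
      have "i h \<le> j" using that F(1) by (auto simp: j_def)
      then show ?thesis using i[OF that] mono by blast
    qed
    then have "w \<in> W j" unfolding L F(3) using F(1) by (intro closed_span_lincomb) auto
    then show "w \<in> (\<Union>j. W j)" by blast
  qed
  then have "L2 A \<subseteq> l2_closure A (\<Union>j. W j)"
    using dense l2_closure_mono[of _ "\<Union>j. W j" A] unfolding closed_span_def by blast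
  then show ?thesis using WL l2_closure_subset_L2[of A "\<Union>j. W j"] unfolding l2_dense_def by blast
qed

text \<open>Slices over boxes vanish almost everywhere, so \<open>F\<close> is orthogonal to every
  finite box; as these span everything, \<open>F\<close> is null.\<close>

lemma Inter_brackets_null:
  assumes F: "\<And>j. F \<in> V_by_brackets A Vr Vp \<phi>p j"
  shows "AE x in A. F x = 0"
proof -
  have FL: "F \<in> L2 A" using F[of 0] unfolding brackets_eq using closed_span_subset_L2 by blast
  show ?thesis
  proof (rule closed_span_orthogonal_zero[OF _ finite_boxes_L2])
    show "F \<in> closed_span A finite_boxes" using FL L2_A_eq by simp
    fix t assume "t \<in> finite_boxes"
    then obtain D C where t: "t = (\<lambda>x. indicator (D \<times> fbox C) x)" "D \<in> sets lborel" "emeasure lborel D < \<infinity>"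
       "sides C" "\<And>p. prime p \<Longrightarrow> emeasure (\<mu> p) (C p) < \<infinity>" unfolding finite_boxes_def by blast
    let ?K = "fbox C"
    have K: "?K \<in> sets Af" "emeasure Af ?K < \<infinity>"
      using t(4) vol_finite[OF t(4,5)] by (auto simp: emeasure_Af_box)
    have "LA.slice ?K F \<in> Vr j" for j
    proof -
      have "LA.slice ?K F \<in> closed_span lborel (Vr j)"
      proof (rule closed_span_map[where T = "LA.slice ?K" and M = A and S = "\<Union>m\<in>places. bracket_gens j m" and B = "measure Af ?K"])
        show "LA.slice ?K f \<in> L2 lborel" if "f \<in> L2 A" for f
          using LA.slice_L2(1)[OF _ K, of f] that by (simp add: A_eq_pair)
        show "AE y in lborel. LA.slice ?K (\<lambda>x. f x + c * g x) y = LA.slice ?K f y + c * LA.slice ?K g y"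
          if "f \<in> L2 A" "g \<in> L2 A" for f g c
          using LA.slice_add[OF _ _ K, of f g c] that by (simp add: A_eq_pair)
        show "l2_sq lborel (LA.slice ?K f) \<le> measure Af ?K * l2_sq A f" if "f \<in> L2 A" for f
          using LA.slice_L2(2)[OF _ K, of f] that by (simp add: A_eq_pair)
        show "(\<Union>m\<in>places. bracket_gens j m) \<subseteq> L2 A" using bracket_gens_L2 by auto
        show "F \<in> closed_span A (\<Union>m\<in>places. bracket_gens j m)" using F brackets_eq by simp
        fix f assume "f \<in> (\<Union>m\<in>places. bracket_gens j m)"
        then obtain f1 g where f: "f = tensor f1 g" "f1 \<in> Vr j" unfolding bracket_gens_def by blast
        have e: "f = (\<lambda>z. f1 (fst z) * fin_tensor g (snd z))" by (simp add: f tensor_eq_fin_tensor fun_eq_iff)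
        \<comment> \<open>The slice of a tensor is its real factor times a constant that carries all
          p-adic factors, so it stays in the real space of level j.\<close>
        have "(\<lambda>x. 0 + (LINT y|Af. indicator ?K y * fin_tensor g y) * f1 x) \<in> closed_span lborel (Vr j)"
          using f(2) Vr_L2 by (intro closed_span_add closed_span_zero closed_span_base) auto
        then show "LA.slice ?K f \<in> closed_span lborel (Vr j)"
          by (rule closed_span_cong) (simp add: e LA.slice_tensor mult.commute)
      qed
      also have "\<dots> \<subseteq> Vr j" using rs.V[of j] by (intro closed_subspace_closed_span) auto
      finally show ?thesis .
    qed
    then have "LA.slice ?K F \<in> l2_zero lborel" using real_mra by (auto simp: real_mra_def)
    then have z: "AE x in lborel. LA.slice ?K F x = 0" by (simp add: l2_zero_def)
    have "(LINT x|A. F x * cnj (t x)) = (LINT x|A. F x * indicator (D \<times> ?K) x)"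
      unfolding t(1) by (intro Bochner_Integration.integral_cong) (auto simp: indicator_def)
    also have "\<dots> = (LINT x|lborel. indicator D x * LA.slice ?K F x)"
      using LA.integral_rectangle[OF _ t(2,3) K, of F] FL by (simp add: A_eq_pair)
    also have "\<dots> = 0" using z by (intro integral_eq_zero_AE) auto
    finally show "(LINT x|A. F x * cnj (t x)) = 0" .
  qed
qed

lemma Inter_eq_zero:
  assumes W: "\<And>j. W j = closed_span A (T j)" and le: "\<And>j::int. W j \<subseteq> V_by_brackets A Vr Vp \<phi>p j"
  shows "(\<Inter>j. W j) = l2_zero A"
proof
  show "(\<Inter>j. W j) \<subseteq> l2_zero A"
  proof
    fix F assume F: "F \<in> (\<Inter>j. W j)"
    then have "F \<in> L2 A" using W[of 0] closed_span_subset_L2 by blast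
    moreover have "AE x in A. F x = 0" using F le by (intro Inter_brackets_null) blast
    ultimately show "F \<in> l2_zero A" by (simp add: l2_zero_def)
  qed
  show "l2_zero A \<subseteq> (\<Inter>j. W j)"
  proof
    fix F assume F: "F \<in> l2_zero A"
    have "F \<in> W j" for j unfolding W
      by (rule closed_span_cong_AE[OF closed_span_zero]) (use F in \<open>auto simp: l2_zero_def\<close>)
    then show "F \<in> (\<Inter>j. W j)" by blast
  qed
qed

subsection \<open>Dilations\<close>

definition adele_scale :: "nat \<Rightarrow> int \<Rightarrow> adele \<Rightarrow> adele" where
  "adele_scale m i x = (2 powi i * fst x, \<lambda>q\<in>{q. prime q}.
     if q \<le> m then padic_mult q (rt q (of_nat q powi (- i))) (snd x q) else snd x q)"

abbreviation psc :: "nat \<Rightarrow> int \<Rightarrow> padic \<Rightarrow> padic" where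
  "psc q i \<equiv> padic_mult q (rt q (of_nat q powi i))"

lemma dilation_eq: "dilation m i f x = dilation_const m i * f (adele_scale m i x)"
  by (simp only: dilation_def dilation_const_def adele_scale_def)

lemma psc_Qp: "prime q \<Longrightarrow> z \<in> Qp q \<Longrightarrow> psc q i z \<in> Qp q"
  using padic_place.scl_Qp[of q z] by (simp add: padic_place_def)

lemma psc_sets: "prime q \<Longrightarrow> C \<in> sets (\<mu> q) \<Longrightarrow> psc q i -` C \<inter> Qp q \<in> sets (\<mu> q)"
  using measurable_sets[OF padic_haar_place.pscl_measurable[OF place], of q C i] by (simp add: space_mu)

lemma emeasure_psc:
  "prime q \<Longrightarrow> C \<in> sets (\<mu> q) \<Longrightarrow> emeasure (\<mu> q) (psc q i -` C \<inter> Qp q) = ennreal (real q powi i) * emeasure (\<mu> q) C"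
  using padic_haar_place.emeasure_pscl[OF place] .

lemma psc_inverse: "prime q \<Longrightarrow> z \<in> Qp q \<Longrightarrow> psc q (- i) (psc q i z) = z"
  using padic_haar_place.pscl_pscl[OF place, of q z "- i" i] padic_place.scl_1[of q z]
  by (simp add: padic_place_def)

lemma finite_primes_upto: "finite (primes_upto m)"
  by (simp add: primes_upto_def)

lemma adele_scale_space: assumes x: "x \<in> space A" shows "adele_scale m i x \<in> space A"
proof -
  have y: "snd x \<in> Afin" using x by (auto simp: space_A)
  have "finite {p. prime p \<and> snd (adele_scale m i x) p \<notin> Zp p}"
  proof (rule finite_subset)
    show "{p. prime p \<and> snd (adele_scale m i x) p \<notin> Zp p} \<subseteq> {..m} \<union> {p. prime p \<and> snd x p \<notin> Zp p}"
      by (auto simp: adele_scale_def)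
    show "finite ({..m} \<union> {p. prime p \<and> snd x p \<notin> Zp p})" using y by (auto simp: Afin_def)
  qed
  moreover have "snd (adele_scale m i x) \<in> (\<Pi>\<^sub>E p\<in>{p. prime p}. Qp p)"
    using Afin_Qp[OF y] psc_Qp by (auto simp: adele_scale_def)
  ultimately have "snd (adele_scale m i x) \<in> Afin" by (simp add: Afin_def)
  then show ?thesis by (auto simp: space_A mem_Times_iff)
qed

lemma adele_scale_inverse: assumes x: "x \<in> space A" shows "adele_scale m i (adele_scale m (- i) x) = x"
proof -
  have y: "snd x \<in> Afin" using x by (auto simp: space_A)
  have "2 powi i * (2 powi (- i) * fst x) = fst x" by (simp add: power_int_minus)
  moreover have "snd (adele_scale m i (adele_scale m (- i) x)) q = snd x q" for q
    using psc_inverse[of q "snd x q" i] Afin_Qp[OF y, of q] y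
    by (cases "prime q") (auto simp: adele_scale_def Afin_def PiE_iff extensional_def)
  ultimately show ?thesis by (auto simp: adele_scale_def prod_eq_iff)
qed

definition scaled_sides :: "nat \<Rightarrow> int \<Rightarrow> (nat \<Rightarrow> padic set) \<Rightarrow> nat \<Rightarrow> padic set" where
  "scaled_sides m i C q = (if q \<le> m then psc q (- i) -` C q \<inter> Qp q else C q)"

lemma sides_scaled_sides: assumes C: "sides C" shows "sides (scaled_sides m i C)"
proof (rule sidesI[of "{..m} \<union> {p. prime p \<and> C p \<noteq> Zp p}"])
  show "scaled_sides m i C p \<in> sets (\<mu> p)" if "prime p" for p
    using psc_sets[OF that] sides_sets[OF C that] by (simp add: scaled_sides_def)
qed (use C in \<open>auto simp: sides_def scaled_sides_def\<close>)

lemma adele_scale_vimage_box: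
  assumes C: "sides C"
  shows "adele_scale m i -` (E \<times> fbox C) \<inter> space A = ((\<lambda>r. 2 powi i * r) -` E) \<times> fbox (scaled_sides m i C)"
proof (rule set_eqI)
  fix x
  show "x \<in> adele_scale m i -` (E \<times> fbox C) \<inter> space A \<longleftrightarrow> x \<in> ((\<lambda>r. 2 powi i * r) -` E) \<times> fbox (scaled_sides m i C)"
  proof (cases "snd x \<in> Afin")
    case True
    then have xA: "x \<in> space A" by (auto simp: space_A mem_Times_iff)
    then have DA: "snd (adele_scale m i x) \<in> Afin" using adele_scale_space[OF xA, of m i] by (auto simp: space_A)
    have "snd (adele_scale m i x) \<in> fbox C \<longleftrightarrow> (\<forall>p. prime p \<longrightarrow> snd (adele_scale m i x) p \<in> C p)"
      using fboxI[OF DA] fboxD by blast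
    also have "\<dots> \<longleftrightarrow> (\<forall>p. prime p \<longrightarrow> snd x p \<in> scaled_sides m i C p)"
      using Afin_Qp[OF True] by (auto simp: adele_scale_def scaled_sides_def)
    also have "\<dots> \<longleftrightarrow> snd x \<in> fbox (scaled_sides m i C)" using fboxI[OF True] fboxD by blast
    finally show ?thesis using xA by (auto simp: mem_Times_iff adele_scale_def)
  next
    case False
    then show ?thesis using fbox_subset[OF sides_scaled_sides[OF C, of m i]] by (auto simp: space_A)
  qed
qed

lemma vol_scaled_sides:
  assumes C: "sides C"
  shows "vol (scaled_sides m i C) = ennreal (\<Prod>q\<in>primes_upto m. real q powi (- i)) * vol C"
proof -
  define S where "S = primes_upto m \<union> {p. prime p \<and> C p \<noteq> Zp p}"
  have S: "finite S" "S \<subseteq> {p. prime p}" "\<And>p. prime p \<Longrightarrow> p \<notin> S \<Longrightarrow> C p = Zp p \<and> \<not> p \<le> m"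
    using C by (auto simp: S_def primes_upto_def sides_def)
  have "vol (scaled_sides m i C) = (\<Prod>q\<in>S. emeasure (\<mu> q) (scaled_sides m i C q))"
    using S by (intro vol_eq) (auto simp: scaled_sides_def)
  also have "\<dots> = (\<Prod>q\<in>S. (if q \<in> primes_upto m then ennreal (real q powi (- i)) else 1) * emeasure (\<mu> q) (C q))"
    using S(2) C by (intro prod.cong) (auto simp: scaled_sides_def primes_upto_def emeasure_psc sides_sets)
  also have "\<dots> = (\<Prod>q\<in>S. if q \<in> primes_upto m then ennreal (real q powi (- i)) else 1) * vol C"
    using S by (subst vol_eq[of S C]) (auto simp: prod.distrib)
  also have "(\<Prod>q\<in>S. if q \<in> primes_upto m then ennreal (real q powi (- i)) else 1) = (\<Prod>q\<in>primes_upto m. ennreal (real q powi (- i)))"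
    using S(1) by (intro prod.mono_neutral_cong_right) (auto simp: S_def)
  also have "\<dots> = ennreal (\<Prod>q\<in>primes_upto m. real q powi (- i))" by (intro prod_ennreal) auto
  finally show ?thesis .
qed

text \<open>Preimages under multiplication by 2^i on the line and by q^(-i) on Q_q are 2^(-i) and
  q^(-i) times as large. The product is the reciprocal of the square of
  \<open>dilation_const m i\<close>.\<close>

definition scale_factor :: "nat \<Rightarrow> int \<Rightarrow> real" where
  "scale_factor m i = 2 powi (- i) * (\<Prod>q\<in>primes_upto m. real q powi (- i))"

lemma scale_factor_pos: "scale_factor m i > 0"
  unfolding scale_factor_def by (intro mult_pos_pos prod_pos) (auto simp: primes_upto_def prime_gt_0_nat)

lemma emeasure_adele_scale_box:
  assumes E: "E \<in> sets lborel" and C: "sides C"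
  shows "emeasure A (adele_scale m i -` (E \<times> fbox C) \<inter> space A) = ennreal (scale_factor m i) * (emeasure lborel E * vol C)"
proof -
  have "(\<lambda>r. 2 powi i * r) -` E \<in> sets lborel"
    using measurable_sets[of "\<lambda>r::real. 2 powi i * r" lborel lborel E] E by simp
  then have "emeasure A (adele_scale m i -` (E \<times> fbox C) \<inter> space A) = emeasure lborel ((\<lambda>r. 2 powi i * r) -` E) * vol (scaled_sides m i C)"
    unfolding adele_scale_vimage_box[OF C] by (rule emeasure_A_box[OF _ sides_scaled_sides[OF C]])
  also have "emeasure lborel ((\<lambda>r. 2 powi i * r) -` E) = ennreal (2 powi (- i)) * emeasure lborel E"
    using emeasure_lborel_scale[OF _ E, of "2 powi i"] by (simp add: power_int_minus_divide)
  finally show ?thesis unfolding vol_scaled_sides[OF C] scale_factor_def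
    by (simp add: ennreal_mult prod_nonneg mult_ac)
qed

lemma adele_scale_measurable: "adele_scale m i \<in> measurable A A"
proof (rule measurable_sigma_sets[OF sets_A gens_Pow])
  show "adele_scale m i \<in> space A \<rightarrow> UNIV \<times> Afin" using adele_scale_space by (auto simp: space_A[symmetric])
  fix y assume "y \<in> gens"
  then obtain E C where y: "y = E \<times> fbox C" "E \<in> sets lborel" "sides C" unfolding fboxes_def by blast
  have "(\<lambda>r. 2 powi i * r) -` E \<in> sets lborel"
    using measurable_sets[of "\<lambda>r::real. 2 powi i * r" lborel lborel E] y by simp
  then show "adele_scale m i -` y \<inter> space A \<in> sets A"
    unfolding y(1) adele_scale_vimage_box[OF y(3)] by (rule box_sets_A) (rule sides_scaled_sides[OF y(3)])
qed

text \<open>The push-forward divided by the factor has the right value on every box, so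
  \<open>A_eqI\<close> identifies it with \<open>A\<close>.\<close>

lemma emeasure_adele_scale:
  assumes E: "E \<in> sets A"
  shows "emeasure A (adele_scale m i -` E \<inter> space A) = ennreal (scale_factor m i) * emeasure A E"
proof -
  have "density (distr A A (adele_scale m i)) (\<lambda>_. ennreal (1 / scale_factor m i)) = A"
  proof (rule A_eqI)
    fix E :: "real set" and C assume E: "E \<in> sets lborel" and C: "sides C"
    have "emeasure (density (distr A A (adele_scale m i)) (\<lambda>_. ennreal (1 / scale_factor m i))) (E \<times> fbox C)
      = ennreal (1 / scale_factor m i) * (ennreal (scale_factor m i) * (emeasure lborel E * vol C))"
      using box_sets_A[OF E C] by (simp add: emeasure_density_const emeasure_distr adele_scale_measurable emeasure_adele_scale_box[OF E C])
    also have "\<dots> = ennreal (1 / scale_factor m i * scale_factor m i) * (emeasure lborel E * vol C)"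
    proof -
      have "ennreal (1 / scale_factor m i * scale_factor m i) = ennreal (1 / scale_factor m i) * ennreal (scale_factor m i)"
        using scale_factor_pos[of m i] by (intro ennreal_mult) auto
      then show ?thesis by (simp only: mult.assoc)
    qed
    also have "\<dots> = emeasure lborel E * vol C" using scale_factor_pos[of m i] by simp
    finally show "emeasure (density (distr A A (adele_scale m i)) (\<lambda>_. ennreal (1 / scale_factor m i))) (E \<times> fbox C)
      = emeasure lborel E * vol C" .
  qed simp
  then have "emeasure A E = ennreal (1 / scale_factor m i) * emeasure A (adele_scale m i -` E \<inter> space A)"
    using emeasure_density_const[of E "distr A A (adele_scale m i)" "ennreal (1 / scale_factor m i)"] E
    by (simp add: emeasure_distr adele_scale_measurable)
  then have "ennreal (scale_factor m i) * emeasure A E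
      = ennreal (scale_factor m i * (1 / scale_factor m i)) * emeasure A (adele_scale m i -` E \<inter> space A)"
  proof -
    have "ennreal (scale_factor m i * (1 / scale_factor m i)) = ennreal (scale_factor m i) * ennreal (1 / scale_factor m i)"
      using scale_factor_pos[of m i] by (intro ennreal_mult) auto
    with \<open>emeasure A E = _\<close> show ?thesis by (simp only: mult.assoc)
  qed
  then show ?thesis using scale_factor_pos[of m i] by simp
qed

lemma dilation_L2:
  assumes f: "f \<in> L2 A"
  shows "dilation m i f \<in> L2 A" "l2_sq A (dilation m i f) = (cmod (dilation_const m i))\<^sup>2 * scale_factor m i * l2_sq A f"
proof -
  have e: "dilation m i f = (\<lambda>x. dilation_const m i * f (adele_scale m i x))" by (simp add: dilation_eq fun_eq_iff)
  have c: "(\<lambda>x. f (adele_scale m i x)) \<in> L2 A" "l2_sq A (\<lambda>x. f (adele_scale m i x)) = scale_factor m i * l2_sq A f"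
    using scaled_comp[OF adele_scale_measurable less_imp_le[OF scale_factor_pos] emeasure_adele_scale f] by auto
  show "dilation m i f \<in> L2 A" unfolding e using c(1) by (rule L2_scale)
  show "l2_sq A (dilation m i f) = (cmod (dilation_const m i))\<^sup>2 * scale_factor m i * l2_sq A f"
    unfolding e l2_sq_scale c(2) by simp
qed

lemma Vp_scaled: "prime p \<Longrightarrow> g \<in> Vp p j \<Longrightarrow> (\<lambda>z. g (psc p (- i) z)) \<in> Vp p (j + i)"
  using scaled_mra.scaled_map[OF padic_haar_place.padic_scaled_mra[OF place padic_mra], of p g j i] by simp

text \<open>A generator goes to a multiple of a generator: factors up to m move by i levels in their
  own analyses, and beyond m the dilation leaves \<open>\<phi>p\<close> alone. This is why m is the
  same on both sides.\<close>

lemma dilation_bracket: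
  assumes f: "f \<in> closed_span A (bracket_gens j m)"
  shows "dilation m i f \<in> closed_span A (bracket_gens (j + i) m)"
proof (rule closed_span_map[where T = "dilation m i" and M = A and S = "bracket_gens j m" and B = "(cmod (dilation_const m i))\<^sup>2 * scale_factor m i"])
  fix t assume "t \<in> bracket_gens j m"
  then obtain f g where t: "t = tensor f g" "f \<in> Vr j"
    "\<forall>p. prime p \<longrightarrow> (if p \<le> m then g p \<in> Vp p j else g p = \<phi>p p)" unfolding bracket_gens_def by blast
  define f' where "f' r = f (2 powi i * r)" for r
  define g' where "g' p = (if p \<le> m then (\<lambda>z. g p (psc p (- i) z)) else \<phi>p p)" for p
  have f': "f' \<in> Vr (j + i)" using rs.scaled_map[OF t(2), of i] by (simp add: f'_def[abs_def])
  have g': "\<forall>p. prime p \<longrightarrow> (if p \<le> m then g' p \<in> Vp p (j + i) else g' p = \<phi>p p)"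
  proof (intro allI impI)
    fix p :: nat assume p: "prime p"
    show "if p \<le> m then g' p \<in> Vp p (j + i) else g' p = \<phi>p p"
      using Vp_scaled[OF p, of "g p" j i] t(3) p by (auto simp: g'_def split: if_splits)
  qed
  have "tensor f' g' \<in> bracket_gens (j + i) m" unfolding bracket_gens_def using f' g' by blast
  then have "tensor f' g' \<in> closed_span A (bracket_gens (j + i) m)" using bracket_gens_L2 by (intro closed_span_base) auto
  then have "(\<lambda>x. 0 + dilation_const m i * tensor f' g' x) \<in> closed_span A (bracket_gens (j + i) m)"
    by (intro closed_span_add closed_span_zero)
  then show "dilation m i t \<in> closed_span A (bracket_gens (j + i) m)"
  proof (rule closed_span_cong)
    fix x :: adele
    have e: "g p (snd (adele_scale m i x) p) = g' p (snd x p)" if "prime p" for p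
      using that t(3) by (auto simp: g'_def adele_scale_def)
    have "tensor f g (adele_scale m i x) = tensor f' g' x"
    proof -
      have "{p. prime p \<and> g p (snd (adele_scale m i x) p) \<noteq> 1} = {p. prime p \<and> g' p (snd x p) \<noteq> 1}"
        using e by auto
      then have "(\<Prod>p | prime p \<and> g p (snd (adele_scale m i x) p) \<noteq> 1. g p (snd (adele_scale m i x) p))
        = (\<Prod>p | prime p \<and> g' p (snd x p) \<noteq> 1. g' p (snd x p))"
        using e by (intro prod.cong) auto
      moreover have "f (fst (adele_scale m i x)) = f' (fst x)" by (simp add: adele_scale_def f'_def)
      ultimately show ?thesis by (simp only: tensor_def)
    qed
    then show "0 + dilation_const m i * tensor f' g' x = dilation m i t x" by (simp add: dilation_eq t(1))
  qed
next
  show "AE y in A. dilation m i (\<lambda>x. f x + c * g x) y = dilation m i f y + c * dilation m i g y" for f g c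
    by (intro AE_I2) (simp add: dilation_eq algebra_simps)
qed (use f bracket_gens_L2 dilation_L2 in auto)

lemma dilation_bracket_iff:
  assumes f: "f \<in> L2 A"
  shows "f \<in> V_bracket A Vr Vp \<phi>p m j \<longleftrightarrow> dilation m 1 f \<in> V_bracket A Vr Vp \<phi>p m (j + 1)"
  unfolding bracket_eq
proof
  assume "f \<in> closed_span A (bracket_gens j m)"
  then show "dilation m 1 f \<in> closed_span A (bracket_gens (j + 1) m)" by (rule dilation_bracket)
next
  assume "dilation m 1 f \<in> closed_span A (bracket_gens (j + 1) m)"
  from dilation_bracket[OF this, of "-1"]
  have "dilation m (-1) (dilation m 1 f) \<in> closed_span A (bracket_gens j m)" by simp
  \<comment> \<open>The two coordinate scalings cancel; the two nonzero constants are divided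
    out.\<close>
  then have "(\<lambda>x. 0 + (1 / (dilation_const m (-1) * dilation_const m 1)) * dilation m (-1) (dilation m 1 f) x) \<in> closed_span A (bracket_gens j m)"
    by (intro closed_span_add closed_span_zero)
  then show "f \<in> closed_span A (bracket_gens j m)"
  proof (rule closed_span_cong)
    fix x assume x: "x \<in> space A"
    show "0 + (1 / (dilation_const m (-1) * dilation_const m 1)) * dilation m (-1) (dilation m 1 f) x = f x"
      using adele_scale_inverse[OF x, of m 1] dilation_const_nz by (simp add: dilation_eq)
  qed
qed

subsection \<open>The orthonormal basis\<close>

lemma dilation_0: assumes x: "x \<in> space A" shows "dilation m 0 f x = f x"
proof -
  have "adele_scale m 0 x = x"
  proof -
    have y: "snd x \<in> Afin" using x by (auto simp: space_A)
    have "snd (adele_scale m 0 x) q = snd x q" for q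
      using Afin_Qp[OF y, of q] y padic_place.scl_1[of q "snd x q"]
      by (cases "prime q") (auto simp: adele_scale_def Afin_def PiE_iff extensional_def padic_place_def)
    then show ?thesis by (auto simp: adele_scale_def prod_eq_iff)
  qed
  moreover have "dilation_const m 0 = 1"
  proof -
    have "(\<Prod>q | prime q \<and> q \<le> m. real q powr (of_int 0 / 2)) = (\<Prod>q | prime q \<and> q \<le> m. 1)"
      by (intro prod.cong) (auto dest: prime_gt_0_nat)
    then show ?thesis by (simp add: dilation_const_def)
  qed
  ultimately show ?thesis by (simp add: dilation_eq)
qed

text \<open>At level 0 a vanishing index gives \<open>\<phi>p\<close> again, so m may exceed the top
  place; two shifts can then be written over one m.\<close>

lemma shift_eq_basis_tensor:
  assumes a: "a \<in> IA" "top_place a \<le> m" and x: "x \<in> space A"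
  shows "shift a \<Phi> x = basis_tensor 0 m (floor (fst a)) (snd a) x"
proof -
  have "dilation m 0 (shift a \<Phi>) x = dilation_const m 0 * basis_tensor 0 m (floor (fst a)) (snd a) x"
  proof (rule dilation_shift[OF a(1) _ x])
    show "snd a q = rt q 0" if "prime q" "q > m" for q
      using top_place_props(2)[OF a(1) that(1)] that(2) a(2) by simp
  qed
  moreover have "dilation_const m 0 = 1"
    using dilation_0[OF x, of m "\<lambda>_. 1"] by (simp add: dilation_eq)
  ultimately show ?thesis using dilation_0[OF x] by simp
qed

lemma IA_Ip: "a \<in> IA \<Longrightarrow> prime p \<Longrightarrow> snd a p \<in> Ip p"
  by (auto simp: IA_def PiE_iff)

lemma shift_L2: assumes a: "a \<in> IA" shows "shift a \<Phi> \<in> L2 A"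
proof -
  have "\<forall>p\<in>primes_upto (top_place a). snd a p \<in> Ip p" using IA_Ip[OF a] by (auto simp: primes_upto_def)
  then show ?thesis
    using L2_cong[of A "shift a \<Phi>"] shift_eq_basis_tensor[OF a order_refl] basis_tensor_L2 by blast
qed

lemma translates_0: "V_by_translates A \<Phi> 0 = closed_span A ((\<lambda>a. shift a \<Phi>) ` IA)"
proof
  let ?S = "{dilation m 0 (shift a \<Phi>) |m a. a \<in> IA \<and> m \<in> places \<and> top_place a = m}"
  show "V_by_translates A \<Phi> 0 \<subseteq> closed_span A ((\<lambda>a. shift a \<Phi>) ` IA)"
    unfolding V_by_translates_def
  proof (rule closed_span_minimal, rule subsetI)
    fix t assume "t \<in> ?S"
    then obtain m a where t: "t = dilation m 0 (shift a \<Phi>)" "a \<in> IA" by blast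
    have "shift a \<Phi> \<in> closed_span A ((\<lambda>a. shift a \<Phi>) ` IA)"
      using t(2) shift_L2 by (intro closed_span_base) auto
    then show "t \<in> closed_span A ((\<lambda>a. shift a \<Phi>) ` IA)"
      by (rule closed_span_cong) (simp add: t(1) dilation_0)
  qed
  show "closed_span A ((\<lambda>a. shift a \<Phi>) ` IA) \<subseteq> V_by_translates A \<Phi> 0"
    unfolding V_by_translates_def
  proof (rule closed_span_minimal, rule subsetI)
    fix t assume "t \<in> (\<lambda>a. shift a \<Phi>) ` IA"
    then obtain a where t: "t = shift a \<Phi>" "a \<in> IA" by blast
    have "dilation (top_place a) 0 t \<in> closed_span A ?S"
    proof (rule closed_span_base)
      show "dilation (top_place a) 0 t \<in> ?S" using t top_place_props(1)[OF t(2)] by blast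
      show "dilation (top_place a) 0 t \<in> L2 A" unfolding t(1) using shift_L2[OF t(2)] by (rule dilation_L2)
    qed
    then show "t \<in> closed_span A ?S"
      by (rule closed_span_cong) (simp add: dilation_0)
  qed
qed

lemma l2_inner_self: "l2_inner M f f = complex_of_real (l2_sq M f)"
  unfolding l2_inner_def l2_sq_def integral_complex_of_real[symmetric]
  by (intro Bochner_Integration.integral_cong) (auto simp: complex_norm_square[symmetric] simp del: of_real_power)

lemma l2_sq_place_basis_0: assumes p: "prime p" and a: "a \<in> Ip p" shows "l2_sq (\<mu> p) (place_basis p 0 a) = 1"
proof -
  have "l2_inner (\<mu> p) (\<lambda>x. \<phi>p p (padic_diff p x a)) (\<lambda>x. \<phi>p p (padic_diff p x a)) = 1"
    using padic_mra[OF p] a by (auto simp: padic_mra_def orthonormal_basis_def)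
  then have "l2_sq (\<mu> p) (\<lambda>x. \<phi>p p (padic_diff p x a)) = 1" by (simp add: l2_inner_self)
  moreover have "l2_sq (\<mu> p) (place_basis p 0 a) = l2_sq (\<mu> p) (\<lambda>x. \<phi>p p (padic_diff p x a))"
    using p padic_place.scl_1[of p] by (intro l2_sq_cong) (simp add: place_basis_def space_mu padic_place_def)
  ultimately show ?thesis by simp
qed

text \<open>A common point of the two unit balls would put the indices within distance 1, against
  \<open>Ip_far\<close>.\<close>

lemma place_basis_0_disjoint:
  assumes p: "prime p" and ab: "a \<in> Ip p" "b \<in> Ip p" "a \<noteq> b" and z: "z \<in> Qp p"
  shows "place_basis p 0 a z = 0 \<or> place_basis p 0 b z = 0"
proof (rule ccontr)
  interpret h: haar_padic_mra p "\<mu> p" "Vp p" "\<phi>p p" by (rule place_mra) (rule p)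
  assume "\<not> ?thesis"
  then have le: "padic_norm p (padic_diff p z a) \<le> 1" "padic_norm p (padic_diff p z b) \<le> 1"
    using p z ab Ip_Qp[OF p] by (auto simp: place_basis_eq h.padic_basis_val split: if_splits)
  have "padic_norm p (padic_diff p a b) \<le> max (padic_norm p (padic_diff p a z)) (padic_norm p (padic_diff p z b))"
    using z ab Ip_Qp[OF p] by (intro h.nrm_triangle) auto
  then have "padic_norm p (padic_diff p a b) \<le> 1"
    using le h.nrm_commute[of a z] z ab Ip_Qp[OF p] by (auto simp: max_def split: if_splits)
  then show False using h.Ip_far[OF ab] by simp
qed

text \<open>Over a common m the inner product splits into a real part, covered by the real analysis,
  and a finite adelic part. The latter is a product of unit norms for equal indices.\<close>

lemma shift_orthonormal:
  assumes a: "a \<in> IA" and b: "b \<in> IA"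
  shows "l2_inner A (shift a \<Phi>) (shift b \<Phi>) = (if a = b then 1 else 0)"
proof -
  define m where "m = max (top_place a) (top_place b)"
  let ?n = "floor (fst a)" and ?k = "floor (fst b)"
  let ?ga = "basis_factor 0 m (snd a)" and ?gb = "basis_factor 0 m (snd b)"
  have fl: "of_int ?n = fst a" "of_int ?k = fst b" using a b by (auto simp: IA_def elim: Ints_cases)
  have L: "fin_tensor (basis_factor 0 m (snd c)) \<in> L2 Af" if "c \<in> IA" for c
    using IA_Ip[OF that] by (intro fin_tensor_L2(1)[OF basis_factor_standard_off]) (auto simp: basis_factor_def primes_upto_def place_basis_L2)
  have "l2_inner A (shift a \<Phi>) (shift b \<Phi>) = l2_inner A (basis_tensor 0 m ?n (snd a)) (basis_tensor 0 m ?k (snd b))"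
    unfolding l2_inner_def using shift_eq_basis_tensor[OF a, of m] shift_eq_basis_tensor[OF b, of m]
    by (intro Bochner_Integration.integral_cong) (auto simp: m_def)
  also have "\<dots> = l2_inner A (\<lambda>z. real_basis 0 ?n (fst z) * fin_tensor ?ga (snd z)) (\<lambda>z. real_basis 0 ?k (fst z) * fin_tensor ?gb (snd z))"
    by (simp add: basis_tensor_def tensor_eq_fin_tensor[abs_def])
  also have "\<dots> = l2_inner lborel (real_basis 0 ?n) (real_basis 0 ?k) * l2_inner Af (fin_tensor ?ga) (fin_tensor ?gb)"
    using LA.l2_inner_pair[OF real_basis_L2 real_basis_L2 L[OF a] L[OF b], of 0 ?n 0 ?k] by (simp add: A_eq_pair)
  also have "l2_inner lborel (real_basis 0 ?n) (real_basis 0 ?k) = (if ?n = ?k then 1 else 0)"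
    using real_mra by (simp add: real_basis_def[abs_def] real_mra_def orthonormal_basis_def)
  also have "l2_inner Af (fin_tensor ?ga) (fin_tensor ?gb) = (if snd a = snd b then 1 else 0)"
  proof (cases "snd a = snd b")
    case True
    have "l2_inner Af (fin_tensor ?ga) (fin_tensor ?gb) = complex_of_real (l2_sq Af (fin_tensor ?ga))" by (simp add: True l2_inner_self)
    also have "l2_sq Af (fin_tensor ?ga) = (\<Prod>p\<in>primes_upto m. l2_sq (\<mu> p) (?ga p))"
      using IA_Ip[OF a] by (intro fin_tensor_L2(2)[OF basis_factor_standard_off]) (auto simp: basis_factor_def primes_upto_def place_basis_L2)
    also have "\<dots> = (\<Prod>p\<in>primes_upto m. 1)"
      using IA_Ip[OF a] by (intro prod.cong) (auto simp: basis_factor_def primes_upto_def l2_sq_place_basis_0)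
    finally show ?thesis using True by simp
  next
    case False
    have "\<exists>p. prime p \<and> snd a p \<noteq> snd b p"
    proof (rule ccontr)
      assume "\<not> ?thesis"
      then have "snd a = snd b" using a b by (intro PiE_ext[of _ "{p. prime p}" Ip]) (auto simp: IA_def)
      then show False using False by simp
    qed
    then obtain p where p: "prime p" "snd a p \<noteq> snd b p" by blast
    have "p \<le> m"
    proof (rule ccontr)
      assume "\<not> p \<le> m"
      then have "snd a p = rt p 0" "snd b p = rt p 0"
        using top_place_props(2)[OF a p(1)] top_place_props(2)[OF b p(1)] by (auto simp: m_def)
      then show False using p(2) by simp
    qed
    then have pm: "p \<in> primes_upto m" using p(1) by (simp add: primes_upto_def)
    \<comment> \<open>One prime with different indices suffices: the supports at that place are
      disjoint, so the integrand vanishes pointwise.\<close>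
    have "fin_tensor ?ga y * cnj (fin_tensor ?gb y) = 0" if y: "y \<in> Afin" for y
    proof -
      have "?ga p (y p) = 0 \<or> ?gb p (y p) = 0"
        using place_basis_0_disjoint[OF p(1) IA_Ip[OF a p(1)] IA_Ip[OF b p(1)] p(2) Afin_Qp[OF y p(1)]] \<open>p \<le> m\<close>
        by (simp add: basis_factor_def)
      then have "(\<Prod>q\<in>primes_upto m. ?ga q (y q)) = 0 \<or> (\<Prod>q\<in>primes_upto m. ?gb q (y q)) = 0"
        using pm finite_primes_upto by (meson prod_zero)
      then have "fin_tensor ?ga y = 0 \<or> fin_tensor ?gb y = 0" using fin_tensor_eq[OF basis_factor_standard_off y] by (metis mult_zero_right)
      then show ?thesis by auto
    qed
    then have "l2_inner Af (fin_tensor ?ga) (fin_tensor ?gb) = (LINT y|Af. 0)"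
      unfolding l2_inner_def by (intro Bochner_Integration.integral_cong) auto
    then show ?thesis using False by simp
  qed
  finally show ?thesis using fl by (auto simp: prod_eq_iff)
qed

lemma shift_orthonormal_basis: "orthonormal_basis A IA (\<lambda>a. shift a \<Phi>) (V_by_translates A \<Phi> 0)"
  unfolding orthonormal_basis_def translates_0
  using shift_orthonormal shift_L2 by (auto intro: closed_span_base)

lemma Phi_in_V0: "\<Phi> \<in> V_by_translates A \<Phi> 0"
proof -
  have f: "\<phi>r \<in> Vr 0" using real_mra by (simp add: real_mra_def)
  \<comment> \<open>The infinite place is 0, below every prime, so only the real factor is
    constrained beyond being standard.\<close>
  have "\<Phi> \<in> bracket_gens 0 0" unfolding bracket_gens_def using f by (auto simp: dest: prime_gt_0_nat)
  then have "\<Phi> \<in> closed_span A (\<Union>m\<in>places. bracket_gens 0 m)"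
    using bracket_gens_L2 by (intro closed_span_base) (auto simp: places_def)
  then show ?thesis using brackets_eq brackets_eq_translates[of 0] by simp
qed

end

section \<open>All properties for either of the two families\<close>

theorem theorem6p2:
  fixes \<mu> :: "nat \<Rightarrow> padic measure" and A :: "adele measure"
    and Vr :: "int \<Rightarrow> (real \<Rightarrow> complex) set" and \<phi>r :: "real \<Rightarrow> complex"
    and Vp :: "nat \<Rightarrow> int \<Rightarrow> (padic \<Rightarrow> complex) set" and \<phi>p :: "nat \<Rightarrow> padic \<Rightarrow> complex"
    and \<Phi> :: "adele \<Rightarrow> complex"
    and V :: "int \<Rightarrow> (adele \<Rightarrow> complex) set"
  assumes "\<And>p. prime p \<Longrightarrow> padic_haar p (\<mu> p)"
    and "adele_haar \<mu> A"
    and "real_mra Vr \<phi>r"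
    and "\<And>p. prime p \<Longrightarrow> padic_mra p (\<mu> p) (Vp p) (\<phi>p p)"
    and "\<And>p x. prime p \<Longrightarrow> x \<in> Qp p \<Longrightarrow> \<phi>p p x = (if padic_norm p x \<le> 1 then 1 else 0)"
    and "\<Phi> = tensor \<phi>r \<phi>p"
    and "V = V_by_brackets A Vr Vp \<phi>p \<or> V = V_by_translates A \<Phi>"
  shows
    "(\<forall>j. V_by_translates A \<Phi> j \<subseteq> V_by_brackets A Vr Vp \<phi>p j) \<and>
     (\<forall>j\<ge>0. V_by_brackets A Vr Vp \<phi>p j = V_by_translates A \<Phi> j) \<and>
     (\<forall>j\<ge>0. V j = tensor_space A \<phi>p (Vr j) (\<lambda>p. Vp p j)) \<and>
     (\<forall>j. V j \<subseteq> V (j + 1)) \<and>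
     l2_dense A (\<Union>j. V j) \<and>
     (\<Inter>j. V j) = l2_zero A \<and>
     (\<forall>j. \<forall>m\<in>places. \<forall>f\<in>L2 A.
        f \<in> V_bracket A Vr Vp \<phi>p m j \<longleftrightarrow> dilation m 1 f \<in> V_bracket A Vr Vp \<phi>p m (j + 1)) \<and>
     \<Phi> \<in> V 0 \<and>
     orthonormal_basis A IA (\<lambda>a. shift a \<Phi>) (V 0)"
proof -
  interpret adele_mra \<mu> A Vr \<phi>r Vp \<phi>p
    using assms(1-5) by unfold_locales auto
  have Phi: "\<Phi> = tensor \<phi>r \<phi>p" by (rule assms(6))
  have nonneg: "V j = V_by_brackets A Vr Vp \<phi>p j" if "0 \<le> j" for j
    using assms(7) brackets_eq_translates[OF that] Phi by auto
  have sub: "V j \<subseteq> V_by_brackets A Vr Vp \<phi>p j" for j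
    using assms(7) translates_subset[of j] Phi by auto
  have mono: "V j \<subseteq> V (j + 1)" for j
    using assms(7) brackets_mono[of j] translates_mono[of j] Phi by auto
  have mono_le: "i \<le> j \<Longrightarrow> V i \<subseteq> V j" for i j
  proof (induction j rule: int_ge_induct)
    case (step j)
    then show ?case using mono[of j] by blast
  qed simp
  \<comment> \<open>Both families are closed spans at every level; \<open>T\<close> names the
    generators of whichever one \<open>V\<close> is.\<close>
  obtain T where T: "\<And>j. V j = closed_span A (T j)"
    using assms(7)
  proof
    assume "V = V_by_brackets A Vr Vp \<phi>p"
    then show thesis by (intro that[of "\<lambda>j. \<Union>m\<in>places. bracket_gens j m"]) (simp add: brackets_eq)
  next
    assume "V = V_by_translates A \<Phi>"
    then show thesis by (intro that[of translate_gens]) (simp add: translates_eq Phi)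
  qed
  \<comment> \<open>Density concerns nonnegative levels, where \<open>V\<close> agrees with the
    brackets in both cases.\<close>
  have Veq: "(\<Union>j\<in>{0..}. V j) = (\<Union>j\<in>{0..}. V_by_brackets A Vr Vp \<phi>p j)"
    using nonneg by auto
  have dense: "l2_dense A (\<Union>j. V j)"
    by (rule increasing_union_dense[OF T mono_le]) (use dense_brackets Veq in simp_all)
  have V0: "V 0 = V_by_translates A \<Phi> 0"
    using nonneg[of 0] brackets_eq_translates[of 0] Phi by simp
  show ?thesis
  proof (intro conjI allI impI ballI)
    show "V_by_translates A \<Phi> j \<subseteq> V_by_brackets A Vr Vp \<phi>p j" for j
      unfolding Phi by (rule translates_subset)
    show "V_by_brackets A Vr Vp \<phi>p j = V_by_translates A \<Phi> j" if "0 \<le> j" for j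
      unfolding Phi using that by (rule brackets_eq_translates)
    show "V j = tensor_space A \<phi>p (Vr j) (\<lambda>p. Vp p j)" if "0 \<le> j" for j
      unfolding nonneg[OF that] using that by (rule brackets_eq_tensor_space)
    show "(\<Inter>j. V j) = l2_zero A" by (rule Inter_eq_zero[OF T sub])
    show "f \<in> V_bracket A Vr Vp \<phi>p m j \<longleftrightarrow> dilation m 1 f \<in> V_bracket A Vr Vp \<phi>p m (j + 1)"
      if "f \<in> L2 A" for j m f using that by (rule dilation_bracket_iff)
    show "\<Phi> \<in> V 0" unfolding V0 unfolding Phi by (rule Phi_in_V0)
    show "orthonormal_basis A IA (\<lambda>a. shift a \<Phi>) (V 0)"
      unfolding V0 unfolding Phi by (rule shift_orthonormal_basis)
  qed (rule mono dense)+
qed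

end
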